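(* For every integer $n\ge 0$, \[ \eta_{4}(25n+24)\equiv 0 \pmod{5}\qquad\text{and}\qquad \eta_{6}(49n+47)\equiv 0 \pmod{7}. \]
   Context: The rank of a partition is its largest part minus its number of parts. For integers $m$ and $n\ge 1$, $N(m,n)$ denotes the number of partitions of $n$ with rank $m$. For an integer $x$ and $k\ge 0$, $\binom{x}{k}=x(x-1)\cdots(x-k+1)/k!$ (the polynomial binomial coefficient, so $x$ may be negative). For $k\ge 1$ and $n\ge 1$ the symmetrized $k$-th rank moment is \[ \eta_{k}(n)=\sum_{m=-\infty}^{\infty}\binom{m+\lfloor \frac{k-1}{2}\rfloor}{k}N(m,n). \] In particular $\eta_4(n)=\sum_m\binom{m+1}{4}N(m,n)$ and $\eta_6(n)=\sum_m\binom{m+2}{6}N(m,n)$. *)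

theory Defs
  imports
    Complex_Main
    "HOL-Library.Multiset"
    "HOL-Library.Groups_Big_Fun"
    "HOL-Number_Theory.Cong"
begin

definition partitions :: "nat \<Rightarrow> nat multiset set" where
  "partitions n = {p. 0 \<notin># p \<and> \<Sum>\<^sub># p = n}"

(* Only meaningful for a nonempty partition. *)
definition partition_rank :: "nat multiset \<Rightarrow> int" where
  "partition_rank p = int (Max (set_mset p)) - int (size p)"

definition rank_count :: "int \<Rightarrow> nat \<Rightarrow> nat" where
  "rank_count m n = card {p \<in> partitions n. partition_rank p = m}"

(* The unfolding of gchoose at type int, where the division is exact. It is written out because
   a sort constraint in Complex_Main restricts gchoose to fields when terms are parsed. *)
definition int_choose :: "int \<Rightarrow> nat \<Rightarrow> int" where
  "int_choose x k = (\<Prod>i=0..<k. x - int i) div fact k"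

lemma fact_mult_int_choose: "fact k * int_choose x k = (\<Prod>i=0..<k. x - int i)"
  using gbinomial_int_mult_fact[of k x] by (simp add: int_choose_def gbinomial_prod_rev)

lemma of_int_int_choose: "of_int (int_choose x k) = (of_int x :: 'a::field_char_0) gchoose k"
  using of_int_gbinomial[of x k, where ?'a = 'a]
  by (simp add: int_choose_def gbinomial_prod_rev[where ?'a = int])

(* Sum_any is the sum over all integers m; the summand is finitely supported, as proved below. *)
definition sym_rank_moment :: "nat \<Rightarrow> nat \<Rightarrow> int" where
  "sym_rank_moment k n =
     Sum_any (\<lambda>m::int. int_choose (m + int ((k - 1) div 2)) k * int (rank_count m n))"

lemma size_le_sum_mset_pos:
  fixes p :: "nat multiset"
  assumes "0 \<notin># p"
  shows "size p \<le> \<Sum>\<^sub># p"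
  using assms by (induction p) auto

lemma finite_partitions: "finite (partitions n)"
proof -
  have "partitions n \<subseteq> mset ` {xs. set xs \<subseteq> {..n} \<and> length xs \<le> n}"
  proof
    fix p assume p: "p \<in> partitions n"
    obtain xs where xs: "p = mset xs" by (metis ex_mset)
    have "length xs \<le> n"
      using p size_le_sum_mset_pos[of p] by (simp add: partitions_def xs)
    moreover have "set xs \<subseteq> {..n}"
      using p member_le_sum_list[of _ xs] by (auto simp: partitions_def xs sum_mset_sum_list)
    ultimately show "p \<in> mset ` {xs. set xs \<subseteq> {..n} \<and> length xs \<le> n}"
      using xs by blast
  qed
  moreover have "finite {xs. set xs \<subseteq> {..n} \<and> length xs \<le> n}"
    by (rule finite_lists_length_le) simp
  ultimately show ?thesis
    by (meson finite_surj)
qed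

lemma finite_rank_count_support: "finite {m. rank_count m n \<noteq> 0}"
proof -
  have "{m. rank_count m n \<noteq> 0} \<subseteq> partition_rank ` partitions n"
    by (auto simp: rank_count_def card_eq_0_iff)
  then show ?thesis
    using finite_partitions finite_surj by blast
qed

lemma sym_rank_moment_eq_sum:
  "sym_rank_moment k n =
     (\<Sum>m | rank_count m n \<noteq> 0. int_choose (m + int ((k - 1) div 2)) k * int (rank_count m n))"
  unfolding sym_rank_moment_def
  by (rule Sum_any.expand_superset[OF finite_rank_count_support]) auto

end

theory Submission
  imports Defs "HOL-Computational_Algebra.Formal_Power_Series"
begin

text \<open>
  Modulo 5 the binomial coefficient weights reduce the first moment to the rank moments \<open>N\<^sub>2\<close> and
  \<open>N\<^sub>4\<close>, modulo 7 the second one to \<open>N\<^sub>2\<close>, \<open>N\<^sub>4\<close>, \<open>N\<^sub>6\<close>; all of these vanish on the given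
  progressions.

  Dyson's adjoint bijection (remove the first column, of length \<open>l\<close>, of a Ferrers diagram and add a
  row of length \<open>l + r\<close>) gives a two-term recurrence for the number \<open>A(m, n)\<close> of partitions of \<open>n\<close>
  with rank at most \<open>m\<close>. Multiplied by \<open>24 n - 1 + (2 m + 1)\<^sup>2\<close>, the recurrence says that the series
  \<open>\<Sum> (24 n - 1 + (2 m + 1)\<^sup>2) A(m, n) z\<^sup>m q\<^sup>n\<close> transforms under \<open>z \<mapsto> z q\<close> like the inverse cube of
  the Jacobi theta function, so its product with that cube is a single term. This is the rank-crank
  partial differential equation of Atkin and Garvan.

  Expanding in \<open>t\<close> with \<open>z = exp (2 t)\<close> expresses the rank moments through \<open>P\<close>, the generating
  function of partitions, times polynomials in the \<open>q\<close>-derivatives of the cube of the Euler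
  function, that is, in Eisenstein series. On the progressions \<open>24 n - 1\<close> is divisible by 25, resp.
  49, so the operator \<open>24 q d/dq - 1\<close> may be dropped, which gives linear relations between the
  coefficients of \<open>P\<close> times such polynomials. The remaining coefficients vanish by writing \<open>P\<close> as
  \<open>P\<^sup>5\<close> or \<open>P\<^sup>7\<close> times a lacunary series (the \<open>p\<close>-th power being a series in \<open>q\<^sup>p\<close> modulo \<open>p\<close>)
  and looking at quadratic forms modulo \<open>p\<close>. Euler's and Jacobi's identities for the Euler
  function and its cube also come out of the recurrence and the differential equation.
\<close>

unbundle fps_syntax

section \<open>Dyson's bijection\<close>

text \<open>The inserted 0 gives the empty partition largest part 0, hence rank 0; Dyson's map can
  take it as argument or as value.\<close>

definition largest_part :: "nat multiset \<Rightarrow> nat" where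
  "largest_part p = Max (insert 0 (set_mset p))"

definition rank0 :: "nat multiset \<Rightarrow> int" where
  "rank0 p = int (largest_part p) - int (size p)"

lemma largest_part_empty [simp]: "largest_part {#} = 0"
  by (simp add: largest_part_def)

lemma le_largest_part: "x \<in># p \<Longrightarrow> x \<le> largest_part p"
  by (simp add: largest_part_def)

lemma largest_part_le_iff: "largest_part p \<le> k \<longleftrightarrow> (\<forall>x\<in>#p. x \<le> k)"
  by (simp add: largest_part_def)

lemma largest_part_in: "p \<noteq> {#} \<Longrightarrow> largest_part p \<in># p"
proof -
  assume "p \<noteq> {#}"
  then have "Max (insert 0 (set_mset p)) = Max (set_mset p)"
    by simp
  moreover have "Max (set_mset p) \<in> set_mset p"
    using \<open>p \<noteq> {#}\<close> by (intro Max_in) auto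
  ultimately show ?thesis by (simp add: largest_part_def)
qed

lemma largest_part_eqI: "x \<in># p \<Longrightarrow> (\<And>y. y \<in># p \<Longrightarrow> y \<le> x) \<Longrightarrow> largest_part p = x"
  using le_largest_part[of x p] largest_part_le_iff[of p x] by (intro antisym) blast+

lemma rank0_eq_partition_rank: "p \<noteq> {#} \<Longrightarrow> rank0 p = partition_rank p"
  by (simp add: rank0_def partition_rank_def largest_part_def)

text \<open>The filter deletes the rows emptied by removing the first column, and also the new row
  when its length is 0.\<close>

definition dyson :: "int \<Rightarrow> nat multiset \<Rightarrow> nat multiset" where
  "dyson r p = filter_mset (\<lambda>x. 0 < x) (image_mset (\<lambda>x. x - 1) p + {#nat (int (size p) + r)#})"

text \<open>A column of length \<open>largest_part p - r\<close> is put in front of the other rows;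
  the ones are the rows that this column creates.\<close>

definition dyson_inv :: "int \<Rightarrow> nat multiset \<Rightarrow> nat multiset" where
  "dyson_inv r p = (let p' = p - {#largest_part p#} in
     image_mset Suc p' + replicate_mset (nat (int (largest_part p) - r) - size p') 1)"

lemma sum_mset_filter_pos: "\<Sum>\<^sub># (filter_mset (\<lambda>x. 0 < x) p) = (\<Sum>\<^sub># p :: nat)"
  by (induction p) auto

lemma sum_mset_minus_one: "0 \<notin># p \<Longrightarrow> \<Sum>\<^sub># (image_mset (\<lambda>x. x - 1) p) + size p = (\<Sum>\<^sub># p :: nat)"
  by (induction p) auto

lemma sum_mset_image_Suc: "\<Sum>\<^sub># (image_mset Suc p) = \<Sum>\<^sub># p + size p"
  by (induction p) auto

lemma filter_pos_eq: "0 \<notin># p \<Longrightarrow> filter_mset (\<lambda>x. 0 < x) p = (p :: nat multiset)"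
  by (induction p) auto

text \<open>Parts equal to 1 vanish with the first column; the padding restores them because
  \<open>size p\<close> remembers how many there were.\<close>

lemma image_Suc_pred_pad:
  "0 \<notin># p \<Longrightarrow> image_mset Suc (filter_mset (\<lambda>x. 0 < x) (image_mset (\<lambda>x. x - 1) p))
     + replicate_mset (size p - size (filter_mset (\<lambda>x. 0 < x) (image_mset (\<lambda>x. x - 1) p))) 1 = p"
proof (induction p)
  case (add x p)
  let ?f = "filter_mset (\<lambda>x. 0 < x) (image_mset (\<lambda>x. x - 1) p)"
  have le: "size ?f \<le> size p"
    using size_filter_mset_lesseq[of _ "image_mset (\<lambda>x. x - 1) p"] by simp
  have IH: "image_mset Suc ?f + replicate_mset (size p - size ?f) 1 = p"
    using add by simp
  show ?case
  proof (cases "x = 1")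
    case True
    have "Suc (size p) - size ?f = Suc (size p - size ?f)" using le by simp
    then show ?thesis using IH True by simp
  next
    case False
    then have "Suc (x - 1) = x" "0 < x - 1" using add.prems by auto
    then show ?thesis using IH by simp
  qed
qed simp

text \<open>The rank bound makes the new row at least as long as every shortened row, so it is the
  largest part of the image and \<open>dyson_inv\<close> finds it again. In the excluded case its
  length would be -1.\<close>

lemma dyson_image:
  assumes p: "0 \<notin># p" and rk: "rank0 p \<le> r + 1" and ex: "\<not> (p = {#} \<and> r = -1)"
  shows "0 \<notin># dyson r p" "int (\<Sum>\<^sub># (dyson r p)) = int (\<Sum>\<^sub># p) + r"
    "rank0 (dyson r p) \<ge> r - 1" "dyson_inv r (dyson r p) = p" "\<not> (dyson r p = {#} \<and> r = 1)"
proof -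
  let ?m = "image_mset (\<lambda>x. x - 1) p" and ?M = "nat (int (size p) + r)"
  let ?f = "filter_mset (\<lambda>x. 0 < x) ?m"
  have M: "int (size p) + r \<ge> 0"
  proof (cases "p = {#}")
    case True
    then show ?thesis using rk ex by (auto simp: rank0_def)
  next
    case False
    then have "largest_part p \<ge> 1"
      using largest_part_in[OF False] p by (metis not_less_eq_eq One_nat_def le_zero_eq nat_le_linear)
    then show ?thesis using rk by (simp add: rank0_def)
  qed
  have le: "x - 1 \<le> ?M" if "x \<in># p" for x
    using le_largest_part[OF that] rk M by (auto simp: rank0_def)
  show z: "0 \<notin># dyson r p" by (simp add: dyson_def)
  have "\<Sum>\<^sub># (dyson r p) = \<Sum>\<^sub># ?m + ?M"
    unfolding dyson_def by (simp only: sum_mset_filter_pos) simp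
  then show "int (\<Sum>\<^sub># (dyson r p)) = int (\<Sum>\<^sub># p) + r"
    using sum_mset_minus_one[OF p] M by linarith
  have lp: "largest_part (dyson r p) = ?M"
  proof (cases "?M = 0")
    case True
    then have "dyson r p = {#}" using le by (auto simp: dyson_def)
    then show ?thesis using True by simp
  next
    case False
    then show ?thesis using le by (intro largest_part_eqI) (auto simp: dyson_def)
  qed
  have "size (dyson r p) \<le> size p + 1"
    unfolding dyson_def using size_filter_mset_lesseq[of "\<lambda>x. 0 < x" "?m + {#?M#}"] by simp
  then show "rank0 (dyson r p) \<ge> r - 1"
    using lp M by (simp add: rank0_def)
  have rest: "dyson r p - {#?M#} = ?f"
  proof (cases "?M = 0")
    case True
    then have "dyson r p = {#}" "?f = {#}" using le by (auto simp: dyson_def)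
    then show ?thesis by simp
  next
    case False
    then show ?thesis by (simp add: dyson_def)
  qed
  have "nat (int ?M - r) = size p" using M by simp
  then show "dyson_inv r (dyson r p) = p"
    unfolding dyson_inv_def lp rest Let_def using image_Suc_pred_pad[OF p] by simp
  show "\<not> (dyson r p = {#} \<and> r = 1)"
    using lp by auto
qed

text \<open>The rank bound makes the new column at least as long as the number of remaining rows. In
  the excluded case its length would be -1.\<close>

lemma dyson_inv_image:
  assumes p: "0 \<notin># p" and rk: "rank0 p \<ge> r - 1" and ex: "\<not> (p = {#} \<and> r = 1)"
  shows "0 \<notin># dyson_inv r p" "int (\<Sum>\<^sub># (dyson_inv r p)) = int (\<Sum>\<^sub># p) - r"
    "rank0 (dyson_inv r p) \<le> r + 1" "dyson r (dyson_inv r p) = p"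
    "\<not> (dyson_inv r p = {#} \<and> r = -1)"
proof -
  let ?M = "largest_part p" and ?p' = "p - {#largest_part p#}"
  let ?l = "nat (int ?M - r)"
  have M: "int (size ?p') \<le> int ?M - r"
  proof (cases "p = {#}")
    case True
    then show ?thesis using rk ex by (auto simp: rank0_def)
  next
    case False
    then have "size p = Suc (size ?p')"
      using size_Suc_Diff1[OF largest_part_in[OF False]] by simp
    then show ?thesis using rk by (simp add: rank0_def)
  qed
  have sz: "size (dyson_inv r p) = ?l"
    unfolding dyson_inv_def Let_def using M by simp
  have sum: "\<Sum>\<^sub># p = \<Sum>\<^sub># ?p' + ?M"
  proof (cases "p = {#}")
    case False
    from arg_cong[OF insert_DiffM[OF largest_part_in[OF this]], of sum_mset] show ?thesis
      by simp
  qed simp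
  show z: "0 \<notin># dyson_inv r p" by (auto simp: dyson_inv_def Let_def)
  have "\<Sum>\<^sub># (dyson_inv r p) = \<Sum>\<^sub># ?p' + ?l"
    unfolding dyson_inv_def Let_def using M
    by (simp add: sum_mset_image_Suc)
  then show "int (\<Sum>\<^sub># (dyson_inv r p)) = int (\<Sum>\<^sub># p) - r"
    using sum M by simp
  have "largest_part (dyson_inv r p) \<le> Suc ?M"
    unfolding largest_part_le_iff
    by (auto simp: dyson_inv_def Let_def dest!: in_diffD intro: le_largest_part split: if_splits)
  then show "rank0 (dyson_inv r p) \<le> r + 1"
    using sz M by (simp add: rank0_def)
  have "image_mset (\<lambda>x. x - 1) (dyson_inv r p) = ?p' + replicate_mset (?l - size ?p') 0"
    by (simp add: dyson_inv_def Let_def image_mset.compositionality o_def)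
  moreover have "nat (int (size (dyson_inv r p)) + r) = ?M"
    using sz M by simp
  ultimately have "dyson r (dyson_inv r p) = filter_mset (\<lambda>x. 0 < x) (?p' + {#?M#})"
    unfolding dyson_def by simp
  also have "\<dots> = p"
  proof (cases "p = {#}")
    case False
    then show ?thesis using largest_part_in[OF False] filter_pos_eq[OF p] by simp
  qed simp
  finally show "dyson r (dyson_inv r p) = p" .
  show "\<not> (dyson_inv r p = {#} \<and> r = -1)"
    using sz M by auto
qed

text \<open>Integer arguments, with value 0 on negatives, keep the recurrences uniform in
  \<open>m\<close> and \<open>n\<close>.\<close>

definition part_num :: "int \<Rightarrow> int" where
  "part_num n = (if n < 0 then 0 else int (card (partitions (nat n))))"

definition rank_le_num :: "int \<Rightarrow> int \<Rightarrow> int" where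
  "rank_le_num m n = (if n < 0 then 0 else int (card {p \<in> partitions (nat n). rank0 p \<le> m}))"

lemma part_num_neg [simp]: "n < 0 \<Longrightarrow> part_num n = 0"
  by (simp add: part_num_def)

lemma rank_le_num_neg [simp]: "n < 0 \<Longrightarrow> rank_le_num m n = 0"
  by (simp add: rank_le_num_def)

lemma partitions_0: "partitions 0 = {{#}}"
  by (auto simp: partitions_def) (metis multiset_nonemptyE)

lemma part_num_0: "part_num 0 = 1"
  by (simp add: part_num_def partitions_0)

lemma rank_le_num_0: "rank_le_num m 0 = (if m \<ge> 0 then 1 else 0)"
proof -
  have "{p \<in> partitions 0. rank0 p \<le> m} = (if m \<ge> 0 then {{#}} else {})"
    by (auto simp: partitions_0 rank0_def)
  then show ?thesis by (simp add: rank_le_num_def)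
qed

text \<open>With \<open>r = m - 1\<close>, the partitions of \<open>n - r\<close> of rank at most
  \<open>m\<close> correspond to those of \<open>n\<close> of rank at least \<open>m - 2\<close>;
  the second summand counts the rest. At the two excluded points the empty partition has no
  partner.\<close>

lemma dyson_recurrence:
  assumes "\<not> (m = 0 \<and> n = -1)" "\<not> (m = 2 \<and> n = 0)"
  shows "rank_le_num m (n - m + 1) + rank_le_num (m - 3) n = part_num n"
proof -
  define r where "r = m - 1"
  define S where "S = {p. 0 \<notin># p \<and> int (\<Sum>\<^sub># p) = n - r \<and> rank0 p \<le> r + 1}"
  define T where "T = {p. 0 \<notin># p \<and> int (\<Sum>\<^sub># p) = n \<and> rank0 p \<ge> r - 1}"
  have exS: "\<not> (p = {#} \<and> r = -1)" if "p \<in> S" for p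
    using that assms(1) by (auto simp: S_def r_def)
  have exT: "\<not> (p = {#} \<and> r = 1)" if "p \<in> T" for p
    using that assms(2) by (auto simp: T_def r_def)
  have "bij_betw (dyson r) S T"
  proof (rule bij_betw_byWitness[where f' = "dyson_inv r"])
    show "\<forall>p\<in>S. dyson_inv r (dyson r p) = p"
      using dyson_image(4) exS unfolding S_def by blast
    show "\<forall>p\<in>T. dyson r (dyson_inv r p) = p"
      using dyson_inv_image(4) exT unfolding T_def by blast
    show "dyson r ` S \<subseteq> T"
    proof (intro image_subsetI)
      fix p assume "p \<in> S"
      then show "dyson r p \<in> T"
        using dyson_image(1,2,3)[of p r] exS[OF \<open>p \<in> S\<close>] unfolding S_def T_def by auto
    qed
    show "dyson_inv r ` T \<subseteq> S"
    proof (intro image_subsetI)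
      fix p assume "p \<in> T"
      then show "dyson_inv r p \<in> S"
        using dyson_inv_image(1,2,3)[of p r] exT[OF \<open>p \<in> T\<close>] unfolding S_def T_def by auto
    qed
  qed
  then have "card S = card T" by (rule bij_betw_same_card)
  moreover have "int (card S) = rank_le_num m (n - m + 1)"
  proof (cases "n - m + 1 < 0")
    case True
    then have "S = {}" by (auto simp: S_def r_def simp del: of_nat_sum_mset)
    then show ?thesis using True by simp
  next
    case False
    then have "S = {p \<in> partitions (nat (n - m + 1)). rank0 p \<le> m}"
      by (auto simp: S_def r_def partitions_def simp del: of_nat_sum_mset)
    then show ?thesis using False by (simp add: rank_le_num_def)
  qed
  moreover have "int (card T) + rank_le_num (m - 3) n = part_num n"
  proof (cases "n < 0")
    case True
    then have "T = {}" by (auto simp: T_def simp del: of_nat_sum_mset)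
    then show ?thesis using True by simp
  next
    case False
    let ?U = "{p \<in> partitions (nat n). rank0 p \<le> m - 3}"
    have "partitions (nat n) = T \<union> ?U" "T \<inter> ?U = {}"
      using False by (auto simp: T_def r_def partitions_def simp del: of_nat_sum_mset)
    moreover have "finite T" "finite ?U"
      using finite_partitions[of "nat n"] calculation(1) by (auto intro: finite_subset)
    ultimately have "card (partitions (nat n)) = card T + card ?U"
      by (metis card_Un_disjoint)
    then show ?thesis using False by (simp add: rank_le_num_def part_num_def)
  qed
  ultimately show ?thesis by simp
qed

lemma abs_rank0_le: "p \<in> partitions n \<Longrightarrow> \<bar>rank0 p\<bar> \<le> int n"
proof -
  assume p: "p \<in> partitions n"
  then have "size p \<le> n" using size_le_sum_mset_pos[of p] by (auto simp: partitions_def)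
  moreover have "largest_part p \<le> n"
    unfolding largest_part_le_iff using p by (auto simp: partitions_def dest!: multi_member_split)
  ultimately show ?thesis by (simp add: rank0_def)
qed

lemma rank_le_num_low: "m < -n \<Longrightarrow> rank_le_num m n = 0"
proof -
  assume m: "m < -n"
  have "{p \<in> partitions (nat n). rank0 p \<le> m} = {}" if "n \<ge> 0"
    using m that abs_rank0_le[of _ "nat n"] by force
  then show ?thesis by (cases "n < 0") (auto simp: rank_le_num_def card_eq_0_iff)
qed

lemma rank_le_num_high: "m \<ge> n \<Longrightarrow> rank_le_num m n = part_num n"
proof -
  assume m: "m \<ge> n"
  have "{p \<in> partitions (nat n). rank0 p \<le> m} = partitions (nat n)" if "n \<ge> 0"
    using m that abs_rank0_le[of _ "nat n"] by force
  then show ?thesis by (simp add: rank_le_num_def part_num_def)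
qed

text \<open>This is conjugation symmetry, deduced from Dyson's recurrence: adding its instances at
  \<open>m + 3\<close> and \<open>-1 - m\<close> reduces \<open>n\<close> to
  \<open>n - m - 2\<close>.\<close>

lemma rank_le_num_reflect: "m \<ge> 0 \<Longrightarrow> rank_le_num m n + rank_le_num (-1 - m) n = part_num n"
proof (induction "nat n" arbitrary: m n rule: less_induct)
  case less
  show ?case
  proof (cases "n < 0")
    case False
    have 1: "rank_le_num (m + 3) (n - m - 2) + rank_le_num m n = part_num n"
      using dyson_recurrence[of "m + 3" n] less.prems by (simp add: algebra_simps)
    have 2: "rank_le_num (-1 - m) n + rank_le_num (-1 - (m + 3)) (n - m - 2) = part_num (n - m - 2)"
      using dyson_recurrence[of "-1 - m" "n - m - 2"] less.prems by (simp add: algebra_simps)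
    have 3: "rank_le_num (m + 3) (n - m - 2) + rank_le_num (-1 - (m + 3)) (n - m - 2)
        = part_num (n - m - 2)"
    proof (cases "n - m - 2 < 0")
      case False
      then show ?thesis using less.prems by (intro less.hyps) auto
    qed simp
    show ?thesis using 1 2 3 by simp
  qed simp
qed

definition rank_num :: "int \<Rightarrow> int \<Rightarrow> int" where
  "rank_num m n = rank_le_num m n - rank_le_num (m - 1) n"

lemma rank_num_neg [simp]: "n < 0 \<Longrightarrow> rank_num m n = 0"
  by (simp add: rank_num_def)

lemma rank_num_uminus: "rank_num (-m) n = rank_num m n"
proof -
  have "rank_num (-m) n = rank_num m n" if "m > 0" for m
  proof -
    have e: "- m - 1 = -1 - m" by simp
    show ?thesis
      using rank_le_num_reflect[of m n] rank_le_num_reflect[of "m - 1" n] that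
      unfolding rank_num_def e by simp
  qed
  from this[of m] this[of "-m"] show ?thesis by (cases m "0::int" rule: linorder_cases) auto
qed

lemma rank_num_outside: "\<bar>m\<bar> > n \<Longrightarrow> rank_num m n = 0"
  by (cases "m > 0") (simp_all add: rank_num_def rank_le_num_low rank_le_num_high)

lemma rank_num_eq_rank_count:
  assumes "n > 0"
  shows "rank_num m (int n) = int (rank_count m n)"
proof -
  have ne: "rank0 p = partition_rank p" if "p \<in> partitions n" for p
    using that assms by (intro rank0_eq_partition_rank) (auto simp: partitions_def)
  let ?U = "{p \<in> partitions n. rank0 p \<le> m - 1}" and ?V = "{p \<in> partitions n. partition_rank p = m}"
  have "{p \<in> partitions n. rank0 p \<le> m} = ?U \<union> ?V" "?U \<inter> ?V = {}"
    using ne by auto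
  then have "card {p \<in> partitions n. rank0 p \<le> m} = card ?U + card ?V"
    using finite_partitions[of n] by (simp add: card_Un_disjoint)
  then show ?thesis by (simp add: rank_num_def rank_le_num_def rank_count_def)
qed

section \<open>Multiplication by the cube of the theta function\<close>

definition tri :: "int \<Rightarrow> int" where
  "tri i = i * (i - 1) div 2"

lemma two_mult_tri: "2 * tri i = i * (i - 1)"
  by (simp add: tri_def)

lemma tri_add_one: "tri (i + 1) = tri i + i"
  using two_mult_tri[of i] two_mult_tri[of "i + 1"] by (simp add: algebra_simps)

text \<open>Hence \<open>tri i\<close> \<le> \<open>n\<close> confines \<open>i\<close> to
  \<open>{-n..n+1}\<close>, the range of summation in \<open>theta\<close>.\<close>

lemma tri_lower: "i - 1 \<le> tri i" "- i \<le> tri i"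
proof -
  have "0 \<le> (i - 1) * (i - 2)" "0 \<le> i * (i + 1)"
    by (auto simp: zero_le_mult_iff)
  then show "i - 1 \<le> tri i" "- i \<le> tri i"
    using two_mult_tri[of i] by (simp_all add: algebra_simps)
qed

definition alt :: "int \<Rightarrow> int" where
  "alt i = (if even i then 1 else - 1)"

lemma alt_add_one: "alt (i + 1) = - alt i"
  by (simp add: alt_def)

lemma alt_of_nat: "alt (int k) = (- 1) ^ k"
  by (simp add: alt_def)

lemma alt_uminus: "alt (- i) = alt i"
  by (simp add: alt_def)

definition causal :: "(int \<Rightarrow> int \<Rightarrow> int) \<Rightarrow> bool" where
  "causal S \<longleftrightarrow> (\<forall>m n. n < 0 \<longrightarrow> S m n = 0)"

text \<open>A function \<open>S m n\<close> stands for the bilateral series \<open>\<Sum> S m n z^m q^n\<close>; then \<open>theta\<close>,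
  \<open>delta\<close> and \<open>tau\<close> are multiplication by \<open>\<Sum> (-1)^i z^i q^(i(i-1)/2)\<close>, by \<open>1 - z\<close>, and by the
  quotient of these two series.\<close>

definition theta :: "(int \<Rightarrow> int \<Rightarrow> int) \<Rightarrow> int \<Rightarrow> int \<Rightarrow> int" where
  "theta S m n = (\<Sum>i\<in>{-n..n+1}. alt i * S (m - i) (n - tri i))"

definition delta :: "(int \<Rightarrow> int \<Rightarrow> int) \<Rightarrow> int \<Rightarrow> int \<Rightarrow> int" where
  "delta S m n = S m n - S (m - 1) n"

definition tau :: "(int \<Rightarrow> int \<Rightarrow> int) \<Rightarrow> int \<Rightarrow> int \<Rightarrow> int" where
  "tau S m n = (\<Sum>k\<le>nat n. (- 1) ^ k *
     (\<Sum>j\<in>{- int k..int k}. S (m - j) (n - int (k * (k + 1) div 2))))"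

lemma causal_theta [simp]: "causal (theta S)"
  by (simp add: causal_def theta_def)

lemma causal_delta [simp]: "causal S \<Longrightarrow> causal (delta S)"
  by (simp add: causal_def delta_def)

lemma theta_superset:
  assumes "causal S" "finite K" "{-n..n+1} \<subseteq> K"
  shows "theta S m n = (\<Sum>i\<in>K. alt i * S (m - i) (n - tri i))"
  unfolding theta_def
proof (rule sum.mono_neutral_left[OF assms(2,3)], intro ballI)
  fix i assume "i \<in> K - {-n..n+1}"
  then have "n - tri i < 0" using tri_lower[of i] by auto
  then show "alt i * S (m - i) (n - tri i) = 0" using assms(1) by (simp add: causal_def)
qed

text \<open>The functional equation of theta under \<open>z \<mapsto> z q\<close>, read off coefficientwise.\<close>

lemma theta_recurrence:
  assumes S: "causal S" and Q: "causal Q"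
    and rec: "\<And>m n. S m (n - m + 1) = Q m n + c * S (m - k) n"
  shows "theta S m (n - m + 1) = - theta Q (m + 1) n + (- c) * theta S (m - (k - 1)) n"
proof -
  \<comment> \<open>\<open>K\<close> is wide enough for the ranges of all sums involved, before and
    after the shift by one.\<close>
  define K where "K = {- \<bar>n\<bar> - \<bar>m\<bar> - 3..\<bar>n\<bar> + \<bar>m\<bar> + 3}"
  define K' where "K' = (\<lambda>i. i + 1) ` K"
  have K': "finite K'" "{-n..n+1} \<subseteq> K'"
    unfolding K'_def K_def by (simp, simp only: image_add_atLeastAtMost' ) auto
  have "theta S m (n - m + 1) = (\<Sum>i\<in>K. alt i * S (m - i) (n - m + 1 - tri i))"
    by (rule theta_superset[OF S]) (auto simp: K_def)
  \<comment> \<open>The recurrence is used at \<open>m - i\<close> and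
    \<open>n - tri (i + 1)\<close>, since \<open>tri (i + 1) = tri i + i\<close>. Reindexing by
    \<open>i + 1\<close> then flips the sign of \<open>alt\<close>.\<close>
  also have "\<dots> = (\<Sum>i\<in>K. alt i * (Q (m - i) (n - tri (i + 1)) + c * S (m - i - k) (n - tri (i + 1))))"
  proof (rule sum.cong[OF refl])
    fix i
    have "n - m + 1 - tri i = (n - tri (i + 1)) - (m - i) + 1"
      by (simp add: tri_add_one)
    then show "alt i * S (m - i) (n - m + 1 - tri i) =
        alt i * (Q (m - i) (n - tri (i + 1)) + c * S (m - i - k) (n - tri (i + 1)))"
      by (simp only: rec)
  qed
  also have "\<dots> = (\<Sum>i\<in>K'. - alt i * (Q (m + 1 - i) (n - tri i) + c * S (m - (k - 1) - i) (n - tri i)))"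
    unfolding K'_def by (subst sum.reindex) (auto simp: alt_add_one algebra_simps intro!: sum.cong)
  also have "\<dots> = - (\<Sum>i\<in>K'. alt i * Q (m + 1 - i) (n - tri i))
      + (- c) * (\<Sum>i\<in>K'. alt i * S (m - (k - 1) - i) (n - tri i))"
    by (simp add: sum_distrib_left sum_negf sum.distrib algebra_simps sum_subtractf)
  finally show ?thesis
    by (simp only: theta_superset[OF S K'] theta_superset[OF Q K'])
qed

lemma theta_shift: "theta (\<lambda>m. S (k + m)) = (\<lambda>m. theta S (k + m))"
  by (intro ext) (simp add: theta_def algebra_simps)

lemma theta_uminus_shift:
  "theta (\<lambda>m n. - S (m + 1) n) = (\<lambda>m n. - theta S (m + 1) n)"
  by (intro ext) (simp add: theta_def sum_negf algebra_simps)

lemma sum_symmetric_interval: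
  "(\<Sum>i\<in>{- int N..int N + 1}. f i) = (\<Sum>k\<le>N. f (- int k) + f (int k + 1) :: 'a::comm_monoid_add)"
proof (induction N)
  case 0
  have "{0..1::int} = {0, 1}" by auto
  then show ?case by simp
next
  case (Suc N)
  have "{- int (Suc N)..int (Suc N) + 1}
      = insert (- int (Suc N)) (insert (int (Suc N) + 1) {- int N..int N + 1})"
    by auto
  then show ?case using Suc by (simp add: ac_simps)
qed

lemma sum_telescope_symmetric:
  "(\<Sum>j\<in>{- int k..int k}. g j - g (j + 1)) = g (- int k) - (g (int k + 1) :: 'a::ab_group_add)"
proof (induction k)
  case (Suc k)
  have "{- int (Suc k)..int (Suc k)} = insert (- int (Suc k)) (insert (int (Suc k)) {- int k..int k})"
    by auto
  then show ?case using Suc by (simp add: algebra_simps)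
qed simp

lemma tri_nat: "tri (- int k) = int (k * (k + 1) div 2)" "tri (int k + 1) = int (k * (k + 1) div 2)"
proof -
  have "2 * int (k * (k + 1) div 2) = int (k * (k + 1))"
    by (metis dvd_mult_div_cancel even_mult_iff even_plus_one_iff of_nat_mult of_nat_numeral)
  then show "tri (- int k) = int (k * (k + 1) div 2)" "tri (int k + 1) = int (k * (k + 1) div 2)"
    using two_mult_tri[of "- int k"] two_mult_tri[of "int k + 1"] by (simp_all add: algebra_simps)
qed

text \<open>The terms for -k and k + 1 have the same exponent of q and opposite signs, and z^(-k) -
  z^(k+1) is 1 - z times the sum of z^j over -k \<le> j \<le> k.\<close>

lemma theta_eq_tau_delta:
  assumes "causal S"
  shows "theta S = tau (delta S)"
proof (intro ext)
  fix m n
  show "theta S m n = tau (delta S) m n"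
  proof (cases "n < 0")
    case True
    then show ?thesis using assms by (simp add: theta_def tau_def delta_def causal_def)
  next
    case False
    let ?e = "\<lambda>k. n - int (k * (k + 1) div 2)"
    have "theta S m n = (\<Sum>i\<in>{- int (nat n)..int (nat n) + 1}. alt i * S (m - i) (n - tri i))"
      using False by (simp add: theta_def)
    also have "\<dots> = (\<Sum>k\<le>nat n. (- 1) ^ k * (S (m + int k) (?e k) - S (m - (int k + 1)) (?e k)))"
      unfolding sum_symmetric_interval tri_nat alt_add_one alt_uminus alt_of_nat
      by (intro sum.cong refl) (simp add: algebra_simps)
    also have "\<dots> = tau (delta S) m n"
      unfolding tau_def
    proof (intro sum.cong refl arg_cong2[where f = "(*)"])
      fix k
      show "S (m + int k) (?e k) - S (m - (int k + 1)) (?e k)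
          = (\<Sum>j\<in>{- int k..int k}. delta S (m - j) (?e k))"
        using sum_telescope_symmetric[of "\<lambda>j. S (m - j) (?e k)" k]
        by (simp add: delta_def algebra_simps)
    qed
    finally show ?thesis .
  qed
qed

lemma delta_tau: "delta (tau S) = tau (delta S)"
  by (intro ext) (simp add: delta_def tau_def sum_subtractf algebra_simps)

lemma causal_tau [simp]: "causal S \<Longrightarrow> causal (tau S)"
  unfolding causal_def tau_def by (auto intro!: sum.neutral)

lemma theta_cube:
  assumes "causal S"
  shows "theta (theta (theta S)) = tau (tau (tau (delta (delta (delta S)))))"
  using assms by (simp add: theta_eq_tau_delta delta_tau)

definition rank_le_weighted :: "int \<Rightarrow> int \<Rightarrow> int" where
  "rank_le_weighted m n = (24 * n - 1 + (2 * m + 1)\<^sup>2) * rank_le_num m n"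

definition part_num_weighted :: "int \<Rightarrow> int \<Rightarrow> int" where
  "part_num_weighted m n = (24 * n - 1 + (2 * m - 5)\<^sup>2) * part_num n"

lemma causal_weighted [simp]: "causal rank_le_weighted" "causal part_num_weighted"
  by (simp_all add: causal_def rank_le_weighted_def part_num_weighted_def)

text \<open>The weights on both sides agree, and they vanish at the two exceptions of Dyson's recurrence.\<close>

lemma rank_le_weighted_recurrence:
  "rank_le_weighted m (n - m + 1) = part_num_weighted m n + (- 1) * rank_le_weighted (m - 3) n"
proof -
  have "24 * (n - m + 1) - 1 + (2 * m + 1)\<^sup>2 = 24 * n - 1 + (2 * m - 5)\<^sup>2"
    "24 * n - 1 + (2 * (m - 3) + 1)\<^sup>2 = 24 * n - 1 + (2 * m - 5)\<^sup>2"
    by (simp_all add: power2_eq_square algebra_simps)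
  then have "rank_le_weighted m (n - m + 1) + rank_le_weighted (m - 3) n - part_num_weighted m n
      = (24 * n - 1 + (2 * m - 5)\<^sup>2) *
        (rank_le_num m (n - m + 1) + rank_le_num (m - 3) n - part_num n)"
    by (simp only: rank_le_weighted_def part_num_weighted_def) (simp add: algebra_simps)
  also have "\<dots> = 0"
    using dyson_recurrence[of m n] by (cases "(m = 0 \<and> n = -1) \<or> (m = 2 \<and> n = 0)") auto
  finally show ?thesis by simp
qed

text \<open>The weight is quadratic in \<open>m\<close> and \<open>part_num\<close> does not depend
  on \<open>m\<close>, so three differences annihilate it.\<close>

lemma theta_cube_part_num: "theta (theta (theta part_num_weighted)) m n = 0"
proof -
  have "delta (delta (delta part_num_weighted)) = (\<lambda>m n. 0)"
    by (intro ext) (simp add: delta_def part_num_weighted_def power2_eq_square algebra_simps)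
  then show ?thesis by (simp add: theta_cube tau_def)
qed

text \<open>Each theta factor flips the sign in the recurrence and shortens its shift by one: after
  three factors, minus the value at \<open>m - 3\<close> has become plus the value at
  \<open>m\<close>.\<close>

lemma theta_cube_rank_le_periodic:
  "theta (theta (theta rank_le_weighted)) m (n - m + 1) = theta (theta (theta rank_le_weighted)) m n"
proof -
  let ?H = rank_le_weighted and ?Q = part_num_weighted
  note 1 = theta_recurrence[OF causal_weighted rank_le_weighted_recurrence]
  have c1: "causal (\<lambda>m n. - theta ?Q (m + 1) n)"
    using causal_theta[of ?Q] by (simp add: causal_def)
  note 2 = theta_recurrence[OF causal_theta c1 1]
  have c2: "causal (\<lambda>m n. - theta (\<lambda>m n. - theta ?Q (m + 1) n) (m + 1) n)"
    using causal_theta by (simp add: causal_def)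
  note 3 = theta_recurrence[OF causal_theta c2 2, of m n]
  show ?thesis using 3
    by (simp add: theta_uminus_shift theta_shift theta_cube_part_num)
qed

lemma theta_cube_rank_le:
  assumes "m \<noteq> 1"
  shows "theta (theta (theta rank_le_weighted)) m n = 0" (is "?W m n = 0")
proof (induction "nat (n + 1)" arbitrary: n rule: less_induct)
  case less
  show ?case
  proof (cases "n < 0")
    case True
    then show ?thesis using causal_theta[of "theta (theta rank_le_weighted)"] by (simp add: causal_def)
  next
    case False
    \<comment> \<open>For \<open>m\<close> \<noteq> 1 one direction of the periodicity lowers
      \<open>n\<close>, until it is negative and the series vanishes.\<close>
    define n' where "n' = (if m > 1 then n - m + 1 else n + m - 1)"
    have "?W m n = ?W m n'"
      using theta_cube_rank_le_periodic[of m n] theta_cube_rank_le_periodic[of m "n + m - 1"]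
      by (simp add: n'_def)
    also have "\<dots> = 0" using assms False by (intro less.hyps) (auto simp: n'_def)
    finally show ?thesis .
  qed
qed

text \<open>This is the third difference of \<open>rank_le_weighted\<close>, in which
  \<open>rank_le_num\<close> recombines into \<open>rank_num\<close>. The weights encode an operator
  of first order in q and second order in z.\<close>

definition rank_pde :: "int \<Rightarrow> int \<Rightarrow> int" where
  "rank_pde m n =
     (24 * n + 4 * m\<^sup>2 + 4 * m) * rank_num m n
     + (8 - 2 * (24 * n + 4 * (m - 1)\<^sup>2)) * rank_num (m - 1) n
     + (24 * n + 4 * (m - 2)\<^sup>2 - 4 * (m - 2)) * rank_num (m - 2) n"

lemma delta_cube_rank_le: "delta (delta (delta rank_le_weighted)) = rank_pde"
proof (intro ext)
  fix m n
  have e: "m - 1 - 1 = m - 2" "m - 2 - 1 = m - 3" "m - 1 - 2 = m - 3" for m :: int by simp_all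
  show "delta (delta (delta rank_le_weighted)) m n = rank_pde m n"
    unfolding delta_def rank_le_weighted_def rank_pde_def rank_num_def e
    by (simp add: power2_eq_square algebra_simps)
qed

theorem tau_cube_rank_pde: "m \<noteq> 1 \<Longrightarrow> tau (tau (tau rank_pde)) m n = 0"
  using theta_cube_rank_le[of m n] by (simp add: theta_cube delta_cube_rank_le)

section \<open>The differential equation for the rank\<close>

text \<open>The series of \<open>c i * q ^ e i\<close> over all \<open>i\<close>. It has this
  meaning when the fibres of \<open>e\<close> are finite; a sum over an infinite fibre would be
  0.\<close>

definition qseries :: "('i \<Rightarrow> nat) \<Rightarrow> ('i \<Rightarrow> 'a::comm_ring_1) \<Rightarrow> 'a fps" where
  "qseries e c = Abs_fps (\<lambda>n. \<Sum>i | e i = n. c i)"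

lemma qseries_nth: "qseries e c $ n = (\<Sum>i | e i = n. c i)"
  by (simp add: qseries_def)

lemma qseries_mult_nth:
  assumes "finite {i. e i \<le> n}"
  shows "(qseries e c * f) $ n = (\<Sum>i | e i \<le> n. c i * f $ (n - e i))"
proof -
  have "(qseries e c * f) $ n = (\<Sum>l=0..n. \<Sum>i | i \<in> {i. e i \<le> n} \<and> e i = l. c i * f $ (n - e i))"
    unfolding fps_mult_nth qseries_nth sum_distrib_right
    by (intro sum.cong refl) auto
  also have "\<dots> = (\<Sum>i | e i \<le> n. c i * f $ (n - e i))"
    using assms by (intro sum.group) auto
  finally show ?thesis .
qed

definition trin :: "nat \<Rightarrow> nat" where
  "trin k = k * (k + 1) div 2"

lemma two_mult_trin: "2 * trin k = k * (k + 1)"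
  by (simp add: trin_def)

lemma le_trin: "k \<le> trin k"
  using two_mult_trin[of k] by (cases k) auto

lemma finite_trin_le: "finite {k. trin k \<le> n}"
  by (rule finite_subset[of _ "{..n}"]) (use le_trin order_trans in auto)

abbreviation ex :: "int \<Rightarrow> rat fps" where
  "ex m \<equiv> fps_exp (of_int m)"

lemma ex_add: "ex (a + b) = ex a * ex b"
  by (simp add: fps_exp_add_mult)

text \<open>The slack 3 leaves room for the shifts by up to 2 in \<open>rank_pde\<close>;
  \<open>tau\<close> preserves it because |j| \<le> k \<le> \<open>trin k\<close>.\<close>

definition narrow :: "(int \<Rightarrow> int \<Rightarrow> int) \<Rightarrow> bool" where
  "narrow S \<longleftrightarrow> (\<forall>m n. \<bar>m\<bar> > n + 3 \<longrightarrow> S m n = 0)"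

text \<open>The specialization \<open>z = exp (2 t)\<close>: a power series in \<open>q\<close> whose coefficients are power
  series in \<open>t\<close>.\<close>

definition zexp :: "(int \<Rightarrow> int \<Rightarrow> int) \<Rightarrow> rat fps fps" where
  "zexp S = Abs_fps (\<lambda>n. \<Sum>m\<in>{- int n - 3..int n + 3}. fps_const (of_int (S m (int n))) * ex (2 * m))"

definition tau_exp :: "rat fps fps" where
  "tau_exp = qseries trin (\<lambda>k. (- 1) ^ k * (\<Sum>j\<in>{- int k..int k}. ex (2 * j)))"

lemma narrow_tau:
  assumes "narrow S" "causal S"
  shows "narrow (tau S)"
  unfolding narrow_def
proof (intro allI impI)
  fix m n :: int assume m: "\<bar>m\<bar> > n + 3"
  have "S (m - j) (n - int (k * (k + 1) div 2)) = 0" if "j \<in> {- int k..int k}" for j k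
    using assms m that le_trin[of k] unfolding narrow_def causal_def trin_def by auto
  then show "tau S m n = 0" by (simp add: tau_def)
qed

lemma zexp_tau:
  assumes S: "narrow S" "causal S"
  shows "zexp (tau S) = tau_exp * zexp S"
proof (rule fps_ext)
  fix n
  let ?I = "{- int n - 3..int n + 3}"
  let ?c = "\<lambda>m l. fps_const (of_int (S m l)) :: rat fps"
  \<comment> \<open>Shifting \<open>m\<close> by \<open>j\<close> produces the factor
    \<open>ex (2 * j)\<close>; narrowness allows the window of summation to move along.\<close>
  have inner: "(\<Sum>m\<in>?I. ?c (m - j) (int n - int (trin k)) * ex (2 * m)) = ex (2 * j) * zexp S $ (n - trin k)"
    if "trin k \<le> n" "j \<in> {- int k..int k}" for k j
  proof -
    have "(\<Sum>m\<in>?I. ?c (m - j) (int n - int (trin k)) * ex (2 * m))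
        = (\<Sum>m\<in>{- int n - 3 - j..int n + 3 - j}. ?c m (int n - int (trin k)) * ex (2 * (m + j)))"
      by (rule sum.reindex_bij_witness[of _ "\<lambda>m. m + j" "\<lambda>m. m - j"]) auto
    also have "\<dots> = (\<Sum>m\<in>{- int (n - trin k) - 3..int (n - trin k) + 3}.
        ?c m (int n - int (trin k)) * ex (2 * (m + j)))"
      using that le_trin[of k] S(1)
      by (intro sum.mono_neutral_right) (auto simp: narrow_def of_nat_diff)
    also have "\<dots> = ex (2 * j) * zexp S $ (n - trin k)"
      using that unfolding zexp_def
      by (simp add: sum_distrib_left distrib_left fps_exp_add_mult of_nat_diff mult_ac)
    finally show ?thesis .
  qed
  have "zexp (tau S) $ n = (\<Sum>m\<in>?I. fps_const (of_int (tau S m (int n))) * ex (2 * m))"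
    by (simp add: zexp_def)
  also have "\<dots> = (\<Sum>m\<in>?I. \<Sum>k\<le>n. \<Sum>j\<in>{- int k..int k}.
      (- 1) ^ k * (?c (m - j) (int n - int (trin k)) * ex (2 * m)))"
  proof (rule sum.cong[OF refl])
    fix m
    have "fps_const (of_int (tau S m (int n)) :: rat) =
       (\<Sum>k\<le>n. \<Sum>j\<in>{- int k..int k}. (- 1) ^ k * ?c (m - j) (int n - int (trin k)))"
      unfolding fps_of_int tau_def trin_def[symmetric]
      by (simp add: sum_distrib_left)
    then show "fps_const (of_int (tau S m (int n))) * ex (2 * m) = (\<Sum>k\<le>n. \<Sum>j\<in>{- int k..int k}.
      (- 1) ^ k * (?c (m - j) (int n - int (trin k)) * ex (2 * m)))"
      by (simp add: sum_distrib_right mult.assoc)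
  qed
  also have "\<dots> = (\<Sum>k\<le>n. \<Sum>j\<in>{- int k..int k}. \<Sum>m\<in>?I.
      (- 1) ^ k * (?c (m - j) (int n - int (trin k)) * ex (2 * m)))"
    by (subst sum.swap, rule sum.cong[OF refl], rule sum.swap)
  also have "\<dots> = (\<Sum>k\<le>n. (- 1) ^ k * (\<Sum>j\<in>{- int k..int k}.
      (\<Sum>m\<in>?I. ?c (m - j) (int n - int (trin k)) * ex (2 * m))))"
    by (simp add: sum_distrib_left)
  also have "\<dots> = (\<Sum>k | trin k \<le> n. (- 1) ^ k * (\<Sum>j\<in>{- int k..int k}.
      (\<Sum>m\<in>?I. ?c (m - j) (int n - int (trin k)) * ex (2 * m))))"
  proof (rule sum.mono_neutral_right)
    show "{k. trin k \<le> n} \<subseteq> {..n}" using le_trin order_trans by auto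
    show "\<forall>k\<in>{..n} - {k. trin k \<le> n}. (- 1) ^ k * (\<Sum>j\<in>{- int k..int k}.
      (\<Sum>m\<in>?I. ?c (m - j) (int n - int (trin k)) * ex (2 * m))) = 0"
      using S(2) by (auto simp: causal_def)
  qed simp
  also have "\<dots> = (\<Sum>k | trin k \<le> n. (- 1) ^ k * (\<Sum>j\<in>{- int k..int k}. ex (2 * j)) * zexp S $ (n - trin k))"
  proof (rule sum.cong[OF refl])
    fix k assume "k \<in> {k. trin k \<le> n}"
    then have "(\<Sum>j\<in>{- int k..int k}. \<Sum>m\<in>?I. ?c (m - j) (int n - int (trin k)) * ex (2 * m))
        = (\<Sum>j\<in>{- int k..int k}. ex (2 * j) * zexp S $ (n - trin k))"
      by (intro sum.cong refl inner) auto
    then show "(- 1) ^ k * (\<Sum>j\<in>{- int k..int k}. \<Sum>m\<in>?I. ?c (m - j) (int n - int (trin k)) * ex (2 * m))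
        = (- 1) ^ k * (\<Sum>j\<in>{- int k..int k}. ex (2 * j)) * zexp S $ (n - trin k)"
      by (simp only: sum_distrib_right mult.assoc)
  qed
  also have "\<dots> = (tau_exp * zexp S) $ n"
    unfolding tau_exp_def by (subst qseries_mult_nth) (auto simp: finite_trin_le)
  finally show "zexp (tau S) $ n = (tau_exp * zexp S) $ n" .
qed

definition dt :: "rat fps fps \<Rightarrow> rat fps fps" where
  "dt f = Abs_fps (\<lambda>n. fps_deriv (f $ n))"

lemma causal_rank_pde: "causal rank_pde"
  by (simp add: causal_def rank_pde_def)

lemma narrow_rank_pde: "narrow rank_pde"
  by (auto simp: narrow_def rank_pde_def rank_num_outside)

text \<open>Here z, z' and z4 stand for \<open>ex 2\<close>, \<open>ex (-2)\<close> and
  \<open>ex 4\<close>, and R1, R2 for the first two t-derivatives of R. Pulling out the middle power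
  z leaves coefficients that are even or odd under z -> 1/z.\<close>

lemma zexp_rank_pde_algebra:
  fixes z :: "'a::idom"
  assumes "z4 = z * z" "z * z' = 1"
  shows "24 * n * R + R2 + 2 * R1 + z * (8 * R - 2 * (24 * n * R + R2)) + z4 * (24 * n * R + R2 - 2 * R1)
    = z * ((z - 2 + z') * (24 * (n * R) + R2) - 2 * ((z - z') * R1) + 8 * R)"
proof -
  have "z * ((z - 2 + z') * (24 * (n * R) + R2) - 2 * ((z - z') * R1) + 8 * R)
      = (z * z + z * z' - 2 * z) * (24 * (n * R) + R2) - 2 * (z * z - z * z') * R1 + 8 * z * R"
    by (simp add: algebra_simps)
  then show ?thesis unfolding assms by (simp add: algebra_simps)
qed

lemma zexp_rank_pde:
  "zexp rank_pde = fps_const (ex 2) *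
     (fps_const (ex 2 - 2 + ex (-2)) * (24 * (fps_X * fps_deriv (zexp rank_num)) + dt (dt (zexp rank_num)))
      - 2 * fps_const (ex 2 - ex (-2)) * dt (zexp rank_num) + 8 * zexp rank_num)"
proof (rule fps_ext)
  fix n
  let ?I = "{- int n - 3..int n + 3}"
  let ?N = "\<lambda>m. rank_num m (int n)"
  \<comment> \<open>\<open>F g\<close> is the coefficient of q^n with ranks weighted by
    \<open>g\<close>; as z = exp(2t), each t-derivative multiplies the weight by
    \<open>2 * m\<close>.\<close>
  define F where "F = (\<lambda>g :: int \<Rightarrow> int. \<Sum>m\<in>?I. fps_const (of_int (g m * ?N m)) * ex (2 * m))"
  have shift: "(\<Sum>m\<in>?I. fps_const (of_int (g (m - s) * ?N (m - s))) * ex (2 * m)) = ex (2 * s) * F g"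
    if "\<bar>s\<bar> \<le> 3" for g s
  proof -
    have "(\<Sum>m\<in>?I. fps_const (of_int (g (m - s) * ?N (m - s))) * ex (2 * m))
        = (\<Sum>m\<in>{- int n - 3 - s..int n + 3 - s}. fps_const (of_int (g m * ?N m)) * ex (2 * (m + s)))"
      by (rule sum.reindex_bij_witness[of _ "\<lambda>m. m + s" "\<lambda>m. m - s"]) auto
    also have "\<dots> = (\<Sum>m\<in>{- int n..int n}. fps_const (of_int (g m * ?N m)) * ex (2 * (m + s)))"
      using that by (intro sum.mono_neutral_right) (auto simp: rank_num_outside)
    also have "\<dots> = ex (2 * s) * (\<Sum>m\<in>{- int n..int n}. fps_const (of_int (g m * ?N m)) * ex (2 * m))"
      by (simp add: sum_distrib_left distrib_left fps_exp_add_mult mult_ac)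
    also have "(\<Sum>m\<in>{- int n..int n}. fps_const (of_int (g m * ?N m)) * ex (2 * m)) = F g"
      unfolding F_def by (intro sum.mono_neutral_left) (auto simp: rank_num_outside)
    finally show ?thesis .
  qed
  have F_lin: "F (\<lambda>m. a * g m + b * h m) = of_int a * F g + of_int b * F h" for a b g h
    unfolding F_def sum_distrib_left sum.distrib[symmetric]
    by (intro sum.cong refl)
      (simp add: algebra_simps fps_of_int flip: fps_const_add fps_const_mult)
  let ?R = "zexp rank_num $ n"
  have R: "?R = F (\<lambda>m. 1)" by (simp add: F_def zexp_def)
  have R': "dt (zexp rank_num) $ n = F (\<lambda>m. 2 * m)"
    by (simp add: F_def zexp_def dt_def fps_deriv_sum mult_ac flip: fps_const_mult)
  have four: "fps_const (4 :: rat) = fps_const 2 * fps_const 2"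
    by simp
  have R'': "dt (dt (zexp rank_num)) $ n = F (\<lambda>m. 4 * m\<^sup>2)"
    by (simp add: F_def zexp_def dt_def fps_deriv_sum mult_ac power2_eq_square four flip: fps_const_mult)
  have Rq: "(fps_X * fps_deriv (zexp rank_num)) $ n = of_nat n * ?R"
    by (cases n) auto
  have "zexp rank_pde $ n = F (\<lambda>m. 24 * int n + 4 * m\<^sup>2 + 4 * m)
     + ex 2 * F (\<lambda>m. 8 - 2 * (24 * int n + 4 * m\<^sup>2))
     + ex 4 * F (\<lambda>m. 24 * int n + 4 * m\<^sup>2 - 4 * m)"
    using shift[of 0 "\<lambda>m. 24 * int n + 4 * m\<^sup>2 + 4 * m"]
      shift[of 1 "\<lambda>m. 8 - 2 * (24 * int n + 4 * m\<^sup>2)"]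
      shift[of 2 "\<lambda>m. 24 * int n + 4 * m\<^sup>2 - 4 * m"]
    by (simp add: zexp_def rank_pde_def sum.distrib distrib_right flip: fps_const_add)
  also have "F (\<lambda>m. 24 * int n + 4 * m\<^sup>2 + 4 * m) =
      24 * of_nat n * F (\<lambda>m. 1) + F (\<lambda>m. 4 * m\<^sup>2) + 2 * F (\<lambda>m. 2 * m)"
    using F_lin[of 1 "\<lambda>m. 24 * int n + 4 * m\<^sup>2" 2 "\<lambda>m. 2 * m"]
      F_lin[of "24 * int n" "\<lambda>m. 1" 1 "\<lambda>m. 4 * m\<^sup>2"] by simp
  also have "F (\<lambda>m. 24 * int n + 4 * m\<^sup>2 - 4 * m) =
      24 * of_nat n * F (\<lambda>m. 1) + F (\<lambda>m. 4 * m\<^sup>2) - 2 * F (\<lambda>m. 2 * m)"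
    using F_lin[of 1 "\<lambda>m. 24 * int n + 4 * m\<^sup>2" "-2" "\<lambda>m. 2 * m"]
      F_lin[of "24 * int n" "\<lambda>m. 1" 1 "\<lambda>m. 4 * m\<^sup>2"] by simp
  also have "F (\<lambda>m. 8 - 2 * (24 * int n + 4 * m\<^sup>2)) =
      8 * F (\<lambda>m. 1) - 2 * (24 * of_nat n * F (\<lambda>m. 1) + F (\<lambda>m. 4 * m\<^sup>2))"
    using F_lin[of 8 "\<lambda>m. 1" "-2" "\<lambda>m. 24 * int n + 4 * m\<^sup>2"]
      F_lin[of "24 * int n" "\<lambda>m. 1" 1 "\<lambda>m. 4 * m\<^sup>2"] by (simp add: algebra_simps)
  finally have 1: "zexp rank_pde $ n =
      24 * of_nat n * F (\<lambda>m. 1) + F (\<lambda>m. 4 * m\<^sup>2) + 2 * F (\<lambda>m. 2 * m)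
      + ex 2 * (8 * F (\<lambda>m. 1) - 2 * (24 * of_nat n * F (\<lambda>m. 1) + F (\<lambda>m. 4 * m\<^sup>2)))
      + ex 4 * (24 * of_nat n * F (\<lambda>m. 1) + F (\<lambda>m. 4 * m\<^sup>2) - 2 * F (\<lambda>m. 2 * m))" .
  have e: "ex 4 = ex 2 * ex 2" "ex 2 * ex (-2) = 1"
    using ex_add[of 2 2] ex_add[of 2 "-2"] by simp_all
  have num: "(24 * f) $ n = 24 * f $ n" "(8 * f) $ n = 8 * f $ n" "(2 * fps_const c * f) $ n = 2 * (c * f $ n)"
    for f :: "rat fps fps" and c
    by (simp_all add: fps_numeral_fps_const mult.assoc)
  have 2: "(fps_const (ex 2) *
     (fps_const (ex 2 - 2 + ex (-2)) * (24 * (fps_X * fps_deriv (zexp rank_num)) + dt (dt (zexp rank_num)))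
      - 2 * fps_const (ex 2 - ex (-2)) * dt (zexp rank_num) + 8 * zexp rank_num)) $ n =
    ex 2 * ((ex 2 - 2 + ex (-2)) * (24 * (of_nat n * F (\<lambda>m. 1)) + F (\<lambda>m. 4 * m\<^sup>2))
      - 2 * ((ex 2 - ex (-2)) * F (\<lambda>m. 2 * m)) + 8 * F (\<lambda>m. 1))"
    by (simp only: fps_mult_left_const_nth fps_add_nth fps_sub_nth num R R' R'' Rq)
  show "zexp rank_pde $ n = (fps_const (ex 2) *
     (fps_const (ex 2 - 2 + ex (-2)) * (24 * (fps_X * fps_deriv (zexp rank_num)) + dt (dt (zexp rank_num)))
      - 2 * fps_const (ex 2 - ex (-2)) * dt (zexp rank_num) + 8 * zexp rank_num)) $ n"
    unfolding 1 2 by (rule zexp_rank_pde_algebra[OF e])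
qed

section \<open>Exchange of the variables q and t\<close>

definition swap_vars :: "rat fps fps \<Rightarrow> rat fps fps" where
  "swap_vars f = Abs_fps (\<lambda>k. Abs_fps (\<lambda>n. f $ n $ k))"

lemma swap_vars_nth: "swap_vars f $ k $ n = f $ n $ k"
  by (simp add: swap_vars_def)

lemma swap_vars_eqI: "(\<And>k n. f $ k $ n = g $ k $ n) \<Longrightarrow> f = (g :: rat fps fps)"
  by (intro fps_ext)

lemma swap_vars_add: "swap_vars (f + g) = swap_vars f + swap_vars g"
  and swap_vars_diff: "swap_vars (f - g) = swap_vars f - swap_vars g"
  by (intro swap_vars_eqI; simp add: swap_vars_nth)+

lemma swap_vars_mult: "swap_vars (f * g) = swap_vars f * swap_vars g"
proof (rule swap_vars_eqI)
  fix k n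
  have "swap_vars (f * g) $ k $ n = (\<Sum>i=0..n. \<Sum>l=0..k. f $ i $ l * g $ (n - i) $ (k - l))"
    by (simp add: swap_vars_nth fps_mult_nth fps_sum_nth)
  also have "\<dots> = (\<Sum>l=0..k. \<Sum>i=0..n. f $ i $ l * g $ (n - i) $ (k - l))"
    by (rule sum.swap)
  also have "\<dots> = (swap_vars f * swap_vars g) $ k $ n"
    by (simp add: swap_vars_nth fps_mult_nth fps_sum_nth)
  finally show "swap_vars (f * g) $ k $ n = (swap_vars f * swap_vars g) $ k $ n" .
qed

definition lift :: "rat fps \<Rightarrow> rat fps fps" where
  "lift g = Abs_fps (\<lambda>k. fps_const (g $ k))"

lemma lift_nth: "lift g $ k = fps_const (g $ k)"
  by (simp add: lift_def)

lemma swap_vars_const: "swap_vars (fps_const g) = lift g"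
  by (intro swap_vars_eqI) (simp add: swap_vars_nth lift_nth)

lemma lift_add: "lift (f + g) = lift f + lift g"
  by (intro fps_ext) (simp add: lift_nth)

lemma lift_mult: "lift (f * g) = lift f * lift g"
  using swap_vars_mult[of "fps_const f" "fps_const g"] by (simp add: swap_vars_const)

lemma lift_numeral: "lift (numeral k) = numeral k"
  by (intro swap_vars_eqI) (simp add: lift_nth fps_numeral_nth)

lemma lift_1: "lift 1 = 1"
  by (intro swap_vars_eqI) (simp add: lift_nth)

lemma lift_X: "lift fps_X = fps_X"
  by (intro swap_vars_eqI) (simp add: lift_nth fps_X_def)

lemma swap_vars_numeral: "swap_vars (numeral k) = numeral k"
  using swap_vars_const[of "numeral k"] by (simp add: lift_numeral flip: fps_numeral_fps_const)

lemma fps_deriv_lift: "fps_deriv (lift g) = lift (fps_deriv g)"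
  by (intro swap_vars_eqI) (simp add: lift_nth fps_of_nat [symmetric] del: of_nat_Suc)

definition qd :: "rat fps fps \<Rightarrow> rat fps fps" where
  "qd f = Abs_fps (\<lambda>k. fps_X * fps_deriv (f $ k))"

lemma qd_nth: "qd f $ k = fps_X * fps_deriv (f $ k)"
  by (simp add: qd_def)

lemma X_deriv_nth: "(fps_X * fps_deriv f) $ n = of_nat n * (f :: 'a::comm_ring_1 fps) $ n"
  by (cases n) auto

lemma of_nat_fps_nth_nth: "(of_nat n * (f :: rat fps)) $ k = of_nat n * f $ k"
  by (simp flip: fps_of_nat)

lemma swap_vars_X_deriv: "swap_vars (fps_X * fps_deriv f) = qd (swap_vars f)"
  by (intro swap_vars_eqI) (simp only: swap_vars_nth qd_nth X_deriv_nth of_nat_fps_nth_nth)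

lemma swap_vars_X_times_deriv: "swap_vars fps_X * swap_vars (fps_deriv f) = qd (swap_vars f)"
  by (simp only: swap_vars_mult[symmetric] swap_vars_X_deriv)

lemma swap_vars_dt: "swap_vars (dt f) = fps_deriv (swap_vars f)"
  by (intro swap_vars_eqI)
    (simp add: swap_vars_nth dt_def of_nat_fps_nth_nth del: of_nat_Suc)

lemma qd_lift_mult: "qd (lift g * f) = lift g * qd f"
proof (rule fps_ext)
  fix k
  show "qd (lift g * f) $ k = (lift g * qd f) $ k"
    by (simp add: qd_nth fps_mult_nth lift_nth fps_deriv_sum sum_distrib_left mult.left_commute)
qed

text \<open>\<open>sh\<close> and \<open>ch\<close> are 2 sinh t and 2 cosh t, that is, the
  difference and the sum of z^(1/2) and z^(-1/2).\<close>

definition sh :: "rat fps fps" where "sh = lift (ex 1 - ex (-1))"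
definition ch :: "rat fps fps" where "ch = lift (ex 1 + ex (-1))"

lemma ex_1: "ex 1 * ex (-1) = 1" "ex 1 * ex 1 = ex 2" "ex (-1) * ex (-1) = ex (-2)"
  using ex_add[of 1 "-1"] ex_add[of 1 1] ex_add[of "-1" "-1"] by simp_all

lemma sh_sq: "lift (ex 2 - 2 + ex (-2)) = sh\<^sup>2"
  and sh_ch: "lift (ex 2 - ex (-2)) = sh * ch"
  and ch_sq: "ch\<^sup>2 = sh\<^sup>2 + 4"
proof -
  have *: "c - 2 + d = (a - b) * (a - b)" "c - d = (a - b) * (a + b)"
    "(a + b) * (a + b) = (a - b) * (a - b) + 4"
    if "a * b = 1" "a * a = c" "b * b = d" for a b c d :: "rat fps"
    using that by algebra+
  note * = *[OF ex_1]
  show "lift (ex 2 - 2 + ex (-2)) = sh\<^sup>2" "lift (ex 2 - ex (-2)) = sh * ch"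
    by (simp_all only: * sh_def ch_def lift_mult power2_eq_square)
  from arg_cong[OF *(3), of lift] show "ch\<^sup>2 = sh\<^sup>2 + 4"
    by (simp only: sh_def ch_def lift_mult lift_add lift_numeral power2_eq_square)
qed

lemma fps_deriv_sh: "fps_deriv sh = ch" and fps_deriv_ch: "fps_deriv ch = sh"
  by (simp_all add: sh_def ch_def fps_deriv_lift flip: fps_const_neg)

definition Rt :: "rat fps fps" where "Rt = swap_vars (zexp rank_num)"
definition Tt :: "rat fps fps" where "Tt = swap_vars tau_exp"

lemma narrow_causal_tau_rank_pde:
  "narrow (tau rank_pde)" "narrow (tau (tau rank_pde))"
  by (intro narrow_tau causal_tau narrow_rank_pde causal_rank_pde)+

text \<open>Only the column \<open>m = 1\<close> survives multiplication by the cube; its factor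
  \<open>ex 2\<close> cancels against the one in \<open>zexp_rank_pde\<close>, which leaves a
  right-hand side free of t.\<close>

lemma rank_pde_zexp:
  "\<exists>w. tau_exp ^ 3 *
     (fps_const (ex 2 - 2 + ex (-2)) * (24 * (fps_X * fps_deriv (zexp rank_num)) + dt (dt (zexp rank_num)))
      - 2 * fps_const (ex 2 - ex (-2)) * dt (zexp rank_num) + 8 * zexp rank_num)
    = Abs_fps (\<lambda>n. fps_const (w n))" (is "\<exists>w. _ * ?L = _")
proof
  define w :: "nat \<Rightarrow> rat" where "w n = of_int (tau (tau (tau rank_pde)) 1 (int n))" for n
  let ?W = "Abs_fps (\<lambda>n. fps_const (w n))"
  have "zexp (tau (tau (tau rank_pde))) = fps_const (ex 2) * ?W"
  proof (rule fps_ext)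
    fix n
    have "zexp (tau (tau (tau rank_pde))) $ n =
      (\<Sum>m\<in>{- int n - 3..int n + 3}. if m = 1 then fps_const (w n) * ex (2 * m) else 0)"
      unfolding zexp_def fps_nth_Abs_fps
      by (intro sum.cong refl) (auto simp: tau_cube_rank_pde w_def)
    also have "\<dots> = fps_const (w n) * ex 2"
      by (subst sum.delta) auto
    finally show "zexp (tau (tau (tau rank_pde))) $ n = (fps_const (ex 2) * ?W) $ n"
      by (simp add: mult.commute)
  qed
  moreover have "zexp (tau (tau (tau rank_pde))) = tau_exp ^ 3 * zexp rank_pde"
    by (simp add: zexp_tau narrow_causal_tau_rank_pde narrow_rank_pde causal_rank_pde power3_eq_cube mult.assoc)
  ultimately have "fps_const (ex 2) * ?W = fps_const (ex 2) * (tau_exp ^ 3 * ?L)"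
    by (simp only: zexp_rank_pde) (simp only: mult_ac)
  moreover have "ex 2 \<noteq> 0"
    by (simp add: fps_eq_iff exI[of _ 0])
  then have "fps_const (ex 2) \<noteq> 0" by simp
  ultimately show "tau_exp ^ 3 * ?L = ?W" by simp
qed

text \<open>Here \<open>t\<close> is the outer and \<open>q\<close> the inner variable.\<close>

lemma rank_pde_Rt:
  "\<exists>W. Tt ^ 3 * (sh\<^sup>2 * (24 * qd Rt + fps_deriv (fps_deriv Rt)) - 2 * sh * ch * fps_deriv Rt + 8 * Rt)
    = fps_const W"
proof -
  obtain w where w: "tau_exp ^ 3 *
     (fps_const (ex 2 - 2 + ex (-2)) * (24 * (fps_X * fps_deriv (zexp rank_num)) + dt (dt (zexp rank_num)))
      - 2 * fps_const (ex 2 - ex (-2)) * dt (zexp rank_num) + 8 * zexp rank_num)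
    = Abs_fps (\<lambda>n. fps_const (w n))"
    using rank_pde_zexp by blast
  have "swap_vars (Abs_fps (\<lambda>n. fps_const (w n))) = fps_const (Abs_fps w)"
    by (intro swap_vars_eqI) (simp add: swap_vars_nth)
  with arg_cong[OF w, of swap_vars] show ?thesis
    unfolding power3_eq_cube
    by (simp only: swap_vars_mult swap_vars_add swap_vars_diff swap_vars_numeral swap_vars_const
        swap_vars_X_times_deriv swap_vars_dt sh_sq sh_ch Rt_def[symmetric] Tt_def[symmetric] mult.assoc) blast
qed

definition sh1 :: "rat fps" where "sh1 = fps_shift 1 (ex 1 - ex (-1))"

text \<open>\<open>Gt\<close> is \<open>t\<close> times the generating function of \<open>A(m, n)\<close>, symmetrized by \<open>z\<^sup>1\<^sup>/\<^sup>2\<close>, so that the equation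
  loses its first-order term; the powers of \<open>t\<close> in \<open>Mt\<close> clear the pole at \<open>t = 0\<close>.\<close>

definition Gt :: "rat fps fps" where "Gt = lift (inverse sh1) * Rt"

lemma sh1_eq: "fps_X * sh1 = ex 1 - ex (-1)"
proof (rule fps_ext)
  fix n
  show "(fps_X * sh1) $ n = (ex 1 - ex (-1)) $ n"
    by (cases n) (simp_all add: sh1_def)
qed

lemma sh1_nth: "sh1 $ k = (1 - (-1) ^ Suc k) / fact (Suc k)"
  by (simp add: sh1_def diff_divide_distrib del: fact_Suc power_Suc)

lemma Gt_sh1: "Gt * lift sh1 = Rt"
proof -
  have "sh1 $ 0 \<noteq> 0" by (simp add: sh1_nth)
  then have "inverse sh1 * sh1 = 1" by (rule inverse_mult_eq_1)
  then have "lift (inverse sh1) * lift sh1 = 1" by (simp only: lift_mult[symmetric] lift_1)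
  moreover have "Gt * lift sh1 = lift (inverse sh1) * lift sh1 * Rt"
    by (simp only: Gt_def mult_ac)
  ultimately show ?thesis by simp
qed

lemma Gt_sh: "Gt * sh = fps_X * Rt"
  unfolding sh_def sh1_eq[symmetric] lift_mult lift_X Gt_sh1[symmetric] by (rule mult.left_commute)

definition Mt :: "rat fps fps" where
  "Mt = fps_X\<^sup>2 * (24 * qd Gt - Gt + fps_deriv (fps_deriv Gt)) - 2 * fps_X * fps_deriv Gt + 2 * Gt"

text \<open>With s' = c and c' = s, the second and third hypotheses are the first two t-derivatives
  of the first one. Substituting for R and its derivatives cancels the mixed terms in c, up to a
  multiple of \<open>c\<^sup>2 - (s\<^sup>2 + 4)\<close>.\<close>

lemma rank_pde_algebra:
  fixes t :: "'a::idom"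
  assumes 0: "G * s = t * R" and 1: "G' * s + G * c = t * R' + R"
    and 2: "G'' * s + 2 * G' * c + G * s = t * R'' + 2 * R'" and 3: "s * qG = t * qR" and 4: "c\<^sup>2 = s\<^sup>2 + 4"
  shows "t ^ 3 * (s\<^sup>2 * (24 * qR + R'') - 2 * s * c * R' + 8 * R) =
    s ^ 3 * (t\<^sup>2 * (24 * qG - G + G'') - 2 * t * G' + 2 * G)"
proof -
  have a: "t * (t * R') = t * G' * s + t * G * c - G * s"
    using arg_cong[OF 1, of "(*) t"] 0 by (simp add: algebra_simps)
  have "t * R'' = G'' * s + 2 * G' * c + G * s - 2 * R'"
    using 2 by (simp add: algebra_simps)
  then have "t\<^sup>2 * (t * R'') = t\<^sup>2 * (G'' * s + 2 * G' * c + G * s - 2 * R')"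
    by (rule arg_cong)
  also have "t\<^sup>2 * (t * R'') = t ^ 3 * R''"
    by algebra
  also have "t\<^sup>2 * (G'' * s + 2 * G' * c + G * s - 2 * R')
      = t\<^sup>2 * (G'' * s + 2 * G' * c + G * s) - 2 * (t * (t * R'))"
    by algebra
  finally have b: "t ^ 3 * R'' = t\<^sup>2 * (G'' * s + 2 * G' * c + G * s) - 2 * (t * G' * s + t * G * c - G * s)"
    unfolding a .
  have "t ^ 3 * (s\<^sup>2 * (24 * qR + R'') - 2 * s * c * R' + 8 * R) =
      s\<^sup>2 * (24 * t\<^sup>2 * (t * qR) + t ^ 3 * R'') - 2 * s * c * t * (t * (t * R')) + 8 * t\<^sup>2 * (t * R)"
    by algebra
  also have "\<dots> = s ^ 3 * (t\<^sup>2 * (24 * qG - G + G'') - 2 * t * G' + 2 * G)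
      - 2 * t\<^sup>2 * G * s * (c\<^sup>2 - (s\<^sup>2 + 4))"
    unfolding a b 3[symmetric] 0[symmetric]
    by algebra
  finally show ?thesis unfolding 4 by simp
qed

lemma rank_pde_Mt: "\<exists>W. (Tt * sh) ^ 3 * Mt = fps_X ^ 3 * fps_const W"
proof -
  obtain W where W: "Tt ^ 3 * (sh\<^sup>2 * (24 * qd Rt + fps_deriv (fps_deriv Rt))
      - 2 * sh * ch * fps_deriv Rt + 8 * Rt) = fps_const W"
    using rank_pde_Rt by blast
  let ?t = "fps_X :: rat fps fps"
  have 0: "Gt * sh = ?t * Rt" by (rule Gt_sh)
  have 1: "fps_deriv Gt * sh + Gt * ch = ?t * fps_deriv Rt + Rt"
    using arg_cong[OF 0, of fps_deriv] by (simp add: fps_deriv_sh add.commute)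
  have 2: "fps_deriv (fps_deriv Gt) * sh + 2 * fps_deriv Gt * ch + Gt * sh
      = ?t * fps_deriv (fps_deriv Rt) + 2 * fps_deriv Rt"
    using arg_cong[OF 1, of fps_deriv] by (simp add: fps_deriv_sh fps_deriv_ch algebra_simps)
  have 3: "sh * qd Gt = ?t * qd Rt"
    using arg_cong[OF 0, of qd] qd_lift_mult[of "ex 1 - ex (-1)" Gt] qd_lift_mult[of fps_X Rt]
    by (simp only: sh_def lift_X mult.commute[of Gt])
  from rank_pde_algebra[OF 0 1 2 3 ch_sq] have "(Tt * sh) ^ 3 * Mt =
      ?t ^ 3 * (Tt ^ 3 * (sh\<^sup>2 * (24 * qd Rt + fps_deriv (fps_deriv Rt))
      - 2 * sh * ch * fps_deriv Rt + 8 * Rt))"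
    unfolding Mt_def power_mult_distrib
    by (simp only: mult.assoc mult.left_commute[of "fps_X ^ 3"])
  then show ?thesis unfolding W by blast
qed

section \<open>Rank moments\<close>

text \<open>Up to a power of \<open>q\<close>, \<open>J i\<close> is \<open>(8 q d/dq)\<^sup>i\<close> applied to \<open>\<eta>\<^sup>3\<close>.\<close>

definition P :: "int fps" where
  "P = Abs_fps (\<lambda>n. part_num (int n))"

definition J :: "nat \<Rightarrow> int fps" where
  "J i = qseries trin (\<lambda>k. (- 1) ^ k * (2 * int k + 1) ^ (2 * i + 1))"

definition moment :: "nat \<Rightarrow> int fps" where
  "moment k = Abs_fps (\<lambda>n. \<Sum>m\<in>{- int n..int n}. m ^ k * rank_num m (int n))"

lemma P_nth: "P $ n = part_num (int n)"
  by (simp add: P_def)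

lemma P_nth_0: "P $ 0 = 1"
  by (simp add: P_nth part_num_0)

lemma J_nth: "J i $ n = (\<Sum>k | trin k = n. (- 1) ^ k * (2 * int k + 1) ^ (2 * i + 1))"
  by (simp add: J_def qseries_nth)

lemma moment_0: "moment 0 = P"
proof (rule fps_ext)
  fix n
  have "(\<Sum>m\<in>{- int n..int n}. rank_num m (int n))
      = rank_le_num (int n) (int n) - rank_le_num (- int n - 1) (int n)"
    using sum_telescope_symmetric[of "\<lambda>m. - rank_le_num (m - 1) (int n)" n]
    by (simp add: rank_num_def)
  then show "moment 0 $ n = P $ n"
    by (simp add: moment_def P_nth rank_le_num_low rank_le_num_high)
qed

text \<open>Completing the square; on the support of \<open>J\<close>, raising \<open>i\<close> by
  one thus multiplies the coefficient by 8n + 1.\<close>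

lemma trin_eq_iff: "trin k = n \<longleftrightarrow> (2 * int k + 1)\<^sup>2 = 8 * int n + 1"
proof -
  have "(2 * int k + 1)\<^sup>2 = 4 * int (k * (k + 1)) + 1"
    by (simp add: power2_eq_square algebra_simps)
  then show ?thesis using two_mult_trin[of k] by presburger
qed

lemma J_Suc_nth: "J (Suc i) $ n = (8 * int n + 1) * J i $ n"
  unfolding J_nth sum_distrib_left
proof (rule sum.cong[OF refl])
  fix k assume "k \<in> {k. trin k = n}"
  then have "8 * int n + 1 = (2 * int k + 1)\<^sup>2" by (simp add: trin_eq_iff)
  then show "(- 1) ^ k * (2 * int k + 1) ^ (2 * Suc i + 1)
      = (8 * int n + 1) * ((- 1) ^ k * (2 * int k + 1) ^ (2 * i + 1))"
    by (simp only: power2_eq_square) (simp add: mult_ac)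
qed

lemma J_Suc: "J (Suc i) = 8 * (fps_X * fps_deriv (J i)) + J i"
proof (rule fps_ext)
  fix n
  show "J (Suc i) $ n = (8 * (fps_X * fps_deriv (J i)) + J i) $ n"
    unfolding fps_add_nth fps_numeral_fps_const fps_mult_left_const_nth X_deriv_nth J_Suc_nth
    by (simp add: algebra_simps)
qed

lemma J_0_nth_0: "J 0 $ 0 = 1"
proof -
  have "trin k = 0 \<longleftrightarrow> k = 0" for k
    using le_trin[of k] by (auto simp: trin_def)
  then have "{k. trin k = 0} = {0}" by auto
  then show ?thesis by (simp add: J_nth)
qed

text \<open>The expansions in t have denominators, so identities are derived over the rationals and
  pulled back by \<open>ri_inj\<close>.\<close>

definition ri :: "int fps \<Rightarrow> rat fps" where
  "ri f = Abs_fps (\<lambda>n. of_int (f $ n))"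

lemma ri_nth: "ri f $ n = of_int (f $ n)"
  by (simp add: ri_def)

lemma ri_add: "ri (f + g) = ri f + ri g"
  and ri_diff: "ri (f - g) = ri f - ri g"
  and ri_mult: "ri (f * g) = ri f * ri g"
  and ri_1: "ri 1 = 1"
  and ri_0: "ri 0 = 0"
  by (auto intro!: fps_ext simp: ri_nth fps_mult_nth)

lemma ri_numeral: "ri (numeral k) = numeral k"
  by (rule fps_ext) (simp add: ri_nth fps_numeral_nth)

lemma ri_power: "ri (f ^ k) = ri f ^ k"
  by (induction k) (simp_all add: ri_mult ri_1)

lemma ri_X_deriv: "ri (fps_X * fps_deriv f) = fps_X * fps_deriv (ri f)"
  by (rule fps_ext) (simp only: ri_nth X_deriv_nth of_int_mult of_int_of_nat_eq)

lemma ri_inj: "ri f = ri g \<longleftrightarrow> f = g"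
  by (auto simp: fps_eq_iff ri_nth)

section \<open>Expansion of theta and of the rank series in powers of t\<close>

lemma minus_one_power_mult_nth: "((- 1) ^ k * f) $ n = (- 1) ^ k * (f :: 'a::comm_ring_1 fps) $ n"
  by (cases "even k") simp_all

text \<open>The inner sum telescopes to 2 sinh((2k+1)t), whose Taylor coefficients produce the
  series \<open>J i\<close>.\<close>

lemma tau_exp_sh:
  "tau_exp * fps_const (ex 1 - ex (-1)) =
     qseries trin (\<lambda>k. (- 1) ^ k * (ex (2 * int k + 1) - ex (- (2 * int k + 1))))"
proof (rule fps_ext)
  fix n
  have "(\<Sum>j\<in>{- int k..int k}. ex (2 * j)) * (ex 1 - ex (-1)) = ex (2 * int k + 1) - ex (- (2 * int k + 1))"
    for k
  proof -
    have "ex (2 * j) * (ex 1 - ex (-1)) = (- ex (2 * j - 1)) - (- ex (2 * (j + 1) - 1))" for j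
      using ex_add[of "2 * j" 1] ex_add[of "2 * j" "-1"]
      by (simp only: right_diff_distrib) (simp add: algebra_simps)
    then have "(\<Sum>j\<in>{- int k..int k}. ex (2 * j)) * (ex 1 - ex (-1))
        = (\<Sum>j\<in>{- int k..int k}. (- ex (2 * j - 1)) - (- ex (2 * (j + 1) - 1)))"
      by (simp only: sum_distrib_right)
    also have "\<dots> = - ex (2 * (- int k) - 1) - (- ex (2 * (int k + 1) - 1))"
      by (rule sum_telescope_symmetric)
    also have "2 * (- int k) - 1 = - (2 * int k + 1)" by simp
    also have "2 * (int k + 1) - 1 = 2 * int k + 1" by simp
    also have "- ex (- (2 * int k + 1)) - (- ex (2 * int k + 1)) = ex (2 * int k + 1) - ex (- (2 * int k + 1))"
      by (simp only: diff_minus_eq_add) (rule uminus_add_conv_diff)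
    finally show ?thesis .
  qed
  then show "(tau_exp * fps_const (ex 1 - ex (-1))) $ n =
     qseries trin (\<lambda>k. (- 1) ^ k * (ex (2 * int k + 1) - ex (- (2 * int k + 1)))) $ n"
    unfolding fps_mult_right_const_nth tau_exp_def qseries_nth sum_distrib_right mult.assoc by simp
qed

text \<open>The symmetrized theta series divided by 2t: even in t, with value \<open>J 0\<close> at
  t = 0.\<close>

definition Th :: "rat fps fps" where
  "Th = fps_const (fps_const (1 / 2)) * fps_shift 1 (Tt * sh)"

lemma Tt_sh_nth:
  "(Tt * sh) $ i $ n = (\<Sum>k | trin k = n.
     (- 1) ^ k * ((of_int (2 * int k + 1)) ^ i - (- of_int (2 * int k + 1)) ^ i) / fact i)"
proof -
  have "Tt * sh = swap_vars (tau_exp * fps_const (ex 1 - ex (-1)))"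
    by (simp add: Tt_def sh_def swap_vars_mult swap_vars_const)
  then show ?thesis
    unfolding tau_exp_sh
    by (simp add: swap_vars_nth qseries_nth fps_sum_nth minus_one_power_mult_nth diff_divide_distrib
        right_diff_distrib)
qed

lemma Th_nth: "Th $ i $ n = (1 / 2) * (Tt * sh) $ (i + 1) $ n"
  by (simp add: Th_def)

lemma Th_odd: "\<forall>i. odd i \<longrightarrow> Th $ i = 0"
proof (intro allI impI fps_ext)
  fix i n :: nat assume "odd i"
  then have "even (i + 1)" by simp
  then show "Th $ i $ n = 0 $ n"
    unfolding Th_nth Tt_sh_nth power_minus_even[OF \<open>even (i + 1)\<close>] by simp
qed

lemma Th_even: "Th $ (2 * i) = fps_const (1 / fact (2 * i + 1)) * ri (J i)"
proof (rule fps_ext)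
  fix n
  have o: "odd (2 * i + 1)" by simp
  have "Th $ (2 * i) $ n = (1 / 2) * (\<Sum>k | trin k = n. (- 1) ^ k * (2 * (of_int (2 * int k + 1)) ^ (2 * i + 1)) / fact (2 * i + 1))"
    unfolding Th_nth Tt_sh_nth power_minus_odd[OF o]
    by (intro arg_cong2[where f = "(*)"] sum.cong refl) simp
  also have "\<dots> = (1 / fact (2 * i + 1)) * ri (J i) $ n"
    by (simp add: ri_nth J_nth sum_distrib_left sum_divide_distrib)
  finally show "Th $ (2 * i) $ n = (fps_const (1 / fact (2 * i + 1)) * ri (J i)) $ n"
    by simp
qed

lemma Tt_sh_eq: "Tt * sh = 2 * (fps_X * Th)"
proof (rule fps_ext)
  fix i
  have half: "2 * (fps_const (1 / 2) * f) = f" for f :: "rat fps"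
    by (simp add: fps_numeral_fps_const flip: mult.assoc)
  have "(2 * (fps_X * Th)) $ i = 2 * (fps_X * Th) $ i"
    by (simp only: fps_numeral_fps_const fps_mult_left_const_nth)
  also have "\<dots> = (Tt * sh) $ i"
  proof (cases i)
    case 0
    have "(Tt * sh) $ 0 = 0" by (rule fps_ext) (simp only: Tt_sh_nth, simp)
    then show ?thesis using 0 by simp
  next
    case (Suc j)
    then show ?thesis by (simp add: Th_def half)
  qed
  finally show "(Tt * sh) $ i = (2 * (fps_X * Th)) $ i" by simp
qed

text \<open>The factor t^3 cancels. Every coefficient of a positive power of t in the product
  therefore vanishes, which is the source of all moment relations below.\<close>

lemma rank_pde_Th: "\<exists>W. Th ^ 3 * Mt = fps_const W"
proof -
  obtain W where "(Tt * sh) ^ 3 * Mt = fps_X ^ 3 * fps_const W"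
    using rank_pde_Mt by blast
  then have "fps_X ^ 3 * (8 * (Th ^ 3 * Mt)) = fps_X ^ 3 * fps_const W"
    unfolding Tt_sh_eq power_mult_distrib by (simp add: mult_ac)
  then have 8: "8 * (Th ^ 3 * Mt) = fps_const W" by simp
  have "(Th ^ 3 * Mt) $ k = 0" if "k > 0" for k
  proof -
    have "8 * (Th ^ 3 * Mt) $ k = (8 * (Th ^ 3 * Mt)) $ k"
      by (simp only: fps_numeral_fps_const fps_mult_left_const_nth)
    also have "\<dots> = 0" unfolding 8 using that by simp
    finally show ?thesis by simp
  qed
  then have "Th ^ 3 * Mt = fps_const ((Th ^ 3 * Mt) $ 0)"
    by (intro fps_ext) auto
  then show ?thesis by blast
qed

lemma Rt_nth: "Rt $ k = fps_const (2 ^ k / fact k) * ri (moment k)"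
proof (rule fps_ext)
  fix n
  have "Rt $ k $ n = (\<Sum>m\<in>{- int n - 3..int n + 3}. of_int (rank_num m (int n)) * (2 * of_int m) ^ k / fact k)"
    by (simp add: Rt_def swap_vars_nth zexp_def fps_sum_nth)
  also have "\<dots> = (\<Sum>m\<in>{- int n..int n}. of_int (rank_num m (int n)) * (2 * of_int m) ^ k / fact k)"
    by (intro sum.mono_neutral_right) (auto simp: rank_num_outside)
  also have "\<dots> = (fps_const (2 ^ k / fact k) * ri (moment k)) $ n"
    by (simp add: ri_nth moment_def sum_distrib_left power_mult_distrib mult_ac sum_divide_distrib)
  finally show "Rt $ k $ n = (fps_const (2 ^ k / fact k) * ri (moment k)) $ n" .
qed

definition D :: "rat fps \<Rightarrow> rat fps" where
  "D f = 24 * (fps_X * fps_deriv f) - f"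

lemma D_nth: "D f $ n = (24 * of_nat n - 1) * f $ n"
  unfolding D_def fps_sub_nth fps_numeral_fps_const fps_mult_left_const_nth X_deriv_nth
  by (simp add: algebra_simps)

lemma numeral_mult_nth: "(numeral v * f) $ n = numeral v * (f :: 'a::comm_ring_1 fps) $ n"
  by (subst fps_numeral_fps_const) (rule fps_mult_left_const_nth)

lemma Mt_0: "Mt $ 0 = 2 * Gt $ 0"
  unfolding Mt_def fps_add_nth fps_sub_nth mult.assoc numeral_mult_nth power2_eq_square
  by simp

text \<open>The factor arises as (k+2)(k+1) - 2(k+2) + 2 = k(k+1) from the terms without
  q-derivative.\<close>

lemma Mt_Suc_Suc: "Mt $ (k + 2) = D (Gt $ k) + of_nat (k * (k + 1)) * Gt $ (k + 2)"
proof -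
  have X: "(fps_X\<^sup>2 * f) $ (k + 2) = f $ k" "(fps_X * f) $ (k + 2) = f $ (k + 1)" for f :: "rat fps fps"
    by (simp_all add: fps_X_power_mult_nth)
  have "Mt $ (k + 2) = 24 * qd Gt $ k - Gt $ k + of_nat (k + 1) * (of_nat (k + 2) * Gt $ (k + 2))
      - 2 * (of_nat (k + 2) * Gt $ (k + 2)) + 2 * Gt $ (k + 2)"
    unfolding Mt_def fps_add_nth fps_sub_nth mult.assoc numeral_mult_nth X fps_deriv_nth
    by (simp only: add.assoc one_add_one)
  then show ?thesis by (simp add: D_def qd_nth algebra_simps)
qed

lemma atLeast0_atMost_numerals:
  "{0..2::nat} = {0,1,2}" "{0..4::nat} = {0,1,2,3,4}" "{0..6::nat} = {0,1,2,3,4,5,6}"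
  "{0..8::nat} = {0,1,2,3,4,5,6,7,8}"
  by auto

lemma fps_mult_even_nth:
  fixes f g :: "'a::comm_ring_1 fps"
  assumes "\<forall>k. odd k \<longrightarrow> f $ k = 0"
  shows "(f * g) $ 2 = f $ 0 * g $ 2 + f $ 2 * g $ 0"
    "(f * g) $ 4 = f $ 0 * g $ 4 + f $ 2 * g $ 2 + f $ 4 * g $ 0"
    "(f * g) $ 6 = f $ 0 * g $ 6 + f $ 2 * g $ 4 + f $ 4 * g $ 2 + f $ 6 * g $ 0"
    "(f * g) $ 8 = f $ 0 * g $ 8 + f $ 2 * g $ 6 + f $ 4 * g $ 4 + f $ 6 * g $ 2 + f $ 8 * g $ 0"
  using assms by (simp_all add: fps_mult_nth atLeast0_atMost_numerals)

text \<open>\<open>Rt\<close> is divided by 2 sinh t / t, whose coefficients are 2, 1/3, 1/60,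
  1/2520, 1/181440, by solving successively for the coefficients of \<open>Gt\<close>.\<close>

lemma Gt_nth:
  defines "N \<equiv> \<lambda>k. ri (moment k)" and "c \<equiv> fps_const :: rat \<Rightarrow> rat fps"
  shows "Gt $ 0 = c (1/2) * N 0" "Gt $ 2 = N 2 - c (1/12) * N 0"
    "Gt $ 4 = c (1/3) * N 4 - c (1/6) * N 2 + c (7/720) * N 0"
    "Gt $ 6 = c (2/45) * N 6 - c (1/18) * N 4 + c (7/360) * N 2 - c (31/30240) * N 0"
    "Gt $ 8 = c (1/315) * N 8 - c (1/135) * N 6 + c (7/1080) * N 4 - c (31/15120) * N 2
       + c (127/1209600) * N 0"
proof -
  have odd: "\<forall>k. odd k \<longrightarrow> lift sh1 $ k = 0"
    by (simp add: lift_nth sh1_nth)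
  have R: "(lift sh1 * Gt) $ k $ n = 2 ^ k / fact k * N k $ n" for k n
    using Gt_sh1 Rt_nth[of k] by (simp add: N_def mult.commute)
  have 0: "2 * Gt $ 0 $ n = N 0 $ n" for n
    using R[of 0 n] by (simp add: lift_nth sh1_nth)
  have 2: "2 * Gt $ 2 $ n + Gt $ 0 $ n / 3 = 2 * N 2 $ n" for n
    using R[of 2 n] by (simp add: fps_mult_even_nth[OF odd] lift_nth sh1_nth fact_numeral)
  have 4: "2 * Gt $ 4 $ n + Gt $ 2 $ n / 3 + Gt $ 0 $ n / 60 = 2 / 3 * N 4 $ n" for n
    using R[of 4 n] by (simp add: fps_mult_even_nth[OF odd] lift_nth sh1_nth fact_numeral)
  have 6: "2 * Gt $ 6 $ n + Gt $ 4 $ n / 3 + Gt $ 2 $ n / 60 + Gt $ 0 $ n / 2520 = 4 / 45 * N 6 $ n" for n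
    using R[of 6 n] by (simp add: fps_mult_even_nth[OF odd] lift_nth sh1_nth fact_numeral)
  have 8: "2 * Gt $ 8 $ n + Gt $ 6 $ n / 3 + Gt $ 4 $ n / 60 + Gt $ 2 $ n / 2520 + Gt $ 0 $ n / 181440
      = 2 / 315 * N 8 $ n" for n
    using R[of 8 n] by (simp add: fps_mult_even_nth[OF odd] lift_nth sh1_nth fact_numeral)
  show g0: "Gt $ 0 = c (1/2) * N 0"
  proof (rule fps_ext)
    fix n show "Gt $ 0 $ n = (c (1/2) * N 0) $ n"
      using 0[of n] by (simp add: c_def)
  qed
  show g2: "Gt $ 2 = N 2 - c (1/12) * N 0"
  proof (rule fps_ext)
    fix n show "Gt $ 2 $ n = (N 2 - c (1/12) * N 0) $ n"
      using 0[of n] 2[of n] by (simp add: c_def)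
  qed
  show g4: "Gt $ 4 = c (1/3) * N 4 - c (1/6) * N 2 + c (7/720) * N 0"
  proof (rule fps_ext)
    fix n show "Gt $ 4 $ n = (c (1/3) * N 4 - c (1/6) * N 2 + c (7/720) * N 0) $ n"
      using 0[of n] 2[of n] 4[of n] by (simp add: c_def)
  qed
  show g6: "Gt $ 6 = c (2/45) * N 6 - c (1/18) * N 4 + c (7/360) * N 2 - c (31/30240) * N 0"
  proof (rule fps_ext)
    fix n show "Gt $ 6 $ n = (c (2/45) * N 6 - c (1/18) * N 4 + c (7/360) * N 2 - c (31/30240) * N 0) $ n"
      using 0[of n] 2[of n] 4[of n] 6[of n] by (simp add: c_def)
  qed
  show "Gt $ 8 = c (1/315) * N 8 - c (1/135) * N 6 + c (7/1080) * N 4 - c (31/15120) * N 2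
       + c (127/1209600) * N 0"
  proof (rule fps_ext)
    fix n show "Gt $ 8 $ n = (c (1/315) * N 8 - c (1/135) * N 6 + c (7/1080) * N 4 - c (31/15120) * N 2
       + c (127/1209600) * N 0) $ n"
      using 0[of n] 2[of n] 4[of n] 6[of n] 8[of n] by (simp add: c_def)
  qed
qed

lemma Mt_even:
  "Mt $ 2 = D (Gt $ 0)" "Mt $ 4 = D (Gt $ 2) + 6 * Gt $ 4"
  "Mt $ 6 = D (Gt $ 4) + 20 * Gt $ 6" "Mt $ 8 = D (Gt $ 6) + 42 * Gt $ 8"
proof -
  show "Mt $ 2 = D (Gt $ 0)" using Mt_Suc_Suc[of 0] by (simp add: numeral_2_eq_2)
qed (use Mt_Suc_Suc[of 2] Mt_Suc_Suc[of 4] Mt_Suc_Suc[of 6] in simp_all)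

lemma Mt_0': "Mt $ 0 = ri P"
proof (rule fps_ext)
  fix n show "Mt $ 0 $ n = ri P $ n"
    unfolding Mt_0 Gt_nth moment_0 by (simp add: numeral_mult_nth)
qed

lemma Th_small:
  "Th $ 0 = ri (J 0)" "Th $ 2 = fps_const (1/6) * ri (J 1)" "Th $ 4 = fps_const (1/120) * ri (J 2)"
  "Th $ 6 = fps_const (1/5040) * ri (J 3)" "Th $ 8 = fps_const (1/362880) * ri (J 4)"
  using Th_even[of 0] Th_even[of 1] Th_even[of 2] Th_even[of 3] Th_even[of 4]
  by (simp_all add: fact_numeral)

text \<open>In the coefficient of t^2, \<open>Mt $ 0\<close> is \<open>P\<close> and
  \<open>Mt $ 2\<close> is half of \<open>D (ri P)\<close>; a factor \<open>J 0\<close> squared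
  cancels.\<close>

lemma J_P_deriv: "J 0 * (24 * (fps_X * fps_deriv P) - P) + J 1 * P = 0"
proof -
  obtain W where "Th ^ 3 * Mt = fps_const W" using rank_pde_Th by blast
  then have "(Th * (Th * (Th * Mt))) $ 2 = 0" by (simp add: power3_eq_cube mult.assoc)
  from this[unfolded fps_mult_even_nth[OF Th_odd] fps_mult_nth_0 Th_small Mt_0' Mt_even]
  have eq: "ri (J 0) * (ri (J 0) * (ri (J 0) * D (Gt $ 0) + 3 * (fps_const (1/6) * ri (J 1)) * ri P)) = 0"
    by (simp add: algebra_simps)
  have "ri (J 0) \<noteq> 0"
    using J_0_nth_0 by (metis ri_nth fps_zero_nth of_int_1 zero_neq_one)
  with eq have "ri (J 0) * D (Gt $ 0) + 3 * (fps_const (1/6) * ri (J 1)) * ri P = 0" by simp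
  then have "2 * (ri (J 0) * D (Gt $ 0) + 3 * (fps_const (1/6) * ri (J 1)) * ri P) = 0" by simp
  moreover have 1: "2 * D (Gt $ 0) = D (ri P)"
    by (rule fps_ext) (simp add: D_nth numeral_mult_nth Gt_nth moment_0)
  moreover have 2: "2 * (3 * (fps_const (1/6) * f)) = f" for f :: "rat fps"
    by (rule fps_ext) (simp add: numeral_mult_nth)
  ultimately have "ri (J 0) * D (ri P) + ri (J 1) * ri P = 0"
    unfolding distrib_left mult.left_commute[of 2 "ri (J 0)"] mult.assoc 1 2 by simp
  then have "ri (J 0 * (24 * (fps_X * fps_deriv P) - P) + J 1 * P) = ri 0"
    by (simp only: ri_add ri_diff ri_mult ri_numeral ri_X_deriv[unfolded ri_mult] ri_0 D_def)
  then show ?thesis by (simp only: ri_inj)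
qed

text \<open>Jacobi's identity for the cube of the Euler function; it is the coefficient of \<open>t\<^sup>2\<close>
  in the differential equation.\<close>

lemma J_P_cube: "J 0 * P ^ 3 = 1"
proof -
  have "8 * (fps_X * (3 * (J 0 * fps_deriv P) + fps_deriv (J 0) * P)) = 0"
    using J_P_deriv J_Suc[of 0] by (simp add: algebra_simps)
  then have "3 * (J 0 * fps_deriv P) + fps_deriv (J 0) * P = 0" by simp
  moreover have "fps_deriv (J 0 * P ^ 3) = P\<^sup>2 * (3 * (J 0 * fps_deriv P) + fps_deriv (J 0) * P)"
    by (simp add: power2_eq_square power3_eq_cube algebra_simps)
  ultimately have "fps_deriv (J 0 * P ^ 3) = 0" by simp
  then have "J 0 * P ^ 3 = fps_const ((J 0 * P ^ 3) $ 0)" by (simp only: fps_deriv_eq_0_iff)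
  moreover have "(J 0 * P ^ 3) $ 0 = 1"
    by (simp add: J_0_nth_0 P_nth_0 power3_eq_cube)
  ultimately show ?thesis by simp
qed

text \<open>\<open>j 1\<close> is the Eisenstein series \<open>E\<^sub>2\<close>.\<close>

definition j :: "nat \<Rightarrow> int fps" where
  "j i = J i * P ^ 3"

text \<open>The hypotheses say that the coefficients of t^2 to t^8 vanish in (1 + r1 t^2 + r2 t^4 +
  ...)^3 (m0 + m2 t^2 + ...); the conclusions are coefficients of the inverse cube, times
  m0.\<close>

lemma solve_cube:
  fixes m0 :: "'a::idom"
  assumes 2: "m2 + 3 * r1 * m0 = 0"
    and 4: "m4 + 3 * r1 * m2 + (3 * r2 + 3 * r1\<^sup>2) * m0 = 0"
    and 6: "m6 + 3 * r1 * m4 + (3 * r2 + 3 * r1\<^sup>2) * m2 + (3 * r3 + 6 * r1 * r2 + r1 ^ 3) * m0 = 0"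
    and 8: "m8 + 3 * r1 * m6 + (3 * r2 + 3 * r1\<^sup>2) * m4 + (3 * r3 + 6 * r1 * r2 + r1 ^ 3) * m2
      + (3 * r4 + 6 * r1 * r3 + 3 * r2\<^sup>2 + 3 * r1\<^sup>2 * r2) * m0 = 0"
  shows "m4 = (6 * r1\<^sup>2 - 3 * r2) * m0"
    "m6 = (- 3 * r3 + 12 * r1 * r2 - 10 * r1 ^ 3) * m0"
    "m8 = (- 3 * r4 + 12 * r1 * r3 + 6 * r2\<^sup>2 - 30 * r1\<^sup>2 * r2 + 15 * r1 ^ 4) * m0"
proof -
  have m2: "m2 = - 3 * r1 * m0" using 2 by (simp add: add_eq_0_iff)
  show m4: "m4 = (6 * r1\<^sup>2 - 3 * r2) * m0" using 4 unfolding m2 by algebra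
  show m6: "m6 = (- 3 * r3 + 12 * r1 * r2 - 10 * r1 ^ 3) * m0" using 6 unfolding m2 m4 by algebra
  show "m8 = (- 3 * r4 + 12 * r1 * r3 + 6 * r2\<^sup>2 - 30 * r1\<^sup>2 * r2 + 15 * r1 ^ 4) * m0"
    using 8 unfolding m2 m4 m6 by algebra
qed

lemma Mt_solved:
  "120 * Mt $ 4 = ri (P * (20 * (j 1)\<^sup>2 - 3 * j 2))"
  "15120 * Mt $ 6 = ri (P * (252 * j 1 * j 2 - 9 * j 3 - 700 * j 1 ^ 3))"
  "604800 * Mt $ 8 = ri (P * (240 * j 1 * j 3 - 5 * j 4 + 252 * (j 2)\<^sup>2 - 4200 * (j 1)\<^sup>2 * j 2 + 7000 * j 1 ^ 4))"
proof -
  \<comment> \<open>The factor \<open>P ^ 3\<close> normalizes theta to constant term 1, by Jacobi's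
    identity; its coefficients become \<open>j i\<close> over (2i+1)!. The multipliers 120, 15120
    and 604800 clear the denominators.\<close>
  define V where "V = fps_const (ri P ^ 3) * Th"
  obtain W where W: "Th ^ 3 * Mt = fps_const W" using rank_pde_Th by blast
  have "V * (V * (V * Mt)) = fps_const (ri P ^ 3) * (fps_const (ri P ^ 3) * (fps_const (ri P ^ 3) * (Th ^ 3 * Mt)))"
    unfolding V_def power3_eq_cube by (simp only: mult_ac)
  then have VM: "(V * (V * (V * Mt))) $ k = 0" if "k > 0" for k
    unfolding W using that by simp
  have odd: "\<forall>k. odd k \<longrightarrow> V $ k = 0" by (simp add: V_def Th_odd)
  have cancel: "numeral v * (p * (fps_const (1 / numeral v) * x)) = x * p" for v and p x :: "rat fps"
  proof -
    have "numeral v * (p * (fps_const (1 / numeral v) * x)) = (numeral v * fps_const (1 / numeral v)) * (x * p)"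
      by (simp only: mult_ac)
    then show ?thesis by (simp add: fps_numeral_fps_const)
  qed
  define r1 where "r1 = V $ 2"
  define r2 where "r2 = V $ 4"
  define r3 where "r3 = V $ 6"
  define r4 where "r4 = V $ 8"
  have V0: "V $ 0 = 1"
    using J_P_cube unfolding V_def by (simp add: Th_small mult.commute flip: ri_power ri_mult ri_1)
  have r: "6 * r1 = ri (j 1)" "120 * r2 = ri (j 2)" "5040 * r3 = ri (j 3)" "362880 * r4 = ri (j 4)"
    unfolding r1_def r2_def r3_def r4_def V_def fps_mult_left_const_nth Th_small cancel
    by (simp_all only: j_def ri_mult ri_power)
  note expand = fps_mult_even_nth[OF odd] fps_mult_nth_0 V0 r1_def[symmetric] r2_def[symmetric]
    r3_def[symmetric] r4_def[symmetric] Mt_0'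
  have 2: "Mt $ 2 + 3 * r1 * ri P = 0"
    using VM[of 2, unfolded expand] by (simp add: algebra_simps)
  have 4: "Mt $ 4 + 3 * r1 * Mt $ 2 + (3 * r2 + 3 * r1\<^sup>2) * ri P = 0"
    using VM[of 4, unfolded expand] by (simp add: algebra_simps power2_eq_square)
  have 6: "Mt $ 6 + 3 * r1 * Mt $ 4 + (3 * r2 + 3 * r1\<^sup>2) * Mt $ 2 + (3 * r3 + 6 * r1 * r2 + r1 ^ 3) * ri P = 0"
    using VM[of 6, unfolded expand] by (simp add: algebra_simps power2_eq_square power3_eq_cube)
  have 8: "Mt $ 8 + 3 * r1 * Mt $ 6 + (3 * r2 + 3 * r1\<^sup>2) * Mt $ 4 + (3 * r3 + 6 * r1 * r2 + r1 ^ 3) * Mt $ 2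
      + (3 * r4 + 6 * r1 * r3 + 3 * r2\<^sup>2 + 3 * r1\<^sup>2 * r2) * ri P = 0"
    using VM[of 8, unfolded expand] by (simp add: algebra_simps power2_eq_square power3_eq_cube)
  note sol = solve_cube[OF 2 4 6 8]
  have *: "120 * ((6 * r1\<^sup>2 - 3 * r2) * p) = p * (20 * (6 * r1)\<^sup>2 - 3 * (120 * r2))"
    "15120 * ((- 3 * r3 + 12 * r1 * r2 - 10 * r1 ^ 3) * p) =
      p * (252 * (6 * r1) * (120 * r2) - 9 * (5040 * r3) - 700 * (6 * r1) ^ 3)"
    "604800 * ((- 3 * r4 + 12 * r1 * r3 + 6 * r2\<^sup>2 - 30 * r1\<^sup>2 * r2 + 15 * r1 ^ 4) * p) =
      p * (240 * (6 * r1) * (5040 * r3) - 5 * (362880 * r4) + 252 * (120 * r2)\<^sup>2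
        - 4200 * (6 * r1)\<^sup>2 * (120 * r2) + 7000 * (6 * r1) ^ 4)"
    for r1 r2 r3 r4 p :: "rat fps"
    by algebra+
  show "120 * Mt $ 4 = ri (P * (20 * (j 1)\<^sup>2 - 3 * j 2))"
    "15120 * Mt $ 6 = ri (P * (252 * j 1 * j 2 - 9 * j 3 - 700 * j 1 ^ 3))"
    "604800 * Mt $ 8 = ri (P * (240 * j 1 * j 3 - 5 * j 4 + 252 * (j 2)\<^sup>2 - 4200 * (j 1)\<^sup>2 * j 2 + 7000 * j 1 ^ 4))"
    unfolding sol * r by (simp_all only: ri_add ri_diff ri_mult ri_power ri_numeral)
qed

text \<open>This and the next two lemmas compare \<open>Mt_solved\<close> with the expression of the
  same coefficient of \<open>Mt\<close> through \<open>Gt\<close>, hence through moments; 24n - 1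
  comes from \<open>D\<close>.\<close>

lemma rank_moment_4:
  "(P * (20 * (j 1)\<^sup>2 - 3 * j 2)) $ n = 240 * moment 4 $ n - 120 * moment 2 $ n + 7 * P $ n
     + (24 * int n - 1) * (120 * moment 2 $ n - 10 * P $ n)"
proof -
  have "(120 * Mt $ 4) $ n = of_int (240 * moment 4 $ n - 120 * moment 2 $ n + 7 * P $ n
     + (24 * int n - 1) * (120 * moment 2 $ n - 10 * P $ n))"
    unfolding numeral_mult_nth Mt_even fps_add_nth D_nth Gt_nth fps_sub_nth fps_mult_left_const_nth
      moment_0 ri_nth by (simp add: field_simps)
  then show ?thesis unfolding Mt_solved ri_nth of_int_eq_iff .
qed

lemma rank_moment_6:
  "(P * (252 * j 1 * j 2 - 9 * j 3 - 700 * j 1 ^ 3)) $ n =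
     13440 * moment 6 $ n - 16800 * moment 4 $ n + 5880 * moment 2 $ n - 310 * P $ n
     + (24 * int n - 1) * (5040 * moment 4 $ n - 2520 * moment 2 $ n + 147 * P $ n)"
proof -
  have "(15120 * Mt $ 6) $ n = of_int (13440 * moment 6 $ n - 16800 * moment 4 $ n + 5880 * moment 2 $ n - 310 * P $ n
     + (24 * int n - 1) * (5040 * moment 4 $ n - 2520 * moment 2 $ n + 147 * P $ n))"
    unfolding numeral_mult_nth Mt_even fps_add_nth D_nth Gt_nth fps_sub_nth fps_mult_left_const_nth
      moment_0 ri_nth by (simp add: field_simps)
  then show ?thesis unfolding Mt_solved ri_nth of_int_eq_iff .
qed

lemma rank_moment_8:
  "(P * (240 * j 1 * j 3 - 5 * j 4 + 252 * (j 2)\<^sup>2 - 4200 * (j 1)\<^sup>2 * j 2 + 7000 * j 1 ^ 4)) $ n =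
     80640 * moment 8 $ n - 188160 * moment 6 $ n + 164640 * moment 4 $ n - 52080 * moment 2 $ n + 2667 * P $ n
     + (24 * int n - 1) * (26880 * moment 6 $ n - 33600 * moment 4 $ n + 11760 * moment 2 $ n - 620 * P $ n)"
proof -
  have "(604800 * Mt $ 8) $ n = of_int (80640 * moment 8 $ n - 188160 * moment 6 $ n + 164640 * moment 4 $ n
     - 52080 * moment 2 $ n + 2667 * P $ n
     + (24 * int n - 1) * (26880 * moment 6 $ n - 33600 * moment 4 $ n + 11760 * moment 2 $ n - 620 * P $ n))"
    unfolding numeral_mult_nth Mt_even fps_add_nth D_nth Gt_nth fps_sub_nth fps_mult_left_const_nth
      moment_0 ri_nth by (simp add: field_simps)
  then show ?thesis unfolding Mt_solved ri_nth of_int_eq_iff .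
qed

section \<open>Lacunary series and congruences\<close>

text \<open>Up to a power of \<open>q\<close>, \<open>E i\<close> below is \<open>(24 q d/dq)\<^sup>i\<close> applied to \<open>\<eta>\<close>.\<close>

definition pen :: "int \<Rightarrow> int" where
  "pen k = k * (3 * k + 1) div 2"

lemma two_mult_pen: "2 * pen k = k * (3 * k + 1)"
  by (simp add: pen_def)

lemma abs_le_pen: "\<bar>k\<bar> \<le> pen k"
proof -
  have "0 \<le> k * (3 * k - 1)" "0 \<le> k * (k + 1)"
    by (auto simp: zero_le_mult_iff)
  then have "2 * k \<le> 2 * pen k" "2 * (- k) \<le> 2 * pen k"
    unfolding two_mult_pen by (auto simp: algebra_simps)
  then show ?thesis by simp
qed

lemma pen_step: "pen (k + 1) = pen k + 3 * k + 2" "pen (- (k + 1)) = pen (- k) + 3 * k + 1"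
  using two_mult_pen[of "k + 1"] two_mult_pen[of k] two_mult_pen[of "- (k + 1)"] two_mult_pen[of "- k"]
  by (simp_all add: algebra_simps)

definition E :: "nat \<Rightarrow> int fps" where
  "E i = qseries (\<lambda>k. nat (pen k)) (\<lambda>k. alt k * (6 * k + 1) ^ (2 * i))"

lemma pen_nonneg: "0 \<le> pen k"
  using abs_le_pen[of k] by simp

lemma finite_pen_le: "finite {k. nat (pen k) \<le> n}"
proof (rule finite_subset)
  show "{k. nat (pen k) \<le> n} \<subseteq> {- int n..int n}"
  proof
    fix k assume "k \<in> {k. nat (pen k) \<le> n}"
    then show "k \<in> {- int n..int n}" using abs_le_pen[of k] by auto
  qed
qed simp

lemma E_nth: "E i $ n = (\<Sum>k | pen k = int n. alt k * (6 * k + 1) ^ (2 * i))"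
proof -
  have "{k. nat (pen k) = n} = {k. pen k = int n}" using pen_nonneg by auto
  then show ?thesis by (simp add: E_def qseries_nth)
qed

lemma pen_eq_iff: "pen k = n \<longleftrightarrow> (6 * k + 1)\<^sup>2 = 24 * n + 1"
proof -
  have "(6 * k + 1)\<^sup>2 = 12 * (k * (3 * k + 1)) + 1"
    by (simp add: power2_eq_square algebra_simps)
  then show ?thesis unfolding two_mult_pen[symmetric] by simp
qed

lemma E_Suc_nth: "E (Suc i) $ n = (24 * int n + 1) * E i $ n"
  unfolding E_nth sum_distrib_left
proof (rule sum.cong[OF refl])
  fix k assume "k \<in> {k. pen k = int n}"
  then have "24 * int n + 1 = (6 * k + 1)\<^sup>2" by (simp add: pen_eq_iff)
  then show "alt k * (6 * k + 1) ^ (2 * Suc i) = (24 * int n + 1) * (alt k * (6 * k + 1) ^ (2 * i))"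
    by (simp only: power2_eq_square) (simp add: mult_ac)
qed

lemma E_nonzero: "E i $ n \<noteq> 0 \<Longrightarrow> \<exists>w. w\<^sup>2 = 24 * int n + 1"
proof -
  assume "E i $ n \<noteq> 0"
  then have "{k. pen k = int n} \<noteq> {}" unfolding E_nth by (metis sum.empty)
  then show ?thesis using pen_eq_iff by blast
qed

text \<open>Dyson's recurrence is iterated from rank bound -1 downwards in steps of 3; each step
  peels off one pentagonal number.\<close>

lemma rank_le_minus_one_down:
  "rank_le_num (-1) n = (\<Sum>k<K. (- 1) ^ k * part_num (n - pen (int k + 1)))
     + (- 1) ^ K * rank_le_num (-1 - 3 * int K) (n - pen (int K))"
proof (induction K)
  case 0
  show ?case by (simp add: pen_def)
next
  case (Suc K)
  have "n - pen (int K) = (n - pen (int K + 1)) - (-1 - 3 * int K) + 1"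
    by (simp add: pen_step)
  then have "rank_le_num (-1 - 3 * int K) (n - pen (int K)) + rank_le_num (-1 - 3 * int K - 3) (n - pen (int K + 1))
      = part_num (n - pen (int K + 1))"
    by (simp only:) (rule dyson_recurrence; simp)
  then have h: "rank_le_num (-1 - 3 * int K) (n - pen (int K))
      = part_num (n - pen (int K + 1)) - rank_le_num (-1 - 3 * int (Suc K)) (n - pen (int (Suc K)))"
    by (simp add: algebra_simps)
  show ?case unfolding Suc.IH h by (simp add: algebra_simps)
qed

text \<open>The same iteration upwards. The term at \<open>n = 0\<close> corrects the exceptional
  point \<open>m = 2\<close>, \<open>n = 0\<close> of the recurrence, met in the first step.\<close>

lemma rank_le_minus_one_up:
  "rank_le_num (-1) n + (if n = 0 then 1 else 0) = (\<Sum>k<Suc K. (- 1) ^ k * part_num (n - pen (- int k)))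
     + (- 1) ^ Suc K * rank_le_num (3 * int K + 2) (n - pen (- int (Suc K)))"
proof (induction K)
  case 0
  have "rank_le_num 2 (n - 1) + rank_le_num (-1) n + (if n = 0 then 1 else 0) = part_num n"
    using dyson_recurrence[of 2 n] by (cases "n = 0") (simp_all add: part_num_0 rank_le_num_0)
  moreover have "pen 0 = 0" "pen (-1) = 1" by (simp_all add: pen_def)
  ultimately show ?case by simp
next
  case (Suc K)
  have "n - pen (- int (Suc (Suc K))) = (n - pen (- int (Suc K))) - (3 * int K + 5) + 1"
    using pen_step(2)[of "int (Suc K)"] by simp
  then have "rank_le_num (3 * int K + 5) (n - pen (- int (Suc (Suc K))))
      + rank_le_num (3 * int K + 5 - 3) (n - pen (- int (Suc K))) = part_num (n - pen (- int (Suc K)))"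
    by (simp only:) (rule dyson_recurrence; simp)
  then have h: "rank_le_num (3 * int K + 2) (n - pen (- int (Suc K)))
      = part_num (n - pen (- int (Suc K))) - rank_le_num (3 * int (Suc K) + 2) (n - pen (- int (Suc (Suc K))))"
    by (simp add: algebra_simps)
  show ?case unfolding Suc.IH h sum.lessThan_Suc[of _ "Suc K"] by (simp add: algebra_simps)
qed

text \<open>Euler's pentagonal number theorem: the two expansions of the number of partitions of
  negative rank agree.\<close>

lemma E_P: "E 0 * P = 1"
proof (rule fps_ext)
  fix n
  let ?p = "\<lambda>k. part_num (int n - pen k)"
  have big: "int n - pen k < 0" if "\<bar>k\<bar> > int n" for k
    using abs_le_pen[of k] that by simp
  have "(E 0 * P) $ n = (\<Sum>k | nat (pen k) \<le> n. alt k * P $ (n - nat (pen k)))"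
    unfolding E_def by (subst qseries_mult_nth) (simp_all add: finite_pen_le)
  also have "\<dots> = (\<Sum>k | nat (pen k) \<le> n. alt k * ?p k)"
    using pen_nonneg by (intro sum.cong refl) (simp add: P_nth of_nat_diff)
  also have "\<dots> = (\<Sum>k\<in>{- int n..int n + 1}. alt k * ?p k)"
  proof (rule sum.mono_neutral_left)
    show "{k. nat (pen k) \<le> n} \<subseteq> {- int n..int n + 1}"
    proof
      fix k assume "k \<in> {k. nat (pen k) \<le> n}"
      then show "k \<in> {- int n..int n + 1}" using abs_le_pen[of k] by auto
    qed
    show "\<forall>k\<in>{- int n..int n + 1} - {k. nat (pen k) \<le> n}. alt k * ?p k = 0"
      by auto
  qed simp
  also have "\<dots> = (\<Sum>k\<le>n. (- 1) ^ k * ?p (- int k) - (- 1) ^ k * ?p (int k + 1))"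
    unfolding sum_symmetric_interval alt_add_one alt_uminus alt_of_nat by simp
  also have "\<dots> = (\<Sum>k<Suc n. (- 1) ^ k * ?p (- int k)) - (\<Sum>k<Suc n. (- 1) ^ k * ?p (int k + 1))"
    by (simp add: sum_subtractf lessThan_Suc_atMost)
  \<comment> \<open>After \<open>Suc n\<close> steps the arguments of both remainders are negative,
    so both expansions terminate.\<close>
  also have "\<dots> = (if n = 0 then 1 else 0)"
    using rank_le_minus_one_down[of "int n" "Suc n"] rank_le_minus_one_up[of "int n" n]
      big[of "int (Suc n)"] big[of "- int (Suc n)"] by simp
  finally show "(E 0 * P) $ n = 1 $ n" by simp
qed

lemma J_eq_E_cube: "J 0 = E 0 ^ 3"
proof -
  have "J 0 = (J 0 * P ^ 3) * E 0 ^ 3"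
    using E_P by (simp add: mult.assoc mult.commute flip: power_mult_distrib)
  then show ?thesis by (simp add: J_P_cube)
qed

text \<open>At most one \<open>k\<close> has a given triangular number, so a single base
  \<open>v\<close> serves all \<open>i\<close> at once; this makes \<open>J i\<close> comparable
  with \<open>J 0\<close>.\<close>

lemma J_shape: "\<exists>s v. (\<forall>i. J i $ n = s * v ^ (2 * i + 1)) \<and> (s \<noteq> 0 \<longrightarrow> v\<^sup>2 = 8 * int n + 1)"
proof (cases "\<exists>k. trin k = n")
  case False
  then show ?thesis by (intro exI[of _ 0]) (simp add: J_nth)
next
  case True
  then obtain k where k: "trin k = n" by blast
  have uniq: "k' = k" if "trin k' = n" for k'
  proof -
    have "(2 * int k' + 1)\<^sup>2 = (2 * int k + 1)\<^sup>2" using that k by (simp only: trin_eq_iff)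
    then have "2 * int k' + 1 = 2 * int k + 1" by (rule power2_eq_imp_eq) simp_all
    then show ?thesis by simp
  qed
  have "{k'. trin k' = n} = {k}" using k uniq by blast
  then have "J i $ n = (- 1) ^ k * (2 * int k + 1) ^ (2 * i + 1)" for i
    unfolding J_nth by simp
  moreover have "(2 * int k + 1)\<^sup>2 = 8 * int n + 1" using k by (simp only: trin_eq_iff)
  ultimately show ?thesis by blast
qed

section \<open>Powers and quadratic forms modulo a prime\<close>

lemma freshmans_dream_dvd:
  fixes x y :: "'a::comm_ring_1"
  assumes "prime p"
  shows "of_nat p dvd (x + y) ^ p - (x ^ p + y ^ p)"
proof -
  have p: "p > 1" using assms prime_gt_1_nat by blast
  let ?f = "\<lambda>k. of_nat (p choose k) * x ^ k * y ^ (p - k)"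
  have "{..p} = insert 0 (insert p {0<..<p})" using p by auto
  then have "(x + y) ^ p = y ^ p + (x ^ p + (\<Sum>k\<in>{0<..<p}. ?f k))"
    unfolding binomial_ring using p by simp
  then have "(x + y) ^ p - (x ^ p + y ^ p) = (\<Sum>k\<in>{0<..<p}. ?f k)" by simp
  also have "of_nat p dvd \<dots>"
  proof (rule dvd_sum)
    fix k assume "k \<in> {0<..<p}"
    then have "p dvd p choose k" using assms by (intro dvd_choose_prime) auto
    then obtain c where "p choose k = p * c" by (rule dvdE)
    then show "of_nat p dvd ?f k" by (simp add: mult.assoc)
  qed
  finally show ?thesis .
qed

lemma fermat_int: "prime p \<Longrightarrow> int p dvd x ^ p - x"
proof -
  assume p: "prime p"
  then have p0: "p > 0" using prime_gt_0_nat by blast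
  have step: "int p dvd ((x + 1) ^ p - (x + 1)) - (x ^ p - x)" for x
    using freshmans_dream_dvd[OF p, of x 1] by (simp add: algebra_simps)
  show ?thesis
  proof (induction x rule: int_induct[of _ 0])
    case base
    then show ?case using p0 by (simp add: zero_power)
  next
    case (step1 i)
    then show ?case using step[of i] by (metis dvd_add_right_iff diff_add_cancel add.commute)
  next
    case (step2 i)
    have "i - 1 + 1 = i" by simp
    then show ?case using step[of "i - 1"] step2 by (metis dvd_diff_right_iff)
  qed
qed

text \<open>That is, f(q)^p = f(q^p) modulo p. Splitting f = f(0) + q g reduces the claim for f at n
  to the claim for g at n - p.\<close>

lemma frobenius_nth:
  fixes f :: "int fps"
  assumes p: "prime p"
  shows "int p dvd (f ^ p) $ n - (if p dvd n then f $ (n div p) else 0)"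
proof (induction n arbitrary: f rule: less_induct)
  case (less n)
  have p0: "p > 0" using p prime_gt_0_nat by blast
  define g where "g = fps_shift 1 f"
  have f: "f = fps_const (f $ 0) + fps_X * g"
  proof (rule fps_ext)
    fix n show "f $ n = (fps_const (f $ 0) + fps_X * g) $ n"
      by (cases n) (simp_all add: g_def)
  qed
  obtain h where "f ^ p - (fps_const (f $ 0) ^ p + (fps_X * g) ^ p) = of_nat p * h"
    using freshmans_dream_dvd[OF p, of "fps_const (f $ 0)" "fps_X * g"] unfolding f[symmetric] by (rule dvdE)
  then have "f ^ p = fps_const ((f $ 0) ^ p) + fps_X ^ p * g ^ p + fps_const (int p) * h"
    by (simp add: power_mult_distrib algebra_simps fps_of_nat)
  then have n: "(f ^ p) $ n = (if n = 0 then (f $ 0) ^ p else 0) + (if n < p then 0 else (g ^ p) $ (n - p)) + int p * h $ n"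
    by (simp add: fps_X_power_mult_nth)
  show ?case
  proof (cases "n < p")
    case True
    show ?thesis
    proof (cases "n = 0")
      case True
      then have eq: "(f ^ p) $ n - (if p dvd n then f $ (n div p) else 0) = ((f $ 0) ^ p - f $ 0) + int p * h $ n"
        unfolding n using p0 by simp
      show ?thesis unfolding eq by (intro dvd_add fermat_int p dvd_triv_left)
    next
      case False
      then show ?thesis unfolding n using True p0 by (auto dest: dvd_imp_le)
    qed
  next
    case False
    have "p dvd n \<longleftrightarrow> p dvd n - p" using False by (simp add: dvd_minus_self)
    moreover have "f $ (n div p) = g $ ((n - p) div p)" if "p dvd n"
      using False p0 by (simp add: g_def le_div_geq)
    ultimately have eq: "(f ^ p) $ n - (if p dvd n then f $ (n div p) else 0)
        = ((g ^ p) $ (n - p) - (if p dvd n - p then g $ ((n - p) div p) else 0)) + int p * h $ n"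
      unfolding n using False p0 by simp
    have "int p dvd (g ^ p) $ (n - p) - (if p dvd n - p then g $ ((n - p) div p) else 0)"
      using False p0 by (intro less.IH) auto
    then show ?thesis unfolding eq by (intro dvd_add dvd_triv_left)
  qed
qed

lemma frobenius_mult_dvd:
  fixes f F :: "int fps"
  assumes p: "prime p" and *: "\<And>l. p * l \<le> n \<Longrightarrow> int p dvd f $ l * F $ (n - p * l)"
  shows "int p dvd (f ^ p * F) $ n"
  unfolding fps_mult_nth
proof (rule dvd_sum)
  fix i assume i: "i \<in> {0..n}"
  let ?c = "if p dvd i then f $ (i div p) else 0"
  have "(f ^ p) $ i * F $ (n - i) = ((f ^ p) $ i - ?c) * F $ (n - i) + ?c * F $ (n - i)"
    by (simp add: algebra_simps)
  moreover have "int p dvd ((f ^ p) $ i - ?c) * F $ (n - i)"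
    using frobenius_nth[OF p, of f i] by (rule dvd_mult2)
  moreover have "int p dvd ?c * F $ (n - i)"
    using *[of "i div p"] i by auto
  ultimately show "int p dvd (f ^ p) $ i * F $ (n - i)" by simp
qed

lemma square_mod_5: "(w::int)\<^sup>2 mod 5 = 0 \<and> 5 dvd w \<or> w\<^sup>2 mod 5 = 1 \<or> w\<^sup>2 mod 5 = 4"
proof -
  have "w\<^sup>2 mod 5 = (w mod 5)\<^sup>2 mod 5" by (simp add: power_mod)
  moreover have "w mod 5 = 0 \<or> w mod 5 = 1 \<or> w mod 5 = 2 \<or> w mod 5 = 3 \<or> w mod 5 = 4"
    by presburger
  ultimately show ?thesis by (elim disjE) (simp_all add: dvd_eq_mod_eq_0)
qed

lemma square_mod_7:
  "(w::int)\<^sup>2 mod 7 = 0 \<and> 7 dvd w \<or> w\<^sup>2 mod 7 = 1 \<or> w\<^sup>2 mod 7 = 2 \<or> w\<^sup>2 mod 7 = 4"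
proof -
  have "w\<^sup>2 mod 7 = (w mod 7)\<^sup>2 mod 7" by (simp add: power_mod)
  moreover have "w mod 7 = 0 \<or> w mod 7 = 1 \<or> w mod 7 = 2 \<or> w mod 7 = 3 \<or> w mod 7 = 4
      \<or> w mod 7 = 5 \<or> w mod 7 = 6"
    by presburger
  ultimately show ?thesis by (elim disjE) (simp_all add: dvd_eq_mod_eq_0)
qed

text \<open>The form is anisotropic since -3 is not a square modulo 5; likewise -1 modulo 7 in the
  next lemma.\<close>

lemma sum_squares_mod_5:
  fixes w v :: int
  assumes "5 dvd w\<^sup>2 + 3 * v\<^sup>2"
  shows "5 dvd w" "5 dvd v"
proof -
  have "[w\<^sup>2 + 3 * v\<^sup>2 = w\<^sup>2 mod 5 + 3 * (v\<^sup>2 mod 5)] (mod 5)"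
    by (intro cong_add cong_mult cong_refl) (simp_all add: cong_def)
  then have *: "(w\<^sup>2 mod 5 + 3 * (v\<^sup>2 mod 5)) mod 5 = 0"
    using assms unfolding cong_def dvd_eq_mod_eq_0 by (rule trans[OF sym])
  have "5 dvd w \<and> 5 dvd v"
    using square_mod_5[of w] square_mod_5[of v]
  proof (elim disjE conjE)
  qed (use * in \<open>simp_all only:\<close>, simp_all)
  then show "5 dvd w" "5 dvd v" by auto
qed

lemma sum_squares_mod_7:
  fixes w v :: int
  assumes "7 dvd w\<^sup>2 + v\<^sup>2"
  shows "7 dvd w" "7 dvd v"
proof -
  have "[w\<^sup>2 + v\<^sup>2 = w\<^sup>2 mod 7 + v\<^sup>2 mod 7] (mod 7)"
    by (intro cong_add) (simp_all add: cong_def)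
  then have *: "(w\<^sup>2 mod 7 + v\<^sup>2 mod 7) mod 7 = 0"
    using assms unfolding cong_def dvd_eq_mod_eq_0 by (rule trans[OF sym])
  have "7 dvd w \<and> 7 dvd v"
    using square_mod_7[of w] square_mod_7[of v]
  proof (elim disjE conjE)
  qed (use * in \<open>simp_all only:\<close>, simp_all)
  then show "7 dvd w" "7 dvd v" by auto
qed

section \<open>Vanishing of the moments modulo 5 and 7\<close>

definition qdiff :: "int fps \<Rightarrow> int fps" where
  "qdiff f = fps_X * fps_deriv f"

lemma qdiff_nth: "qdiff f $ n = int n * f $ n"
  unfolding qdiff_def X_deriv_nth by simp

lemma qdiff_add: "qdiff (f + g) = qdiff f + qdiff g"
  and qdiff_diff: "qdiff (f - g) = qdiff f - qdiff g"
  and qdiff_mult: "qdiff (f * g) = qdiff f * g + f * qdiff g"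
  and qdiff_1: "qdiff 1 = 0"
  and qdiff_numeral: "qdiff (numeral v) = 0"
  and qdiff_X: "qdiff fps_X = fps_X"
  by (simp_all add: qdiff_def algebra_simps)

lemma qdiff_power: "qdiff (f ^ Suc n) = of_nat (Suc n) * f ^ n * qdiff f"
  by (induction n) (simp_all add: qdiff_mult algebra_simps)

lemma qdiff_power2: "qdiff (f\<^sup>2) = 2 * f * qdiff f"
  using qdiff_power[of f 1] by (simp add: numeral_2_eq_2)

lemma qdiff_power3: "qdiff (f ^ 3) = 3 * f\<^sup>2 * qdiff f"
  using qdiff_power[of f 2] by simp

lemma qdiff_P: "24 * qdiff P = P - j 1 * P"
proof -
  have "P ^ 3 * (J 0 * (24 * qdiff P - P) + J 1 * P) = 0"
    using J_P_deriv by (simp only: qdiff_def mult_zero_right)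
  then have "(J 0 * P ^ 3) * (24 * qdiff P - P) + j 1 * P = 0"
    unfolding j_def by (simp add: algebra_simps)
  then show ?thesis unfolding J_P_cube by (simp add: algebra_simps eq_neg_iff_add_eq_0)
qed

text \<open>The logarithmic derivative of \<open>P\<close> turns q d/dq on \<open>J i\<close> into a
  rule that stays within polynomials in the \<open>j i\<close>.\<close>

lemma qdiff_j: "8 * qdiff (j i) = j (Suc i) - j 1 * j i"
proof -
  have "8 * qdiff (j i) = 8 * qdiff (J i) * P ^ 3 + J i * P\<^sup>2 * (24 * qdiff P)"
    unfolding j_def qdiff_mult qdiff_power3 by (simp add: algebra_simps)
  also have "8 * qdiff (J i) = J (Suc i) - J i"
    by (simp add: J_Suc qdiff_def)
  also have "(J (Suc i) - J i) * P ^ 3 + J i * P\<^sup>2 * (24 * qdiff P) = j (Suc i) - j 1 * j i"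
    unfolding qdiff_P j_def by (simp add: power2_eq_square power3_eq_cube algebra_simps)
  finally show ?thesis .
qed

lemma qdiff_j': "24 * qdiff (j i) = 3 * (j (Suc i) - j 1 * j i)"
  unfolding qdiff_j[symmetric] by simp

text \<open>When \<open>24 n - 1\<close> vanishes modulo a prime power, every \<open>f\<close> yields a relation between coefficients.\<close>

lemma weighted_coeff: "(24 * int n - 1) * (P * f) $ n = (P * (24 * qdiff f - j 1 * f)) $ n"
proof -
  have "24 * qdiff (P * f) - P * f = P * (24 * qdiff f) + f * (24 * qdiff P) - P * f"
    unfolding qdiff_mult by (simp add: algebra_simps)
  also have "\<dots> = P * (24 * qdiff f - j 1 * f)"
    unfolding qdiff_P by (simp add: algebra_simps)
  finally have "(24 * qdiff (P * f) - P * f) $ n = (P * (24 * qdiff f - j 1 * f)) $ n"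
    by (rule arg_cong)
  then show ?thesis
    unfolding fps_sub_nth numeral_mult_nth qdiff_nth by (simp add: algebra_simps)
qed

lemma P_mult_numeral: "(P * (numeral v * f)) $ n = numeral v * (P * f) $ n"
  by (simp only: mult.left_commute[of P] numeral_mult_nth)

lemmas P_mult_simps = right_diff_distrib distrib_left fps_sub_nth fps_add_nth mult.assoc P_mult_numeral

text \<open>These are the instances of \<open>weighted_coeff\<close> at 1, \<open>j 1\<close>,
  \<open>(j 1)\<^sup>2\<close>, \<open>j 2\<close>, \<open>j 3\<close>, \<open>j 1 ^ 3\<close> and
  \<open>j 1 * j 2\<close>.\<close>

lemma P_coeff_relations:
  defines "c \<equiv> \<lambda>n. 24 * int n - 1"
  shows "(P * j 1) $ n = - c n * P $ n"
    "3 * (P * j 2) $ n - 4 * (P * (j 1)\<^sup>2) $ n = c n * (P * j 1) $ n"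
    "6 * (P * (j 1 * j 2)) $ n - 7 * (P * j 1 ^ 3) $ n = c n * (P * (j 1)\<^sup>2) $ n"
    "3 * (P * j 3) $ n - 4 * (P * (j 1 * j 2)) $ n = c n * (P * j 2) $ n"
    "3 * (P * j 4) $ n - 4 * (P * (j 1 * j 3)) $ n = c n * (P * j 3) $ n"
    "9 * (P * ((j 1)\<^sup>2 * j 2)) $ n - 10 * (P * j 1 ^ 4) $ n = c n * (P * j 1 ^ 3) $ n"
    "3 * (P * (j 1 * j 3)) $ n + 3 * (P * (j 2)\<^sup>2) $ n - 7 * (P * ((j 1)\<^sup>2 * j 2)) $ n
       = c n * (P * (j 1 * j 2)) $ n"
proof -
  have d: "24 * qdiff (j 1) = 3 * (j 2 - j 1 * j 1)" "24 * qdiff (j 2) = 3 * (j 3 - j 1 * j 2)"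
    "24 * qdiff (j 3) = 3 * (j 4 - j 1 * j 3)"
    using qdiff_j'[of 1] qdiff_j'[of 2] qdiff_j'[of 3] by (simp_all add: eval_nat_numeral)
  show "(P * j 1) $ n = - c n * P $ n"
    using weighted_coeff[of n 1] by (simp add: c_def qdiff_1 algebra_simps)
  have "24 * qdiff (j 1) - j 1 * j 1 = 3 * j 2 - 4 * (j 1)\<^sup>2"
    unfolding d by (simp add: power2_eq_square algebra_simps)
  then show "3 * (P * j 2) $ n - 4 * (P * (j 1)\<^sup>2) $ n = c n * (P * j 1) $ n"
    unfolding c_def weighted_coeff by (simp only: P_mult_simps)
  have "24 * qdiff ((j 1)\<^sup>2) - j 1 * (j 1)\<^sup>2 = 2 * j 1 * (24 * qdiff (j 1)) - j 1 * (j 1)\<^sup>2"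
    by (simp add: qdiff_power2)
  also have "\<dots> = 6 * (j 1 * j 2) - 7 * j 1 ^ 3"
    unfolding d by (simp add: power2_eq_square power3_eq_cube algebra_simps)
  finally show "6 * (P * (j 1 * j 2)) $ n - 7 * (P * j 1 ^ 3) $ n = c n * (P * (j 1)\<^sup>2) $ n"
    unfolding c_def weighted_coeff by (simp only: P_mult_simps)
  have "24 * qdiff (j 2) - j 1 * j 2 = 3 * j 3 - 4 * (j 1 * j 2)"
    unfolding d by (simp add: algebra_simps)
  then show "3 * (P * j 3) $ n - 4 * (P * (j 1 * j 2)) $ n = c n * (P * j 2) $ n"
    unfolding c_def weighted_coeff by (simp only: P_mult_simps)
  have "24 * qdiff (j 3) - j 1 * j 3 = 3 * j 4 - 4 * (j 1 * j 3)"
    unfolding d by (simp add: algebra_simps)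
  then show "3 * (P * j 4) $ n - 4 * (P * (j 1 * j 3)) $ n = c n * (P * j 3) $ n"
    unfolding c_def weighted_coeff by (simp only: P_mult_simps)
  have "24 * qdiff (j 1 ^ 3) - j 1 * j 1 ^ 3 = 3 * (j 1)\<^sup>2 * (24 * qdiff (j 1)) - j 1 * j 1 ^ 3"
    by (simp add: qdiff_power3)
  also have "\<dots> = 9 * ((j 1)\<^sup>2 * j 2) - 10 * j 1 ^ 4"
    unfolding d by (simp add: eval_nat_numeral algebra_simps)
  finally show "9 * (P * ((j 1)\<^sup>2 * j 2)) $ n - 10 * (P * j 1 ^ 4) $ n = c n * (P * j 1 ^ 3) $ n"
    unfolding c_def weighted_coeff by (simp only: P_mult_simps)
  have "24 * qdiff (j 1 * j 2) - j 1 * (j 1 * j 2) =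
      (24 * qdiff (j 1)) * j 2 + j 1 * (24 * qdiff (j 2)) - j 1 * (j 1 * j 2)"
    by (simp add: qdiff_mult algebra_simps)
  also have "\<dots> = 3 * (j 1 * j 3) + 3 * (j 2)\<^sup>2 - 7 * ((j 1)\<^sup>2 * j 2)"
    unfolding d by (simp add: power2_eq_square algebra_simps)
  finally show "3 * (P * (j 1 * j 3)) $ n + 3 * (P * (j 2)\<^sup>2) $ n - 7 * (P * ((j 1)\<^sup>2 * j 2)) $ n
       = c n * (P * (j 1 * j 2)) $ n"
    unfolding c_def weighted_coeff by (simp only: P_mult_simps)
qed

text \<open>The second property hands the support on to the quotient, so that lacunarity survives
  division.\<close>

lemma fps_dvd_coeffs:
  fixes f :: "int fps"
  assumes "\<And>n. c dvd f $ n"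
  obtains g where "f = fps_const c * g" "\<And>n. f $ n = 0 \<Longrightarrow> g $ n = 0"
proof
  show "f = fps_const c * Abs_fps (\<lambda>n. f $ n div c)"
    by (rule fps_ext) (simp add: assms)
  show "Abs_fps (\<lambda>n. f $ n div c) $ n = 0" if "f $ n = 0" for n
    using that by simp
qed

lemma J_nonzero: "J i $ n \<noteq> 0 \<Longrightarrow> \<exists>v. v\<^sup>2 = 8 * int n + 1"
  using J_shape[of n] by auto

text \<open>With p = 2i + 1, the coefficients differ by \<open>s\<close> times v^p - v, which
  Fermat's theorem makes divisible by p.\<close>

lemma J_mod_prime:
  assumes p: "prime (2 * i + 1)"
  obtains Y where "J i = J 0 + fps_const (int (2 * i + 1)) * Y"
    "\<And>n. Y $ n \<noteq> 0 \<Longrightarrow> \<exists>v. v\<^sup>2 = 8 * int n + 1"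
proof -
  have "int (2 * i + 1) dvd (J i - J 0) $ n" for n
  proof -
    obtain s v where sv: "\<forall>i. J i $ n = s * v ^ (2 * i + 1)" using J_shape by blast
    have "(J i - J 0) $ n = s * (v ^ (2 * i + 1) - v)"
      using sv by (simp add: right_diff_distrib)
    moreover have "int (2 * i + 1) dvd v ^ (2 * i + 1) - v" by (rule fermat_int[OF p])
    ultimately show ?thesis by simp
  qed
  then obtain Y where Y: "J i - J 0 = fps_const (int (2 * i + 1)) * Y"
    "\<And>n. (J i - J 0) $ n = 0 \<Longrightarrow> Y $ n = 0"
    by (rule fps_dvd_coeffs) blast
  show ?thesis
  proof
    show "J i = J 0 + fps_const (int (2 * i + 1)) * Y"
      using Y(1) by (simp add: algebra_simps)
    show "\<exists>v. v\<^sup>2 = 8 * int n + 1" if "Y $ n \<noteq> 0" for n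
      using that Y(2)[of n] J_nonzero[of i n] J_nonzero[of 0 n] by fastforce
  qed
qed

text \<open>\<open>E 0\<close> and \<open>J 0\<close> are the inverses of \<open>P\<close> and
  \<open>P ^ 3\<close>, and 5 - 1 - 3 = 1. For 7 below, 7 - 3 - 3 = 1. The shape
  \<open>F * P ^ 3\<close> is that of \<open>j i\<close>.\<close>

lemma P_factor_5: "P * (F * P ^ 3) = P ^ 5 * (E 0 * F)" "P = P ^ 5 * (E 0 * J 0)"
proof -
  have *: "P * (F * P ^ 3) = P ^ 5 * (E 0 * F)" for F
  proof -
    have "P ^ 5 * (E 0 * F) = (E 0 * P) * (P * (F * P ^ 3))"
      by (simp add: eval_nat_numeral algebra_simps)
    then show ?thesis unfolding E_P mult_1 by (rule sym)
  qed
  then show "P * (F * P ^ 3) = P ^ 5 * (E 0 * F)" .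
  show "P = P ^ 5 * (E 0 * J 0)" unfolding *[symmetric] J_P_cube by simp
qed

lemma P_factor_7: "P * (F * P ^ 3) = P ^ 7 * (J 0 * F)" "P = P ^ 7 * (J 0 * J 0)"
proof -
  have *: "P * (F * P ^ 3) = P ^ 7 * (J 0 * F)" for F
  proof -
    have "P ^ 7 * (J 0 * F) = (J 0 * P ^ 3) * (P * (F * P ^ 3))"
      by (simp add: eval_nat_numeral algebra_simps)
    then show ?thesis unfolding J_P_cube mult_1 by (rule sym)
  qed
  then show "P * (F * P ^ 3) = P ^ 7 * (J 0 * F)" .
  show "P = P ^ 7 * (J 0 * J 0)" unfolding *[symmetric] J_P_cube by simp
qed

lemma mult_nth_nonzero:
  fixes f g :: "int fps"
  assumes "(f * g) $ m \<noteq> 0"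
  shows "\<exists>i l. i + l = m \<and> f $ i \<noteq> 0 \<and> g $ l \<noteq> 0"
proof -
  have "\<exists>i\<in>{0..m}. f $ i * g $ (m - i) \<noteq> 0"
    using assms unfolding fps_mult_nth by (meson sum.neutral)
  then show ?thesis by (metis atLeastAtMost_iff le_add_diff_inverse mult_eq_0_iff)
qed

lemma mult_nth_dvd:
  fixes f g :: "int fps"
  assumes "\<And>i l. i + l = m \<Longrightarrow> c dvd f $ i * g $ l"
  shows "c dvd (f * g) $ m"
  unfolding fps_mult_nth by (intro dvd_sum) (simp add: assms)

lemma J_0_dvd:
  assumes "\<And>u. u\<^sup>2 = 8 * int i + 1 \<Longrightarrow> c dvd u"
  shows "c dvd J 0 $ i"
proof -
  obtain s u where su: "\<forall>k. J k $ i = s * u ^ (2 * k + 1)" "s \<noteq> 0 \<longrightarrow> u\<^sup>2 = 8 * int i + 1"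
    using J_shape by blast
  then have "J 0 $ i = s * u" by simp
  then show ?thesis using su(2) assms[of u] by (cases "s = 0") simp_all
qed

text \<open>Ramanujan's congruence. The form w^2 + 3 v^2 = 24m + 4 is divisible by 5, hence so is v,
  and v is a factor of the coefficient of \<open>J 0\<close>.\<close>

lemma partitions_mod_5:
  assumes "n mod 5 = 4"
  shows "5 dvd P $ n"
proof -
  have "int 5 dvd (P ^ 5 * (E 0 * J 0)) $ n"
  proof (rule frobenius_mult_dvd)
    fix l assume l: "5 * l \<le> n"
    let ?m = "n - 5 * l"
    have "int n = 5 * int (n div 5) + 4" using assms by presburger
    moreover have "int ?m = int n - 5 * int l" using l by (simp add: of_nat_diff)
    ultimately have m: "int ?m = 5 * (int (n div 5) - int l) + 4" by simp
    have "int 5 dvd (E 0 * J 0) $ ?m"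
    proof (rule mult_nth_dvd)
      fix i k assume ik: "i + k = ?m"
      show "int 5 dvd E 0 $ i * J 0 $ k"
      proof (cases "E 0 $ i = 0")
        case False
        then obtain w where w: "w\<^sup>2 = 24 * int i + 1" using E_nonzero by blast
        have "int 5 dvd J 0 $ k"
        proof (rule J_0_dvd)
          fix v assume v: "v\<^sup>2 = 8 * int k + 1"
          have "int i + int k = int ?m" using ik by linarith
          then have "w\<^sup>2 + 3 * v\<^sup>2 = 24 * int ?m + 4" unfolding w v by simp
          then have "w\<^sup>2 + 3 * v\<^sup>2 = 5 * (24 * (int (n div 5) - int l) + 20)" unfolding m by simp
          then have "5 dvd w\<^sup>2 + 3 * v\<^sup>2" by (rule dvdI)
          then have "5 dvd v" by (rule sum_squares_mod_5(2))
          then show "int 5 dvd v" by simp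
        qed
        then show ?thesis by simp
      qed simp
    qed
    then show "int 5 dvd P $ l * (E 0 * J 0) $ ?m" by simp
  qed simp
  then show ?thesis unfolding P_factor_5(2)[symmetric] by simp
qed

text \<open>For general lacunary \<open>F\<close> no factor v is available. Instead a nonzero
  coefficient makes 24m + 4 divisible by 25, which forces \<open>l\<close> to be 4 modulo 5, and
  \<open>P $ l\<close> supplies the factor 5.\<close>

lemma E_mult_mod_5:
  assumes F: "\<And>n. F $ n \<noteq> 0 \<Longrightarrow> \<exists>v. v\<^sup>2 = 8 * int n + 1" and n: "n mod 25 = 24"
  shows "5 dvd (P ^ 5 * (E 0 * F)) $ n"
proof -
  have "int 5 dvd (P ^ 5 * (E 0 * F)) $ n"
  proof (rule frobenius_mult_dvd)
    fix l assume l: "5 * l \<le> n"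
    let ?m = "n - 5 * l"
    have "int n = 25 * int (n div 25) + 24" using n by presburger
    moreover have "int ?m = int n - 5 * int l" using l by (simp add: of_nat_diff)
    ultimately have m: "int ?m = 25 * int (n div 25) + 24 - 5 * int l" by simp
    show "int 5 dvd P $ l * (E 0 * F) $ ?m"
    proof (cases "(E 0 * F) $ ?m = 0")
      case False
      then obtain i k where ik: "i + k = ?m" "E 0 $ i \<noteq> 0" "F $ k \<noteq> 0"
        using mult_nth_nonzero by blast
      obtain w v where wv: "w\<^sup>2 = 24 * int i + 1" "v\<^sup>2 = 8 * int k + 1"
        using E_nonzero[OF ik(2)] F[OF ik(3)] by blast
      have "int i + int k = int ?m" using ik(1) by linarith
      then have eq: "w\<^sup>2 + 3 * v\<^sup>2 = 24 * int ?m + 4" unfolding wv by simp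
      have "24 * int ?m + 4 = 5 * (120 * int (n div 25) + 116 - 24 * int l)" unfolding m by simp
      then have "5 dvd w\<^sup>2 + 3 * v\<^sup>2" unfolding eq by (rule dvdI)
      then have "5 dvd w" "5 dvd v" by (rule sum_squares_mod_5)+
      then obtain w' v' where "w = 5 * w'" "v = 5 * v'" by (auto elim!: dvdE)
      then have "24 * int ?m + 4 = 25 * (w'\<^sup>2 + 3 * v'\<^sup>2)"
        using eq by (simp add: power_mult_distrib)
      then have "120 * int (n div 25) + 116 - 24 * int l = 5 * (w'\<^sup>2 + 3 * v'\<^sup>2)" unfolding m by simp
      then have "int l + 1 = 5 * (w'\<^sup>2 + 3 * v'\<^sup>2 - 24 * int (n div 25) - 23 + 5 * int l)" by simp
      then have "5 dvd int l + 1" by (rule dvdI)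
      then have "l mod 5 = 4" by presburger
      then show ?thesis using partitions_mod_5 by simp
    qed simp
  qed simp
  then show ?thesis by simp
qed

text \<open>Here u^2 + v^2 = 8m + 2 is divisible by 7, and the root u is a factor of the coefficient
  of \<open>J 0\<close>.\<close>

lemma J_mult_mod_7:
  assumes F: "\<And>n. F $ n \<noteq> 0 \<Longrightarrow> \<exists>v. v\<^sup>2 = 8 * int n + 1" and n: "n mod 7 = 5"
  shows "7 dvd (P ^ 7 * (J 0 * F)) $ n"
proof -
  have "int 7 dvd (P ^ 7 * (J 0 * F)) $ n"
  proof (rule frobenius_mult_dvd)
    fix l assume l: "7 * l \<le> n"
    let ?m = "n - 7 * l"
    have "int n = 7 * int (n div 7) + 5" using n by presburger
    moreover have "int ?m = int n - 7 * int l" using l by (simp add: of_nat_diff)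
    ultimately have m: "int ?m = 7 * (int (n div 7) - int l) + 5" by simp
    have "int 7 dvd (J 0 * F) $ ?m"
    proof (rule mult_nth_dvd)
      fix i k assume ik: "i + k = ?m"
      show "int 7 dvd J 0 $ i * F $ k"
      proof (cases "F $ k = 0")
        case False
        then obtain v where v: "v\<^sup>2 = 8 * int k + 1" using F by blast
        have "int 7 dvd J 0 $ i"
        proof (rule J_0_dvd)
          fix u assume u: "u\<^sup>2 = 8 * int i + 1"
          have "int i + int k = int ?m" using ik by linarith
          then have "u\<^sup>2 + v\<^sup>2 = 8 * int ?m + 2" unfolding u v by simp
          then have "u\<^sup>2 + v\<^sup>2 = 7 * (8 * (int (n div 7) - int l) + 6)" unfolding m by simp
          then have "7 dvd u\<^sup>2 + v\<^sup>2" by (rule dvdI)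
          then have "7 dvd u" by (rule sum_squares_mod_7(1))
          then show "int 7 dvd u" by simp
        qed
        then show ?thesis by simp
      qed simp
    qed
    then show "int 7 dvd P $ l * (J 0 * F) $ ?m" by simp
  qed simp
  then show ?thesis by simp
qed

lemma moment_mod:
  "5 dvd moment 6 $ n - moment 2 $ n" "7 dvd moment 8 $ n - moment 2 $ n"
proof -
  have 5: "(5::int) dvd m ^ 6 - m ^ 2" for m :: int
  proof -
    have "m ^ 6 - m ^ 2 = m * (m ^ 5 - m)" by (simp add: eval_nat_numeral algebra_simps)
    then show ?thesis using fermat_int[of 5 m] by simp
  qed
  have 7: "(7::int) dvd m ^ 8 - m ^ 2" for m :: int
  proof -
    have "m ^ 8 - m ^ 2 = m * (m ^ 7 - m)" by (simp add: eval_nat_numeral algebra_simps)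
    then show ?thesis using fermat_int[of 7 m] by simp
  qed
  show "5 dvd moment 6 $ n - moment 2 $ n"
    by (simp add: moment_def sum_subtractf[symmetric] left_diff_distrib[symmetric] 5 dvd_sum)
  show "7 dvd moment 8 $ n - moment 2 $ n"
    by (simp add: moment_def sum_subtractf[symmetric] left_diff_distrib[symmetric] 7 dvd_sum)
qed

text \<open>Modulo 25 the terms with 24n - 1 drop out. As the sixth moment is congruent to the
  second modulo 5, \<open>rank_moment_6\<close> determines the second, and
  \<open>rank_moment_4\<close> then the fourth.\<close>

lemma moments_mod_5:
  assumes n: "n mod 25 = 24"
  shows "5 dvd moment 2 $ n" "5 dvd moment 4 $ n"
proof -
  obtain Y where Y: "J 2 = J 0 + 5 * Y" "\<And>n. Y $ n \<noteq> 0 \<Longrightarrow> \<exists>v. v\<^sup>2 = 8 * int n + 1"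
    by (rule J_mod_prime[of 2]) (auto simp: fps_numeral_fps_const)
  define y where "y = Y * P ^ 3"
  have j2: "j 2 = 1 + 5 * y"
    unfolding j_def Y(1) y_def using J_P_cube by (simp add: algebra_simps)
  have "5 dvd (P * y) $ n"
    unfolding y_def P_factor_5(1) by (rule E_mult_mod_5[OF Y(2) n])
  then obtain y0 where y0: "(P * y) $ n = 5 * y0" by (rule dvdE)
  have "n mod 5 = 4" using n by presburger
  then obtain x0 where x0: "P $ n = 5 * x0" using partitions_mod_5 by (auto elim: dvdE)
  define c where "c = 24 * int (n div 25) + 23"
  have "int n = 25 * int (n div 25) + 24" using n by presburger
  then have c: "24 * int n - 1 = 25 * c" unfolding c_def by simp
  define X A1 A2 A3 AJ2 AY J2 J3 N2 N4 N6 where defs: "X = P $ n" "A1 = (P * j 1) $ n" "A2 = (P * (j 1)\<^sup>2) $ n"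
    "A3 = (P * j 1 ^ 3) $ n" "AJ2 = (P * (j 1 * j 2)) $ n" "AY = (P * (j 1 * y)) $ n"
    "J2 = (P * j 2) $ n" "J3 = (P * j 3) $ n"
    "N2 = moment 2 $ n" "N4 = moment 4 $ n" "N6 = moment 6 $ n"
  note rel = P_coeff_relations[of n, unfolded c, folded defs]
  note m4 = rank_moment_4[of n, unfolded c P_mult_simps, folded defs]
  note m6 = rank_moment_6[of n, unfolded c P_mult_simps, folded defs]
  have J2: "J2 = X + 25 * y0"
    unfolding defs j2 by (simp add: P_mult_simps y0)
  have "j 1 * j 2 = j 1 + 5 * (j 1 * y)" unfolding j2 by (simp add: algebra_simps)
  then have AJ2: "AJ2 = A1 + 5 * AY"
    unfolding defs by (simp only: P_mult_simps)
  have X: "X = 5 * x0" unfolding defs by (rule x0)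
  obtain k where "N6 - N2 = 5 * k"
    using moment_mod(1)[of n] unfolding defs by (rule dvdE)
  then have k: "N6 = N2 + 5 * k" by simp
  \<comment> \<open>All other terms are multiples of 25, while 19320 = 13440 + 5880 is 5 times 3864,
    a unit modulo 5.\<close>
  have "19320 * N2 = 25 * (- 2688 * k - 1200 * c * x0 + 48 * AY - 3 * c * J2 - 28 * A3
      + 672 * N4 + 62 * x0 - c * (5040 * N4 - 2520 * N2 + 735 * x0))"
    using m6 rel(1,4) k X AJ2 by algebra
  then obtain z where "19320 * N2 = 25 * z" by blast
  then have "N2 = 5 * (773 * N2 - z)" by simp
  then obtain w where w: "N2 = 5 * w" by blast
  have "240 * N4 - 120 * N2 = 25 * (x0 + 12 * y0 + 625 * c * c * x0 - c * (120 * N2 - 50 * x0))"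
    using m4 rel(1,2) X J2 by algebra
  then obtain z' where "240 * N4 - 120 * N2 = 25 * z'" by blast
  then have "48 * N4 = 5 * z' + 120 * w" unfolding w by simp
  then have "N4 = 5 * (2 * z' + 48 * w - 19 * N4)" by simp
  then have "5 dvd N4" by (rule dvdI)
  moreover have "5 dvd N2" unfolding w by simp
  ultimately show "5 dvd moment 2 $ n" "5 dvd moment 4 $ n"
    unfolding defs by simp_all
qed


text \<open>Gauss's lemma for power series: look at the product of the first coefficients not
  divisible by \<open>p\<close>.\<close>

lemma fps_prime_dvd_mult:
  fixes f g :: "int fps"
  assumes "prime p" "fps_const p dvd f * g"
  shows "fps_const p dvd f \<or> fps_const p dvd g"
proof (rule ccontr)
  assume neg: "\<not> ?thesis"
  have ex: "\<exists>n. \<not> p dvd h $ n" if "\<not> fps_const p dvd h" for h :: "int fps"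
  proof (rule ccontr)
    assume "\<nexists>n. \<not> p dvd h $ n"
    then have "\<And>n. p dvd h $ n" by blast
    then obtain g where "h = fps_const p * g" by (rule fps_dvd_coeffs) blast
    then show False using that by simp
  qed
  define a where "a = (LEAST n. \<not> p dvd f $ n)"
  define b where "b = (LEAST n. \<not> p dvd g $ n)"
  have a: "\<not> p dvd f $ a" "\<And>i. i < a \<Longrightarrow> p dvd f $ i"
    using ex[of f] neg LeastI_ex[of "\<lambda>n. \<not> p dvd f $ n"] not_less_Least[of _ "\<lambda>n. \<not> p dvd f $ n"]
    unfolding a_def by blast+
  have b: "\<not> p dvd g $ b" "\<And>i. i < b \<Longrightarrow> p dvd g $ i"
    using ex[of g] neg LeastI_ex[of "\<lambda>n. \<not> p dvd g $ n"] not_less_Least[of _ "\<lambda>n. \<not> p dvd g $ n"]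
    unfolding b_def by blast+
  have "(f * g) $ (a + b) = f $ a * g $ b + (\<Sum>i\<in>{0..a + b} - {a}. f $ i * g $ (a + b - i))"
    unfolding fps_mult_nth by (subst sum.remove[of _ a]) auto
  moreover have "p dvd (\<Sum>i\<in>{0..a + b} - {a}. f $ i * g $ (a + b - i))"
  proof (rule dvd_sum)
    fix i assume i: "i \<in> {0..a + b} - {a}"
    show "p dvd f $ i * g $ (a + b - i)"
    proof (cases "i < a")
      case True
      then show ?thesis using a(2) by simp
    next
      case False
      then have "a + b - i < b" using i by auto
      then show ?thesis using b(2) by simp
    qed
  qed
  moreover have "p dvd (f * g) $ (a + b)"
    using assms(2) by (auto elim!: dvdE)
  ultimately have "p dvd f $ a * g $ b" by (simp add: dvd_add_left_iff)
  then show False using assms(1) a(1) b(1) by (simp add: prime_dvd_mult_iff)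
qed

section \<open>The Euler function and the discriminant modulo 7\<close>

lemma E_Suc: "E (Suc i) = 24 * qdiff (E i) + E i"
proof (rule fps_ext)
  fix n
  show "E (Suc i) $ n = (24 * qdiff (E i) + E i) $ n"
    unfolding fps_add_nth numeral_mult_nth qdiff_nth E_Suc_nth by (simp add: algebra_simps)
qed

text \<open>From \<open>E 0 * P = 1\<close>, the operator 24 q d/dq takes \<open>E 0\<close> to
  \<open>(j 1 - 1) * E 0\<close>; so each \<open>E i\<close> is \<open>E 0\<close> times a
  polynomial in the \<open>j i\<close>.\<close>

lemma E_step: "E i = c * E 0 \<Longrightarrow> E (Suc i) = (24 * qdiff c + c * j 1) * E 0"
proof -
  have "(E 0 * P) * (24 * qdiff (E 0)) + (E 0 * E 0) * (24 * qdiff P) = E 0 * (24 * qdiff (E 0 * P))"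
    unfolding qdiff_mult by (simp add: algebra_simps)
  moreover have "(E 0 * E 0) * (P - j 1 * P) = (E 0 * P) * (E 0 - j 1 * E 0)"
    by (simp add: algebra_simps)
  ultimately have "24 * qdiff (E 0) + (E 0 - j 1 * E 0) = 0"
    unfolding qdiff_P E_P qdiff_1 by simp
  then have q: "24 * qdiff (E 0) = - (E 0 - j 1 * E 0)"
    by (simp only: eq_neg_iff_add_eq_0)
  assume i: "E i = c * E 0"
  have "E (Suc i) = 24 * qdiff c * E 0 + c * (24 * qdiff (E 0)) + c * E 0"
    unfolding E_Suc i qdiff_mult by (simp add: algebra_simps)
  then show ?thesis unfolding q by (simp add: algebra_simps)
qed

lemma E_3: "E 3 = (9 * j 3 - 18 * j 1 * j 2 + 10 * j 1 ^ 3) * E 0"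
proof -
  have d: "24 * qdiff (j 1) = 3 * (j 2 - j 1 * j 1)" "24 * qdiff (j 2) = 3 * (j 3 - j 1 * j 2)"
    using qdiff_j'[of 1] qdiff_j'[of 2] by (simp_all add: eval_nat_numeral)
  have 1: "E 1 = j 1 * E 0"
    using E_step[of 0 1] by (simp add: qdiff_1)
  have "24 * qdiff (j 1) + j 1 * j 1 = 3 * j 2 - 2 * (j 1)\<^sup>2"
    unfolding d by (simp add: power2_eq_square algebra_simps)
  then have 2: "E 2 = (3 * j 2 - 2 * (j 1)\<^sup>2) * E 0"
    using E_step[OF 1] by (simp add: numeral_2_eq_2)
  have "24 * qdiff (3 * j 2 - 2 * (j 1)\<^sup>2) = 3 * (24 * qdiff (j 2)) - 4 * j 1 * (24 * qdiff (j 1))"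
    by (simp add: qdiff_diff qdiff_mult qdiff_numeral qdiff_power2 algebra_simps)
  then have "24 * qdiff (3 * j 2 - 2 * (j 1)\<^sup>2) + (3 * j 2 - 2 * (j 1)\<^sup>2) * j 1
      = 9 * j 3 - 18 * j 1 * j 2 + 10 * j 1 ^ 3"
    unfolding d by (simp add: power2_eq_square power3_eq_cube algebra_simps)
  then show ?thesis using E_step[OF 2] by (simp add: numeral_3_eq_3 numeral_2_eq_2)
qed

lemma E_power_49: "7 dvd (E 0 ^ 49) $ n - (if 49 dvd n then E 0 $ (n div 49) else 0)"
proof -
  have e: "E 0 ^ 49 = (E 0 ^ 7) ^ 7" by (simp flip: power_mult)
  have 1: "7 dvd ((E 0 ^ 7) ^ 7) $ n - (if 7 dvd n then (E 0 ^ 7) $ (n div 7) else 0)"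
    using frobenius_nth[of 7 "E 0 ^ 7" n] by simp
  have 2: "7 dvd (E 0 ^ 7) $ (n div 7) - (if 7 dvd n div 7 then E 0 $ (n div 7 div 7) else 0)"
    using frobenius_nth[of 7 "E 0" "n div 7"] by simp
  show ?thesis
  proof (cases "7 dvd n")
    case True
    have "49 dvd n \<longleftrightarrow> 7 dvd n div 7" "n div 49 = n div 7 div 7"
      using True by (auto simp: div_mult2_eq[symmetric] elim!: dvdE)
    then show ?thesis using True dvd_add[OF 1 2] unfolding e by (cases "7 dvd n div 7") simp_all
  next
    case False
    then have "\<not> 49 dvd n" using dvd_trans[of 7 49 n] by auto
    then show ?thesis using 1 False unfolding e by simp
  qed
qed

text \<open>The numbers 7k + 1 are those with 6(7k + 1) + 1 = 7(6k + 1), that is, the indices whose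
  root is divisible by 7.\<close>

lemma pen_seven: "pen (7 * k + 1) = 49 * pen k + 2"
  using two_mult_pen[of "7 * k + 1"] two_mult_pen[of k] by (simp add: algebra_simps)

lemma alt_seven: "alt (7 * k + 1) = - alt k"
  by (simp add: alt_def)

text \<open>By Fermat (6k+1)^6 is 1 modulo 7 unless 7 divides 6k + 1. The terms of the latter kind
  in \<open>E 0\<close> form -q^2 E(q^49) with E = \<open>E 0\<close>, and E(q^49) is E(q)^49 modulo
  7.\<close>

lemma E_3_mod_7:
  obtains h where "E 3 = E 0 + fps_X\<^sup>2 * E 0 ^ 49 + 7 * h"
proof -
  have "7 dvd (E 3 - E 0 - fps_X\<^sup>2 * E 0 ^ 49) $ n" for n
  proof -
    let ?S = "{k. pen k = int n}" and ?T = "{k. pen k = int n \<and> 7 dvd 6 * k + 1}"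
    have fin: "finite ?S"
      by (rule finite_subset[OF _ finite_pen_le[of n]]) auto
    \<comment> \<open>\<open>X\<close> and \<open>X'\<close> are the coefficients of q^2 times the
      49th power of \<open>E 0\<close> and of q^2 times \<open>E 0\<close> at q^49.\<close>
    define X where "X = (if n < 2 then 0 else (E 0 ^ 49) $ (n - 2))"
    define X' where "X' = (if n \<ge> 2 \<and> 49 dvd n - 2 then E 0 $ ((n - 2) div 49) else 0)"
    have "E 3 $ n - E 0 $ n = (\<Sum>k\<in>?S. alt k * ((6 * k + 1) ^ 6 - 1))"
      unfolding E_nth by (simp add: sum_subtractf[symmetric] right_diff_distrib)
    also have "\<dots> = (\<Sum>k\<in>?S. alt k * ((6 * k + 1) ^ 6 - (if 7 dvd 6 * k + 1 then 0 else 1))) - (\<Sum>k\<in>?S. if 7 dvd 6 * k + 1 then alt k else 0)"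
      unfolding sum_subtractf[symmetric] by (intro sum.cong refl) (simp add: algebra_simps)
    also have "(\<Sum>k\<in>?S. if 7 dvd 6 * k + 1 then alt k else 0) = (\<Sum>k\<in>?T. alt k)"
      using fin by (simp add: sum.inter_filter[symmetric])
    also have "(\<Sum>k\<in>?T. alt k) = - X'"
    proof (cases "n \<ge> 2 \<and> 49 dvd n - 2")
      case True
      then obtain m where "n - 2 = 49 * m" by (auto elim: dvdE)
      then have m: "n = 49 * m + 2" using True by simp
      have "?T = (\<lambda>k. 7 * k + 1) ` {k. pen k = int m}"
      proof (intro equalityI subsetI)
        fix k assume k: "k \<in> ?T"
        then have "7 dvd 6 * k + 1" by simp
        then have "k = 7 * (k div 7) + 1" by presburger
        moreover from this have "pen (7 * (k div 7) + 1) = int n" using k by simp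
        then have "pen (k div 7) = int m" unfolding pen_seven m by simp
        ultimately show "k \<in> (\<lambda>k. 7 * k + 1) ` {k. pen k = int m}" by blast
      next
        fix k assume "k \<in> (\<lambda>k. 7 * k + 1) ` {k. pen k = int m}"
        then obtain k' where k': "k = 7 * k' + 1" "pen k' = int m" by blast
        have "6 * k + 1 = 7 * (6 * k' + 1)" unfolding k' by simp
        then show "k \<in> ?T" unfolding k'(1) using k'(2) by (simp add: pen_seven m)
      qed
      then have "(\<Sum>k\<in>?T. alt k) = (\<Sum>k | pen k = int m. alt (7 * k + 1))"
        by (simp only:) (subst sum.reindex, auto simp: inj_on_def)
      also have "\<dots> = - X'"
        using True by (simp add: alt_seven sum_negf X'_def E_nth m)
      finally show ?thesis .
    next
      case False
      have "?T = {}"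
      proof (rule ccontr)
        assume "?T \<noteq> {}"
        then obtain k where k: "pen k = int n" "7 dvd 6 * k + 1" by blast
        then have "k = 7 * (k div 7) + 1" by presburger
        then have "int n = 49 * pen (k div 7) + 2" using k(1) pen_seven[of "k div 7"] by simp
        then have "n = 49 * nat (pen (k div 7)) + 2" using pen_nonneg[of "k div 7"] by linarith
        then show False using False by simp
      qed
      then have "(\<Sum>k\<in>?T. alt k) = 0" by (simp only: sum.empty)
      then show ?thesis using False by (auto simp: X'_def)
    qed
    finally have "(E 3 - E 0 - fps_X\<^sup>2 * E 0 ^ 49) $ n =
        (\<Sum>k\<in>?S. alt k * ((6 * k + 1) ^ 6 - (if 7 dvd 6 * k + 1 then 0 else 1))) - (X - X')"
      by (simp add: fps_X_power_mult_nth X_def)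
    moreover have "7 dvd (\<Sum>k\<in>?S. alt k * ((6 * k + 1) ^ 6 - (if 7 dvd 6 * k + 1 then 0 else 1)))"
    proof (intro dvd_sum dvd_mult)
      fix k :: int
      show "7 dvd (6 * k + 1) ^ 6 - (if 7 dvd 6 * k + 1 then 0 else 1)"
      proof (cases "7 dvd 6 * k + 1")
        case True
        then show ?thesis using dvd_trans[OF True dvd_power[of 6 "6 * k + 1"]] by simp
      next
        case False
        have "(6 * k + 1) * ((6 * k + 1) ^ 6 - 1) = (6 * k + 1) ^ 7 - (6 * k + 1)"
          by (simp add: right_diff_distrib eval_nat_numeral)
        then have "7 dvd (6 * k + 1) * ((6 * k + 1) ^ 6 - 1)"
          using fermat_int[of 7 "6 * k + 1"] by simp
        then show ?thesis using False by (simp add: prime_dvd_mult_iff)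
      qed
    qed
    moreover have "7 dvd X - X'"
      unfolding X_def X'_def using E_power_49[of "n - 2"] by (cases "n < 2") simp_all
    ultimately show ?thesis by (simp only: dvd_diff)
  qed
  then obtain h where "E 3 - E 0 - fps_X\<^sup>2 * E 0 ^ 49 = fps_const 7 * h"
    by (rule fps_dvd_coeffs) blast
  then show ?thesis
    by (intro that[of h]) (simp add: fps_numeral_fps_const algebra_simps)
qed

definition Delta :: "int fps" where
  "Delta = fps_X * E 0 ^ 24"

lemma qdiff_Delta: "qdiff Delta = j 1 * Delta"
proof -
  have "24 * qdiff (E 0) + E 0 = j 1 * E 0"
    using E_step[of 0 1] E_Suc[of 0] by (simp add: qdiff_1)
  then have q: "24 * qdiff (E 0) = j 1 * E 0 - E 0" by (simp only: eq_diff_eq)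
  have "qdiff Delta = Delta + fps_X * E 0 ^ 23 * (24 * qdiff (E 0))"
    using qdiff_power[of "E 0" 23] unfolding Delta_def qdiff_mult qdiff_X by (simp add: algebra_simps)
  also have "\<dots> = fps_X * (E 0 ^ 23 * E 0) + fps_X * E 0 ^ 23 * (j 1 * E 0 - E 0)"
    unfolding q Delta_def by (simp flip: power_Suc2)
  also have "\<dots> = j 1 * (fps_X * (E 0 ^ 23 * E 0))" by (simp add: algebra_simps)
  finally show ?thesis unfolding Delta_def by (simp flip: power_Suc2)
qed

text \<open>Since 24 - 1 = 21 + 2, the product is q times the 7th power of \<open>J 0\<close> times
  \<open>E 0\<close> squared. A nonzero coefficient of the latter makes w^2 + v^2 = 24m + 2
  divisible by 49, hence 8l + 1 divisible by 7, and then \<open>J 0 $ l\<close> as well.\<close>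

lemma P_Delta_mod_7:
  assumes n: "n mod 49 = 47"
  shows "7 dvd (P * Delta) $ n"
proof -
  have "P * Delta = fps_X * ((E 0 * P) * (E 0 ^ 3) ^ 7 * (E 0 * E 0))"
    unfolding Delta_def by (simp add: eval_nat_numeral algebra_simps)
  then have "P * Delta = fps_X * (J 0 ^ 7 * (E 0 * E 0))"
    unfolding E_P J_eq_E_cube by simp
  moreover have "n \<noteq> 0" using n by auto
  ultimately have eq: "(P * Delta) $ n = (J 0 ^ 7 * (E 0 * E 0)) $ (n - 1)" by simp
  have "int 7 dvd (J 0 ^ 7 * (E 0 * E 0)) $ (n - 1)"
  proof (rule frobenius_mult_dvd)
    fix l assume l: "7 * l \<le> n - 1"
    let ?m = "n - 1 - 7 * l"
    have "int n = 49 * int (n div 49) + 47" using n by presburger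
    moreover have "int ?m = int n - 1 - 7 * int l" using l \<open>n \<noteq> 0\<close> by (simp add: of_nat_diff)
    ultimately have m: "int ?m = 49 * int (n div 49) + 46 - 7 * int l" by simp
    show "int 7 dvd J 0 $ l * (E 0 * E 0) $ ?m"
    proof (cases "(E 0 * E 0) $ ?m = 0")
      case False
      then obtain i k where ik: "i + k = ?m" "E 0 $ i \<noteq> 0" "E 0 $ k \<noteq> 0"
        using mult_nth_nonzero by blast
      obtain w v where wv: "w\<^sup>2 = 24 * int i + 1" "v\<^sup>2 = 24 * int k + 1"
        using E_nonzero[OF ik(2)] E_nonzero[OF ik(3)] by blast
      have "int i + int k = int ?m" using ik(1) by linarith
      then have eq: "w\<^sup>2 + v\<^sup>2 = 24 * int ?m + 2" unfolding wv by simp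
      have "24 * int ?m + 2 = 7 * (168 * int (n div 49) + 158 - 24 * int l)" unfolding m by simp
      then have "7 dvd w\<^sup>2 + v\<^sup>2" unfolding eq by (rule dvdI)
      then have "7 dvd w" "7 dvd v" by (rule sum_squares_mod_7)+
      then obtain w' v' where "w = 7 * w'" "v = 7 * v'" by (auto elim!: dvdE)
      then have "24 * int ?m + 2 = 49 * (w'\<^sup>2 + v'\<^sup>2)"
        using eq by (simp add: power_mult_distrib)
      then have "168 * int (n div 49) + 158 - 24 * int l = 7 * (w'\<^sup>2 + v'\<^sup>2)" unfolding m by simp
      then have l1: "8 * int l + 1 = 7 * (2 * (w'\<^sup>2 + v'\<^sup>2) - 48 * int (n div 49) + 8 * int l - 45)"
        by simp
      have "int 7 dvd J 0 $ l"
      proof (rule J_0_dvd)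
        fix u assume u: "u\<^sup>2 = 8 * int l + 1"
        have "7 dvd u\<^sup>2" unfolding u using l1 by (rule dvdI)
        then show "int 7 dvd u" by (simp add: prime_dvd_power_iff)
      qed
      then show ?thesis by simp
    qed simp
  qed simp
  then show ?thesis unfolding eq by simp
qed

text \<open>With a = \<open>j 1\<close> and d = \<open>Delta\<close>: the discriminant squared
  modulo 7 in terms of \<open>j 1\<close> and \<open>j 2\<close>; k collects the multiples of
  7.\<close>

lemma discriminant_algebra_1:
  fixes a :: "'a::idom"
  assumes e3: "9 * j3 - 18 * a * j2 + 10 * a ^ 3 = 1 + d\<^sup>2 + 7 * h" and j3: "j3 = 1 + 7 * y"
    and k: "k = 1 + 9 * y - 2 * a * j2 + a ^ 3 - h"
  shows "d\<^sup>2 = 1 - 4 * a * j2 + 3 * a ^ 3 + 7 * k"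
proof -
  have "d\<^sup>2 = 9 * j3 - 18 * a * j2 + 10 * a ^ 3 - 1 - 7 * h" unfolding e3 by simp
  then show ?thesis unfolding j3 k by algebra
qed

text \<open>The hypothesis on \<open>16 * a * d\<^sup>2\<close> is the q-derivative of the first
  one. It yields that b^2 is a modulo 7, and with this the first hypothesis becomes (1 - ab)^2 = d^2
  modulo 7.\<close>

lemma discriminant_algebra_2:
  fixes a :: "'a::idom"
  assumes d: "d\<^sup>2 = 1 - 4 * a * j2 + 3 * a ^ 3 + 7 * k" and j3: "j3 = 1 + 7 * y" and b: "b = 2 * j2 - a\<^sup>2"
    and diff: "16 * a * d\<^sup>2 = 9 * a\<^sup>2 * (j2 - a\<^sup>2) - 4 * ((j2 - a\<^sup>2) * j2 + a * (j3 - a * j2)) + 7 * m"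
    and k2: "k2 = m + 11 * a\<^sup>2 * j2 - 8 * a ^ 4 - 3 * a - 4 * a * y - 16 * a * k"
  shows "b\<^sup>2 = a + 7 * k2"
    "(1 - a * b - d) * (1 - a * b + d) = 7 * (a\<^sup>2 * k2 - k)"
proof -
  have "7 * m = 16 * a * d\<^sup>2 - (9 * a\<^sup>2 * (j2 - a\<^sup>2) - 4 * ((j2 - a\<^sup>2) * j2 + a * (j3 - a * j2)))"
    unfolding diff by simp
  then have m: "7 * m = 16 * a * (1 - 4 * a * j2 + 3 * a ^ 3 + 7 * k)
      - (9 * a\<^sup>2 * (j2 - a\<^sup>2) - 4 * ((j2 - a\<^sup>2) * j2 + a * (1 + 7 * y - a * j2)))"
    unfolding d j3 .
  have "a + 7 * k2 = a + 7 * m + 7 * (11 * a\<^sup>2 * j2 - 8 * a ^ 4 - 3 * a - 4 * a * y - 16 * a * k)"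
    unfolding k2 by algebra
  also have "\<dots> = (2 * j2 - a\<^sup>2)\<^sup>2" unfolding m by algebra
  finally show b2: "b\<^sup>2 = a + 7 * k2" unfolding b by (rule sym)
  have "(1 - a * b - d) * (1 - a * b + d) = 1 - 2 * a * b + a\<^sup>2 * b\<^sup>2 - d\<^sup>2" by algebra
  also have "\<dots> = 7 * (a\<^sup>2 * k2 - k)" unfolding d b2 unfolding b by algebra
  finally show "(1 - a * b - d) * (1 - a * b + d) = 7 * (a\<^sup>2 * k2 - k)" .
qed

text \<open>Modulo 7, with \<open>E\<^sub>2 = j 1\<close> and \<open>E\<^sub>4 = 2 j 2 - (j 1)\<^sup>2\<close>: the congruences
  \<open>E\<^sub>4\<^sup>2 = E\<^sub>2\<close> and \<open>1 - E\<^sub>2 E\<^sub>4 = \<plusminus>\<Delta>\<close>.\<close>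

lemma eisenstein_mod_7:
  obtains k2 k3 s where "(2 * j 2 - (j 1)\<^sup>2)\<^sup>2 = j 1 + 7 * k2"
    "j 1 * (2 * j 2 - (j 1)\<^sup>2) = 1 - s * Delta + 7 * k3" "s = 1 \<or> s = -1"
proof -
  obtain h where h: "E 3 = E 0 + fps_X\<^sup>2 * E 0 ^ 49 + 7 * h" by (rule E_3_mod_7)
  obtain Y where Y: "J 3 = J 0 + fps_const (int (2 * 3 + 1)) * Y"
    by (rule J_mod_prime[of 3]) auto
  define y where "y = Y * P ^ 3"
  have j3: "j 3 = 1 + 7 * y"
    unfolding j_def Y y_def using J_P_cube by (simp add: distrib_right mult.assoc fps_numeral_fps_const)
  \<comment> \<open>Multiplying by \<open>P\<close> cancels \<open>E 0\<close> and leaves q^2 times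
    its 48th power, which is \<open>Delta\<close> squared.\<close>
  have "(9 * j 3 - 18 * j 1 * j 2 + 10 * j 1 ^ 3) * (E 0 * P) = (E 0 * P) + fps_X\<^sup>2 * E 0 ^ 48 * (E 0 * P) + 7 * (h * P)"
    using arg_cong[OF h[unfolded E_3], of "\<lambda>x. x * P"] by (simp add: algebra_simps eval_nat_numeral)
  moreover have "Delta\<^sup>2 = fps_X\<^sup>2 * E 0 ^ 48"
    unfolding Delta_def by (simp add: power_mult_distrib flip: power_mult)
  ultimately have e3: "9 * j 3 - 18 * j 1 * j 2 + 10 * j 1 ^ 3 = 1 + Delta\<^sup>2 + 7 * (h * P)"
    unfolding E_P by simp
  define k where "k = 1 + 9 * y - 2 * j 1 * j 2 + j 1 ^ 3 - h * P"
  note d = discriminant_algebra_1[OF e3 j3 k_def]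
  then have "8 * qdiff (Delta\<^sup>2) = 8 * qdiff (1 - 4 * j 1 * j 2 + 3 * j 1 ^ 3 + 7 * k)" by simp
  also have "\<dots> = 9 * (j 1)\<^sup>2 * (8 * qdiff (j 1)) - 4 * ((8 * qdiff (j 1)) * j 2 + j 1 * (8 * qdiff (j 2)))
      + 7 * (8 * qdiff k)"
    by (simp add: qdiff_add qdiff_diff qdiff_mult qdiff_1 qdiff_numeral qdiff_power3 algebra_simps)
  also have "8 * qdiff (Delta\<^sup>2) = 16 * j 1 * Delta\<^sup>2"
    unfolding qdiff_power2 qdiff_Delta by (simp add: power2_eq_square)
  also have "8 * qdiff (j 1) = j 2 - (j 1)\<^sup>2"
    using qdiff_j[of 1] by (simp add: power2_eq_square numeral_2_eq_2)
  also have "8 * qdiff (j 2) = j 3 - j 1 * j 2"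
    using qdiff_j[of 2] by (simp add: numeral_3_eq_3 numeral_2_eq_2)
  finally have diff: "16 * j 1 * Delta\<^sup>2 = 9 * (j 1)\<^sup>2 * (j 2 - (j 1)\<^sup>2)
      - 4 * ((j 2 - (j 1)\<^sup>2) * j 2 + j 1 * (j 3 - j 1 * j 2)) + 7 * (8 * qdiff k)" .
  note res = discriminant_algebra_2[OF d j3 refl diff refl]
  have c7: "fps_const 7 = (7 :: int fps)" by (simp add: fps_numeral_fps_const)
  \<comment> \<open>Gauss's lemma selects one of the two factors; the choice becomes the sign
    \<open>s\<close>.\<close>
  have "fps_const 7 dvd (1 - j 1 * (2 * j 2 - (j 1)\<^sup>2) - Delta) * (1 - j 1 * (2 * j 2 - (j 1)\<^sup>2) + Delta)"
    unfolding c7 res(2) by simp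
  then have "fps_const 7 dvd 1 - j 1 * (2 * j 2 - (j 1)\<^sup>2) - Delta \<or>
      fps_const 7 dvd 1 - j 1 * (2 * j 2 - (j 1)\<^sup>2) + Delta"
    by (intro fps_prime_dvd_mult) simp_all
  then show ?thesis
  proof (elim disjE dvdE)
    fix q assume "1 - j 1 * (2 * j 2 - (j 1)\<^sup>2) - Delta = fps_const 7 * q"
    then have "j 1 * (2 * j 2 - (j 1)\<^sup>2) = 1 - 1 * Delta + 7 * (- q)"
      unfolding c7 by (simp add: algebra_simps)
    then show ?thesis using that res(1) by blast
  next
    fix q assume "1 - j 1 * (2 * j 2 - (j 1)\<^sup>2) + Delta = fps_const 7 * q"
    then have "j 1 * (2 * j 2 - (j 1)\<^sup>2) = 1 - (- 1) * Delta + 7 * (- q)"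
      unfolding c7 by (simp add: algebra_simps)
    then show ?thesis using that res(1) by blast
  qed
qed

text \<open>Modulo 49 the terms with 24n - 1 drop out. As the eighth moment is congruent to the
  second modulo 7, \<open>rank_moment_8\<close> determines the second; the fourth and sixth follow
  in this order.\<close>

lemma moments_mod_7:
  assumes n: "n mod 49 = 47"
  shows "7 dvd moment 2 $ n" "7 dvd moment 4 $ n" "7 dvd moment 6 $ n"
proof -
  have "n mod 49 mod 7 = n mod 7" by (rule mod_mod_cancel) simp
  then have n7: "n mod 7 = 5" unfolding n by simp
  obtain Y where "J 3 = J 0 + fps_const (int (2 * 3 + 1)) * Y"
    and Ys: "\<And>n. Y $ n \<noteq> 0 \<Longrightarrow> \<exists>v. v\<^sup>2 = 8 * int n + 1"
    by (rule J_mod_prime[of 3]) auto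
  then have Y: "J 3 = J 0 + 7 * Y" by (simp add: fps_numeral_fps_const)
  define y where "y = Y * P ^ 3"
  have j3: "j 3 = 1 + 7 * y"
    unfolding j_def Y y_def using J_P_cube by (simp add: distrib_right mult.assoc)
  obtain k2 k3 s where b2: "(2 * j 2 - (j 1)\<^sup>2)\<^sup>2 = j 1 + 7 * k2"
    and ab: "j 1 * (2 * j 2 - (j 1)\<^sup>2) = 1 - s * Delta + 7 * k3" and s: "s = 1 \<or> s = -1"
    by (rule eisenstein_mod_7)
  define c where "c = 24 * int (n div 49) + 23"
  have "int n = 49 * int (n div 49) + 47" using n by presburger
  then have c: "24 * int n - 1 = 49 * c" unfolding c_def by simp
  define X A1 A2 A3 A4 AJ2 AJ3 A2J2 AY J2 J22 J3 J4 N2 N4 N6 N8 K2 where defs: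
    "X = P $ n" "A1 = (P * j 1) $ n" "A2 = (P * (j 1)\<^sup>2) $ n" "A3 = (P * j 1 ^ 3) $ n" "A4 = (P * j 1 ^ 4) $ n"
    "AJ2 = (P * (j 1 * j 2)) $ n" "AJ3 = (P * (j 1 * j 3)) $ n" "A2J2 = (P * ((j 1)\<^sup>2 * j 2)) $ n"
    "AY = (P * (j 1 * y)) $ n" "J2 = (P * j 2) $ n" "J22 = (P * (j 2)\<^sup>2) $ n" "J3 = (P * j 3) $ n" "J4 = (P * j 4) $ n"
    "N2 = moment 2 $ n" "N4 = moment 4 $ n" "N6 = moment 6 $ n" "N8 = moment 8 $ n" "K2 = (P * k2) $ n"
  note rel = P_coeff_relations[of n, unfolded c, folded defs]
  note m4 = rank_moment_4[of n, unfolded c P_mult_simps, folded defs]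
  note m6 = rank_moment_6[of n, unfolded c P_mult_simps, folded defs]
  note m8 = rank_moment_8[of n, unfolded c P_mult_simps, folded defs]
  have "7 dvd (P * y) $ n"
    unfolding y_def P_factor_7(1) by (rule J_mult_mod_7[OF Ys n7])
  then obtain y0 where y0: "(P * y) $ n = 7 * y0" by (rule dvdE)
  have "7 dvd (P ^ 7 * (J 0 * J 0)) $ n" by (rule J_mult_mod_7[OF J_nonzero n7])
  then have "7 dvd X" unfolding defs P_factor_7(2)[symmetric] .
  then obtain x0 where x0: "X = 7 * x0" by (rule dvdE)
  have "7 dvd (P * j 2) $ n"
    unfolding j_def P_factor_7(1) by (rule J_mult_mod_7[OF J_nonzero n7])
  then obtain b0 where b0: "J2 = 7 * b0" unfolding defs by (rule dvdE)
  have J3: "J3 = X + 49 * y0" unfolding defs j3 by (simp add: P_mult_simps y0)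
  have "j 1 * j 3 = j 1 + 7 * (j 1 * y)" unfolding j3 by (simp add: algebra_simps)
  then have AJ3: "AJ3 = A1 + 7 * AY" unfolding defs by (simp only: P_mult_simps)
  obtain d0 where d0: "(P * Delta) $ n = 7 * d0" using P_Delta_mod_7[OF n] by (rule dvdE)
  have "2 * (j 1 * j 2) - j 1 ^ 3 = 1 - s * Delta + 7 * k3"
    unfolding ab[symmetric] by (simp add: power2_eq_square power3_eq_cube algebra_simps)
  then have "(P * (2 * (j 1 * j 2) - j 1 ^ 3)) $ n = (P * (1 - s * Delta + 7 * k3)) $ n" by simp
  then have "2 * AJ2 - A3 = X - (P * (s * Delta)) $ n + 7 * (P * k3) $ n"
    by (simp add: P_mult_simps defs)
  moreover have "(P * (s * Delta)) $ n = 7 * d0 \<or> (P * (s * Delta)) $ n = 7 * (- d0)"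
    using s d0 by auto
  ultimately obtain e0 where e0: "2 * AJ2 - A3 = 7 * e0"
  proof (elim disjE)
    assume "2 * AJ2 - A3 = X - (P * (s * Delta)) $ n + 7 * (P * k3) $ n" "(P * (s * Delta)) $ n = 7 * d0"
    then have "2 * AJ2 - A3 = 7 * (x0 - d0 + (P * k3) $ n)" unfolding x0 by simp
    then show ?thesis by (rule that)
  next
    assume "2 * AJ2 - A3 = X - (P * (s * Delta)) $ n + 7 * (P * k3) $ n" "(P * (s * Delta)) $ n = 7 * (- d0)"
    then have "2 * AJ2 - A3 = 7 * (x0 + d0 + (P * k3) $ n)" unfolding x0 by simp
    then show ?thesis by (rule that)
  qed
  have "4 * (j 2)\<^sup>2 - 4 * ((j 1)\<^sup>2 * j 2) + j 1 ^ 4 = j 1 + 7 * k2"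
    unfolding b2[symmetric] by (simp add: eval_nat_numeral algebra_simps)
  then have "(P * (4 * (j 2)\<^sup>2 - 4 * ((j 1)\<^sup>2 * j 2) + j 1 ^ 4)) $ n = (P * (j 1 + 7 * k2)) $ n" by simp
  then have b2': "4 * J22 - 4 * A2J2 + A4 = A1 + 7 * K2"
    unfolding defs by (simp only: P_mult_simps)
  obtain k8 where "N8 - N2 = 7 * k8"
    using moment_mod(2)[of n] unfolding defs by (rule dvdE)
  then have k8: "N8 = N2 + 7 * k8" by simp
  \<comment> \<open>Eliminating \<open>A3\<close> by \<open>e0\<close> makes the left-hand side a
    unit multiple of \<open>AJ2\<close>; the next line inverts 8 by 1 = 49 - 6 * 8, as similar lines
    do below.\<close>
  have "8 * AJ2 = 49 * (e0 - c * A2)" using rel(3) e0 by algebra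
  then have "AJ2 = 49 * (AJ2 - 6 * (e0 - c * A2))" by simp
  then obtain q where q: "AJ2 = 49 * q" by blast
  then have A3: "A3 = 7 * (14 * q - e0)" using e0 by simp
  have "3 * J3 = 49 * (4 * q + c * J2)" using rel(4) q by algebra
  then have "J3 = 49 * (J3 - 16 * (4 * q + c * J2))" by simp
  then obtain r where r: "J3 = 49 * r" by blast
  \<comment> \<open>So the partition number itself is divisible by 49 here.\<close>
  define x1 where "x1 = r - y0"
  have x1: "X = 49 * x1" using J3 r by (simp add: x1_def)
  have "240 * N4 - 120 * N2 = 7 * (12 * b0 - 35 * c * A1 - X - 7 * c * (120 * N2 - 10 * X))"
    using m4 rel(2) b0 by algebra
  then obtain z4 where z4: "240 * N4 - 120 * N2 = 7 * z4" by blast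
  have "13440 * N6 - 16800 * N4 + 5880 * N2 = 49 * (310 * x1 + 252 * q - 9 * r - 100 * (14 * q - e0)
      - c * (5040 * N4 - 2520 * N2 + 147 * X))"
    using m6 q r A3 x1 by algebra
  then obtain z6 where z6: "13440 * N6 - 16800 * N4 + 5880 * N2 = 49 * z6" by blast
  \<comment> \<open>After elimination of \<open>J4\<close> the quartic coefficients enter the
    eighth-moment relation with multiples of 7, so each of them is only needed modulo 7.\<close>
  define s0 where "s0 = AY - 7 * c * X"
  have s0: "AJ3 = 7 * s0" using AJ3 rel(1) unfolding s0_def by algebra
  define t1 where "t1 = A2J2 + 7 * c * AJ2 - 3 * s0"
  have "3 * J22 = 7 * t1" using rel(7) s0 unfolding t1_def by algebra
  then have "J22 = 7 * (J22 - 2 * t1)" by simp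
  then obtain t0 where t0: "J22 = 7 * t0" by blast
  define u where "u = K2 - 7 * c * X - 4 * t0"
  have A4: "A4 = 4 * A2J2 + 7 * u" using b2' t0 rel(1) unfolding u_def by algebra
  have "- 31 * A2J2 = 7 * (7 * c * A3 + 10 * u)" using rel(6) A4 by algebra
  then have "A2J2 = 7 * (- 5 * (7 * c * A3 + 10 * u) - 22 * A2J2)" by simp
  then obtain g0 where g0: "A2J2 = 7 * g0" by blast
  have h0: "A4 = 7 * (4 * g0 + u)" using A4 g0 by simp
  \<comment> \<open>Three times \<open>m8\<close>, so that \<open>rel(5)\<close> eliminates
    \<open>J4\<close>. Since \<open>N8\<close> is \<open>N2 + 7 * k8\<close>, the coefficient of
    \<open>N2\<close> is 3(80640 - 52080) = 85680, which is 7 times a unit modulo 7.\<close>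
  have "85680 * N2 = 49 * (100 * s0 - 5 * c * J3 + 108 * t0 - 1800 * g0 + 3000 * (4 * g0 + u) - 34560 * k8
      + 11520 * N6 - 10080 * N4 - 8001 * x1 - 3 * c * (26880 * N6 - 33600 * N4 + 11760 * N2 - 620 * X))"
    using m8 rel(5) s0 t0 g0 h0 k8 x1 by algebra
  then obtain z8 where "85680 * N2 = 49 * z8" by blast
  then have "N2 = 7 * (2 * z8 - 3497 * N2)" by simp
  then obtain n2 where n2: "N2 = 7 * n2" by blast
  have "N4 = 7 * (4 * (z4 + 120 * n2) - 137 * N4)" using z4 n2 by simp
  then obtain n4 where n4: "N4 = 7 * n4" by blast
  have "N6 = 7 * (4 * (z6 + 2400 * n4 - 840 * n2) - 1097 * N6)" using z6 n2 n4 by simp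
  then obtain n6 where n6: "N6 = 7 * n6" by blast
  show "7 dvd moment 2 $ n" "7 dvd moment 4 $ n" "7 dvd moment 6 $ n"
    using n2 n4 n6 unfolding defs by simp_all
qed

section \<open>Symmetrized moments in terms of power moments\<close>

lemma moment_odd: "odd k \<Longrightarrow> moment k $ n = 0"
proof -
  assume k: "odd k"
  have "(\<Sum>m\<in>{- int n..int n}. m ^ k * rank_num m (int n)) = (\<Sum>m\<in>{- int n..int n}. (- m) ^ k * rank_num (- m) (int n))"
    by (rule sum.reindex_bij_witness[of _ uminus uminus]) auto
  also have "\<dots> = - (\<Sum>m\<in>{- int n..int n}. m ^ k * rank_num m (int n))"
    using k by (simp add: rank_num_uminus sum_negf)
  finally show ?thesis by (simp add: moment_def)
qed

lemma sym_rank_moment_rank_num: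
  assumes "n > 0"
  shows "fact k * sym_rank_moment k n =
    (\<Sum>m\<in>{- int n..int n}. (\<Prod>i=0..<k. m + int ((k - 1) div 2) - int i) * rank_num m (int n))"
proof -
  have "sym_rank_moment k n =
      (\<Sum>m\<in>{- int n..int n}. int_choose (m + int ((k - 1) div 2)) k * int (rank_count m n))"
    unfolding sym_rank_moment_eq_sum
  proof (rule sum.mono_neutral_left)
    show "{m. rank_count m n \<noteq> 0} \<subseteq> {- int n..int n}"
      using rank_num_outside[of "int n"] rank_num_eq_rank_count[OF assms]
      by (auto simp: not_less[symmetric])
  qed auto
  then show ?thesis
    by (simp add: sum_distrib_left fact_mult_int_choose rank_num_eq_rank_count[OF assms] flip: mult.assoc)
qed

text \<open>The product (m+1)m(m-1)(m-2) is expanded; the odd moments vanish by the symmetry of the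
  rank.\<close>

lemma sym_rank_moment_4:
  assumes "n > 0"
  shows "24 * sym_rank_moment 4 n = moment 4 $ n - moment 2 $ n"
proof -
  have "24 * sym_rank_moment 4 n = (\<Sum>m\<in>{- int n..int n}. (\<Prod>i=0..<4. m + 1 - int i) * rank_num m (int n))"
    using sym_rank_moment_rank_num[OF assms, of 4] by (simp add: fact_numeral)
  also have "\<dots> = (\<Sum>m\<in>{- int n..int n}. (m ^ 4 - 2 * m ^ 3 - m ^ 2 + 2 * m ^ 1) * rank_num m (int n))"
    by (intro sum.cong refl) (simp add: eval_nat_numeral algebra_simps)
  also have "\<dots> = moment 4 $ n - 2 * moment 3 $ n - moment 2 $ n + 2 * moment 1 $ n"
    by (simp add: moment_def algebra_simps sum.distrib sum_subtractf sum_distrib_left)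
  finally show ?thesis by (simp add: moment_odd)
qed

lemma sym_rank_moment_6:
  assumes "n > 0"
  shows "720 * sym_rank_moment 6 n = moment 6 $ n - 5 * moment 4 $ n + 4 * moment 2 $ n"
proof -
  have "720 * sym_rank_moment 6 n = (\<Sum>m\<in>{- int n..int n}. (\<Prod>i=0..<6. m + 2 - int i) * rank_num m (int n))"
    using sym_rank_moment_rank_num[OF assms, of 6] by (simp add: fact_numeral)
  also have "\<dots> = (\<Sum>m\<in>{- int n..int n}. (m ^ 6 - 3 * m ^ 5 - 5 * m ^ 4 + 15 * m ^ 3 + 4 * m ^ 2 - 12 * m ^ 1) * rank_num m (int n))"
    by (intro sum.cong refl) (simp add: eval_nat_numeral algebra_simps)
  also have "\<dots> = moment 6 $ n - 3 * moment 5 $ n - 5 * moment 4 $ n + 15 * moment 3 $ n + 4 * moment 2 $ n - 12 * moment 1 $ n"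
    by (simp add: moment_def algebra_simps sum.distrib sum_subtractf sum_distrib_left)
  finally show ?thesis by (simp add: moment_odd)
qed

theorem theorem1p1:
  fixes n :: nat
  shows "[sym_rank_moment 4 (25 * n + 24) = 0] (mod 5) \<and>
         [sym_rank_moment 6 (49 * n + 47) = 0] (mod 7)"
proof
  have "(25 * n + 24) mod 25 = 24" by simp
  from moments_mod_5[OF this] have "5 dvd 24 * sym_rank_moment 4 (25 * n + 24)"
    by (subst sym_rank_moment_4) (auto intro: dvd_diff)
  then have "5 dvd sym_rank_moment 4 (25 * n + 24)"
    using prime_dvd_mult_iff[of "5 :: int" 24] by simp
  then show "[sym_rank_moment 4 (25 * n + 24) = 0] (mod 5)" by (simp add: cong_0_iff)
  have "(49 * n + 47) mod 49 = 47" by simp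
  from moments_mod_7[OF this] have "7 dvd 720 * sym_rank_moment 6 (49 * n + 47)"
    by (subst sym_rank_moment_6) (auto intro!: dvd_add dvd_diff)
  then have "7 dvd sym_rank_moment 6 (49 * n + 47)"
    using prime_dvd_mult_iff[of "7 :: int" 720] by simp
  then show "[sym_rank_moment 6 (49 * n + 47) = 0] (mod 7)" by (simp add: cong_0_iff)
qed

end
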